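(* Let $q$ be a prime power, and let $n,l,m$ be integers with $1<m<n-1$ and $l>0$. Then the full automorphism group of the association scheme $\mathfrak{X}_m$ is $\mathrm{Aut}(\mathfrak{X}_m)=P\Gamma L(n+l,\mathbb{F}_q)_E$.
   Context: Let $\mathbb{F}_q^{(n+l)}$ be the $(n+l)$-dimensional row vector space over $\mathbb{F}_q$, with standard basis $e_1,\dots,e_{n+l}$, and let $E=\langle e_{n+1},\dots,e_{n+l}\rangle$. An $m$-dimensional subspace $P$ is of type $(m,k)$ if $\dim(P\cap E)=k$. Let $X_m$ be the set of all subspaces of type $(m,0)$. For a subspace $P$ spanned by the rows of an $m\times(n+l)$ matrix, write the matrix as $(P'\ P'')$ with $P'$ consisting of the first $n$ columns and $P''$ of the last $l$ columns, and identify $P'$ with the subspace of $\mathbb{F}_q^{(n)}$ spanned by its rows. For $0\le i\le \min\{m,n-m\}$ and $0\le j-i\le\min\{m-i,j,l\}$ let $R_{i,j-i}=\{(P,Q)\in X_m\times X_m : \dim(P'\cap Q')=m-i,\ \dim(P\cap Q)=m-j\}$. The configuration $\mathfrak{X}_m=(X_m,\{R_{i,j-i}\})$ is a symmetric association scheme. An automorphism of $\mathfrak{X}_m$ is a permutation $\sigma$ of $X_m$ that induces a permutation of the relations, i.e. for each relation $R$ there is a relation $R^*$ such that $(\sigma(x),\sigma(y))\in R^*$ whenever $(x,y)\in R$; these form the group $\mathrm{Aut}(\mathfrak{X}_m)$. $P\Gamma L(n+l,\mathbb{F}_q)_E$ denotes the stabilizer of $E$ in $P\Gamma L(n+l,\mathbb{F}_q)$,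 acting on $X_m$ in the natural way on subspaces. *)

theory Defs
  imports "HOL-Analysis.Cartesian_Space" "HOL-Algebra.Coset" "HOL-Algebra.Bij"
begin

subsection \<open>Subspaces of type (m, k)\<close>

text \<open>
  The space of row vectors of length n + l over a field is rendered as
  \<open>'a ^ ('n + 'l)\<close> with n = \<open>CARD('n)\<close> and l = \<open>CARD('l)\<close>: the coordinates
  \<open>Inl i\<close> are the first n ones, the coordinates \<open>Inr j\<close> the last l ones.
\<close>

definition E_space :: "('a::field ^ ('n::finite + 'l::finite)) set" where
  "E_space = vec.span (range (\<lambda>j::'l. axis (Inr j) 1))"

definition has_type :: "nat \<Rightarrow> nat \<Rightarrow> ('a::field ^ ('n::finite + 'l::finite)) set \<Rightarrow> bool" where
  "has_type m k P \<longleftrightarrow> vec.subspace P \<and> vec.dim P = m \<and> vec.dim (P \<inter> E_space) = k"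

definition X :: "nat \<Rightarrow> ('a::field ^ ('n::finite + 'l::finite)) set set" where
  "X m = {P. has_type m 0 P}"

definition first_part :: "'a ^ ('n::finite + 'l::finite) \<Rightarrow> 'a ^ 'n" where
  "first_part v = (\<chi> i. v $ Inl i)"

text \<open>
  If P is the row space of the block matrix (P' P''), then the row space of P' is the image
  of P under \<^const>\<open>first_part\<close>.
\<close>

definition prime_part :: "('a ^ ('n::finite + 'l::finite)) set \<Rightarrow> ('a ^ 'n) set" where
  "prime_part P = first_part ` P"

subsection \<open>The scheme and its automorphism group\<close>

definition scheme_rel ::
  "nat \<Rightarrow> nat \<Rightarrow> nat \<Rightarrow>
    (('a::field ^ ('n::finite + 'l::finite)) set \<times> ('a ^ ('n + 'l)) set) set" where
  "scheme_rel m i j = {(P, Q) \<in> X m \<times> X m.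
     vec.dim (prime_part P \<inter> prime_part Q) = m - i \<and> vec.dim (P \<inter> Q) = m - j}"

text \<open>
  \<open>scheme_rel m i j\<close> is the relation with index pair (i, j - i). In the index range below
  i \<open>\<le>\<close> j \<open>\<le>\<close> m and i \<open>\<le>\<close> m, so that none of the natural-number subtractions truncates
  (provided m \<open>\<le>\<close> n).
\<close>

definition scheme_rels ::
  "nat \<Rightarrow> (('a::field ^ ('n::finite + 'l::finite)) set \<times> ('a ^ ('n + 'l)) set) set set" where
  "scheme_rels m = {scheme_rel m i j | i j.
     i \<le> min m (CARD('n) - m) \<and> i \<le> j \<and> j - i \<le> min (min (m - i) j) CARD('l)}"

definition scheme_auts :: "'x set \<Rightarrow> ('x \<times> 'x) set set \<Rightarrow> ('x \<Rightarrow> 'x) set" where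
  "scheme_auts S Rs = {\<sigma> \<in> Bij S. \<forall>R\<in>Rs. \<exists>R'\<in>Rs. \<forall>(x, y)\<in>R. (\<sigma> x, \<sigma> y) \<in> R'}"

definition AutX :: "nat \<Rightarrow> (('a::field ^ ('n::finite + 'l::finite)) set \<Rightarrow> ('a ^ ('n + 'l)) set) monoid"
  where "AutX m = (BijGroup (X m))\<lparr>carrier := scheme_auts (X m) (scheme_rels m)\<rparr>"

subsection \<open>The projective semilinear group and the stabilizer of E\<close>

definition field_aut :: "('a::field \<Rightarrow> 'a) \<Rightarrow> bool" where
  "field_aut \<tau> \<longleftrightarrow> bij \<tau> \<and> (\<forall>a b. \<tau> (a + b) = \<tau> a + \<tau> b) \<and> (\<forall>a b. \<tau> (a * b) = \<tau> a * \<tau> b)"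

definition semilinear :: "('a::field ^ 'k::finite \<Rightarrow> 'a ^ 'k) \<Rightarrow> bool" where
  "semilinear g \<longleftrightarrow> (\<forall>u v. g (u + v) = g u + g v) \<and>
     (\<exists>\<tau>. field_aut \<tau> \<and> (\<forall>c v. g (c *s v) = \<tau> c *s g v))"

definition GammaL :: "('a::field ^ 'k::finite \<Rightarrow> 'a ^ 'k) monoid" where
  "GammaL = \<lparr>carrier = {g. bij g \<and> semilinear g}, mult = (\<circ>), one = id\<rparr>"

definition scalar_maps :: "('a::field ^ 'k::finite \<Rightarrow> 'a ^ 'k) set" where
  "scalar_maps = {(\<lambda>v. c *s v) | c. c \<noteq> 0}"

definition PGammaL :: "('a::field ^ 'k::finite \<Rightarrow> 'a ^ 'k) set monoid" where
  "PGammaL = GammaL Mod scalar_maps"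

text \<open>
  The representatives of a class C differ by scalars, so they all send a subspace P to the
  same subspace, which is therefore the union below.
\<close>

definition pact :: "('a::field ^ 'k::finite \<Rightarrow> 'a ^ 'k) set \<Rightarrow> ('a ^ 'k) set \<Rightarrow> ('a ^ 'k) set" where
  "pact C P = (\<Union>g\<in>C. g ` P)"

definition PGammaL_E :: "('a::field ^ ('n::finite + 'l::finite) \<Rightarrow> 'a ^ ('n + 'l)) set monoid" where
  "PGammaL_E = PGammaL\<lparr>carrier := {C \<in> carrier PGammaL. pact C E_space = E_space}\<rparr>"

definition X_action ::
  "nat \<Rightarrow> ('a::field ^ ('n::finite + 'l::finite) \<Rightarrow> 'a ^ ('n + 'l)) set \<Rightarrow>
    ('a ^ ('n + 'l)) set \<Rightarrow> ('a ^ ('n + 'l)) set" where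
  "X_action m C = (\<lambda>P\<in>X m. pact C P)"

subsection \<open>Well-definedness\<close>

lemma field_aut_comp: "field_aut \<sigma> \<Longrightarrow> field_aut \<tau> \<Longrightarrow> field_aut (\<sigma> \<circ> \<tau>)"
  by (auto simp: field_aut_def bij_comp)

lemma field_aut_inv:
  assumes "field_aut \<tau>" shows "field_aut (inv_into UNIV \<tau>)"
proof -
  let ?r = "inv_into UNIV \<tau>"
  have b: "bij \<tau>" using assms by (simp add: field_aut_def)
  have 1: "\<tau> (?r x) = x" "?r (\<tau> x) = x" for x
    using b by (simp_all add: bij_is_surj surj_f_inv_f bij_is_inj)
  have "\<tau> (?r x + ?r y) = x + y" "\<tau> (?r x * ?r y) = x * y" for x y
    using assms 1(1) by (simp_all add: field_aut_def)
  then have "?r (x + y) = ?r x + ?r y" "?r (x * y) = ?r x * ?r y" for x y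
    using 1(2)[of "?r x + ?r y"] 1(2)[of "?r x * ?r y"] by simp_all
  then show ?thesis by (simp add: field_aut_def bij_imp_bij_inv[OF b])
qed

lemma field_aut_nonzero:
  assumes "field_aut \<tau>" "c \<noteq> 0" shows "\<tau> c \<noteq> 0"
proof -
  have "\<tau> (0 + 0) = \<tau> 0 + \<tau> 0" using assms(1) unfolding field_aut_def by blast
  then have "\<tau> 0 = 0" by (metis add_0_right add_left_cancel)
  moreover have "inj \<tau>" using assms(1) by (simp add: field_aut_def bij_is_inj)
  ultimately show ?thesis using assms(2) injD[of \<tau> c 0] by auto
qed

lemma semilinear_inv:
  assumes "bij g" "semilinear g" shows "semilinear (inv_into UNIV g)"
proof -
  let ?r = "inv_into UNIV g"
  have 1: "g (?r x) = x" "?r (g x) = x" for x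
    using assms(1) by (simp_all add: bij_is_surj surj_f_inv_f bij_is_inj)
  obtain \<tau> where t: "field_aut \<tau>" "\<And>c v. g (c *s v) = \<tau> c *s g v"
    using assms(2) by (auto simp: semilinear_def)
  have 2: "\<tau> (inv_into UNIV \<tau> c) = c" for c
    using t(1) by (simp add: field_aut_def bij_is_surj surj_f_inv_f)
  have "g (?r u + ?r v) = u + v" for u v
    using assms(2) 1(1) by (simp add: semilinear_def)
  then have "?r (u + v) = ?r u + ?r v" for u v
    using 1(2)[of "?r u + ?r v"] by simp
  moreover have "?r (c *s v) = inv_into UNIV \<tau> c *s ?r v" for c v
    using 1(2)[of "inv_into UNIV \<tau> c *s ?r v"] by (simp add: t(2) 1(1) 2)
  ultimately show ?thesis using field_aut_inv[OF t(1)] by (auto simp: semilinear_def)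
qed

lemma group_GammaL: "group (GammaL :: ('a::field ^ 'k::finite \<Rightarrow> 'a ^ 'k) monoid)"
proof (rule groupI)
  fix f g :: "'a ^ 'k \<Rightarrow> 'a ^ 'k"
  assume "f \<in> carrier GammaL" "g \<in> carrier GammaL"
  then have bf: "bij f" "bij g" and s: "semilinear f" "semilinear g"
    by (auto simp: GammaL_def)
  obtain \<sigma> \<tau> where "field_aut \<sigma>" "\<And>c v. f (c *s v) = \<sigma> c *s f v"
    "field_aut \<tau>" "\<And>c v. g (c *s v) = \<tau> c *s g v"
    using s by (auto simp: semilinear_def)
  then have "semilinear (f \<circ> g)"
    using s field_aut_comp[of \<sigma> \<tau>] by (auto simp: semilinear_def intro!: exI[of _ "\<sigma> \<circ> \<tau>"])
  then show "f \<otimes>\<^bsub>GammaL\<^esub> g \<in> carrier GammaL"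
    using bf by (simp add: GammaL_def bij_comp)
next
  have "field_aut (id :: 'a \<Rightarrow> 'a)" by (simp add: field_aut_def)
  then show "\<one>\<^bsub>GammaL\<^esub> \<in> carrier (GammaL :: ('a ^ 'k \<Rightarrow> 'a ^ 'k) monoid)"
    by (auto simp: GammaL_def semilinear_def)
next
  fix f :: "'a ^ 'k \<Rightarrow> 'a ^ 'k"
  assume f: "f \<in> carrier GammaL"
  then have "inv_into UNIV f \<in> carrier GammaL"
    using semilinear_inv by (auto simp: GammaL_def bij_imp_bij_inv)
  moreover have "inv_into UNIV f \<otimes>\<^bsub>GammaL\<^esub> f = \<one>\<^bsub>GammaL\<^esub>"
    using f by (simp add: GammaL_def bij_is_inj)
  ultimately show "\<exists>g\<in>carrier GammaL. g \<otimes>\<^bsub>GammaL\<^esub> f = \<one>\<^bsub>GammaL\<^esub>" by blast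
qed (auto simp: GammaL_def)

lemma scalar_mapsI: "c \<noteq> 0 \<Longrightarrow> (*s) c \<in> scalar_maps"
  unfolding scalar_maps_def by blast

lemma scalar_maps_in_GammaL: "scalar_maps \<subseteq> carrier GammaL"
proof
  fix s :: "'a ^ 'b \<Rightarrow> 'a ^ 'b" assume "s \<in> scalar_maps"
  then obtain c where c: "c \<noteq> 0" "s = (\<lambda>v. c *s v)" by (auto simp: scalar_maps_def)
  have "bij s"
    by (rule bij_betw_byWitness[where f' = "\<lambda>v. inverse c *s v"]) (use c in auto)
  moreover have "field_aut (id :: 'a \<Rightarrow> 'a)" by (simp add: field_aut_def)
  ultimately show "s \<in> carrier GammaL"
    using c by (auto simp: GammaL_def semilinear_def vec.scale_right_distrib mult.commute
        intro!: exI[of _ id])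
qed

lemma normal_scalar_maps:
  "scalar_maps \<lhd> (GammaL :: ('a::field ^ 'k::finite \<Rightarrow> 'a ^ 'k) monoid)"
proof -
  interpret G: group "GammaL :: ('a ^ 'k \<Rightarrow> 'a ^ 'k) monoid" by (rule group_GammaL)
  have inv_eq: "inv\<^bsub>GammaL\<^esub> f = inv_into UNIV f" if f: "f \<in> carrier GammaL" for f :: "'a ^ 'k \<Rightarrow> 'a ^ 'k"
  proof (rule G.inv_equality[OF _ f])
    show "inv_into UNIV f \<in> carrier GammaL"
      using f semilinear_inv by (auto simp: GammaL_def bij_imp_bij_inv)
    show "inv_into UNIV f \<otimes>\<^bsub>GammaL\<^esub> f = \<one>\<^bsub>GammaL\<^esub>"
      using f by (simp add: GammaL_def bij_is_inj)
  qed
  have sub: "subgroup (scalar_maps :: ('a ^ 'k \<Rightarrow> 'a ^ 'k) set) GammaL"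
  proof (rule G.subgroupI[OF scalar_maps_in_GammaL])
    show "(scalar_maps :: ('a ^ 'k \<Rightarrow> 'a ^ 'k) set) \<noteq> {}"
      unfolding scalar_maps_def using zero_neq_one[symmetric] by blast
  next
    fix s :: "'a ^ 'k \<Rightarrow> 'a ^ 'k" assume s: "s \<in> scalar_maps"
    then obtain c where c: "c \<noteq> 0" "s = (\<lambda>v. c *s v)" by (auto simp: scalar_maps_def)
    have sG: "s \<in> carrier GammaL" using s scalar_maps_in_GammaL by blast
    have r: "(\<lambda>v. inverse c *s v) \<in> (scalar_maps :: ('a ^ 'k \<Rightarrow> 'a ^ 'k) set)"
      using c(1) by (intro scalar_mapsI) simp
    have "inv\<^bsub>GammaL\<^esub> s = (\<lambda>v. inverse c *s v)"
    proof (rule G.inv_equality[OF _ sG])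
      show "(\<lambda>v. inverse c *s v :: 'a ^ 'k) \<in> carrier GammaL"
        by (rule subsetD[OF scalar_maps_in_GammaL r])
      show "(\<lambda>v. inverse c *s v) \<otimes>\<^bsub>GammaL\<^esub> s = \<one>\<^bsub>GammaL\<^esub>"
        unfolding c(2) GammaL_def by (rule ext) (simp add: c(1) vector_smult_assoc)
    qed
    then show "inv\<^bsub>GammaL\<^esub> s \<in> scalar_maps" using r by simp
  next
    fix s t :: "'a ^ 'k \<Rightarrow> 'a ^ 'k" assume "s \<in> scalar_maps" "t \<in> scalar_maps"
    then obtain c d where "c \<noteq> 0" "s = (\<lambda>v. c *s v)" "d \<noteq> 0" "t = (\<lambda>v. d *s v)"
      by (auto simp: scalar_maps_def)
    moreover from this have "s \<otimes>\<^bsub>GammaL\<^esub> t = (*s) (c * d)"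
      by (simp add: GammaL_def comp_def vector_smult_assoc)
    ultimately show "s \<otimes>\<^bsub>GammaL\<^esub> t \<in> scalar_maps"
      using scalar_mapsI[of "c * d"] by simp
  qed
  moreover have "g \<otimes>\<^bsub>GammaL\<^esub> s \<otimes>\<^bsub>GammaL\<^esub> inv\<^bsub>GammaL\<^esub> g \<in> scalar_maps"
    if g: "g \<in> carrier GammaL" and s: "s \<in> scalar_maps" for g s :: "'a ^ 'k \<Rightarrow> 'a ^ 'k"
  proof -
    obtain c where c: "c \<noteq> 0" "s = (\<lambda>v. c *s v)" using s by (auto simp: scalar_maps_def)
    obtain \<tau> where t: "field_aut \<tau>" "\<And>c v. g (c *s v) = \<tau> c *s g v"
      using g by (auto simp: GammaL_def semilinear_def)
    have "g (inv_into UNIV g v) = v" for v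
      using g by (simp add: GammaL_def bij_is_surj surj_f_inv_f)
    then have "g \<otimes>\<^bsub>GammaL\<^esub> s \<otimes>\<^bsub>GammaL\<^esub> inv_into UNIV g = (*s) (\<tau> c)"
      by (simp add: c(2) t(2) GammaL_def comp_def)
    then show ?thesis
      unfolding inv_eq[OF g] using scalar_mapsI[OF field_aut_nonzero[OF t(1) c(1)]] by simp
  qed
  ultimately show ?thesis unfolding G.normal_inv_iff by blast
qed

lemma pact_coset:
  assumes g: "g \<in> carrier GammaL" and P: "vec.subspace P"
  shows "pact (scalar_maps #>\<^bsub>GammaL\<^esub> g) P = g ` P"
proof -
  obtain \<tau> where t: "field_aut \<tau>" "\<And>c v. g (c *s v) = \<tau> c *s g v"
    using g by (auto simp: GammaL_def semilinear_def)
  have "c *s g v \<in> g ` P" if "v \<in> P" for c v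
  proof -
    obtain d where d: "\<tau> d = c" using t(1) by (metis bij_pointE field_aut_def)
    then have "c *s g v = g (d *s v)" using t(2) by simp
    then show ?thesis using that P by (simp add: vec.subspace_scale)
  qed
  moreover have "g v = 1 *s g v" for v by simp
  ultimately show ?thesis
    unfolding pact_def r_coset_def scalar_maps_def GammaL_def
    by (fastforce simp del: vector_smult_lid intro: exI[of _ "1::'a"])
qed

end

theory Submission
  imports Defs
begin

text \<open>
  Write \<open>sh P\<close> = P + E, so that P' = Q' iff \<open>sh P = sh Q\<close>; the sets of all P with a given \<open>sh P\<close> are
  the fibres. An automorphism permutes the relations bijectively, hence so does its inverse.

  It preserves fibres: the pull-back of ``same fibre'' is an equivalence relation and a union of
  relations of the scheme. If it relates two members P, Q of different fibres, then a shear fixing P and moving Q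
  shows that it contains the pairs at distance one in a fibre, hence all pairs in a common fibre.
  So one of the two equivalence relations contains the other, and they have the same number of
  pairs.

  It preserves adjacency, i.e. \<open>dim (P \<inter> Q) = m - 1\<close> and P' \<open>\<noteq>\<close> Q': the number of members of the fibre of Q
  in the same relation to P as Q is at most \<open>q\<^sup>l\<close> for adjacent P, Q and at least
  \<open>q\<^sup>2\<^sup>l\<close> if \<open>dim (P' \<inter> Q') \<le> m - 2\<close>; among the relations with \<open>dim (P' \<inter> Q') = m - 1\<close> only
  adjacency can be transitive on three pairwise adjacent fibres.

  Fibres and adjacency determine, for each S of type (m - 1, 0), the set of all P containing S,
  because a triangle formed by two members of one fibre and a common neighbour in another fibre has a common
  hyperplane. Thus the automorphism descends to type (m - 1, 0) and finally to the points outside E, where the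
  argument of the fundamental theorem of projective geometry yields a semilinear map.
\<close>

subsection \<open>Sums of subspaces and semilinear images\<close>

text \<open>An automorphism may a priori permute the index pairs arbitrarily, so nothing about
  dimensions of intersections is given in advance. Counting inside a fibre controls only how the
  shadows \<open>sh P\<close> meet. Moreover, the images of three fibres of a pencil are at first
  only known to be pairwise adjacent, possibly without forming a pencil, so the configuration that
  violates transitivity has to be built in both situations. The assumption l > 0 enters through
  triangles. Three pairwise adjacent members of different fibres need not share a hyperplane, as
  they may instead lie in a common (m + 1)-space; this is the ambiguity known from Grassmann graphs.
  Two members of one fibre together with a common neighbour leave no such alternative, and a nonzero
  vector of E is what produces them. The points of E itself are invisible. The semilinear map is
  therefore first found outside a larger subspace, additivity then forces its values on the rest,
  and E is treated last.\<close>

definition subspace_sum :: "('a::field ^ 'k::finite) set \<Rightarrow> ('a ^ 'k) set \<Rightarrow> ('a ^ 'k) set" where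
  "subspace_sum P Q = {x + y |x y. x \<in> P \<and> y \<in> Q}"

lemma subspace_subspace_sum: "vec.subspace P \<Longrightarrow> vec.subspace Q \<Longrightarrow> vec.subspace (subspace_sum P Q)"
  unfolding subspace_sum_def by (rule vec.subspace_sums)

lemma dim_subspace_sum:
  "vec.subspace P \<Longrightarrow> vec.subspace Q \<Longrightarrow>
    vec.dim (subspace_sum P Q) + vec.dim (P \<inter> Q) = vec.dim P + vec.dim Q"
  unfolding subspace_sum_def by (rule vec.dim_sums_Int)

lemma subspace_sum_subset_left: "vec.subspace Q \<Longrightarrow> P \<subseteq> subspace_sum P Q"
  unfolding subspace_sum_def using vec.subspace_0 by force

lemma subspace_sum_subset_right: "vec.subspace P \<Longrightarrow> Q \<subseteq> subspace_sum P Q"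
  unfolding subspace_sum_def using vec.subspace_0 by force

lemma subspace_sum_least: "vec.subspace C \<Longrightarrow> P \<subseteq> C \<Longrightarrow> Q \<subseteq> C \<Longrightarrow> subspace_sum P Q \<subseteq> C"
  unfolding subspace_sum_def using vec.subspace_add by blast

lemma subspace_sum_mono: "P \<subseteq> P' \<Longrightarrow> Q \<subseteq> Q' \<Longrightarrow> subspace_sum P Q \<subseteq> subspace_sum P' Q'"
  unfolding subspace_sum_def by blast

lemma span_insert_subspace:
  "vec.subspace S \<Longrightarrow> x \<in> vec.span (insert a S) \<longleftrightarrow> (\<exists>k. x - k *s a \<in> S)"
  by (simp add: vec.span_breakdown_eq vec.span_eq_iff[THEN iffD2])

lemma dim_span_insert:
  "vec.subspace S \<Longrightarrow> x \<notin> S \<Longrightarrow> vec.dim (vec.span (insert x S)) = Suc (vec.dim S)"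
  by (simp add: vec.dim_insert vec.span_eq_iff[THEN iffD2])

lemma span_insert_exchange:
  "vec.subspace S \<Longrightarrow> y \<in> vec.span (insert x S) \<Longrightarrow> y \<notin> S \<Longrightarrow> x \<in> vec.span (insert y S)"
  by (rule vec.in_span_insert) (simp_all add: vec.span_eq_iff[THEN iffD2])

lemma span_insert_least: "vec.subspace C \<Longrightarrow> x \<in> C \<Longrightarrow> S \<subseteq> C \<Longrightarrow> vec.span (insert x S) \<subseteq> C"
  by (intro vec.span_minimal) auto

lemma subspace_dim_less_exists:
  assumes "vec.subspace S" "vec.subspace T" "vec.dim S < vec.dim T"
  shows "\<exists>x\<in>T. x \<notin> S"
  using assms vec.dim_subset[of T S] by fastforce

lemma exists_notin:
  fixes S :: "('a::field ^ 'k::finite) set"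
  assumes "vec.dim S < CARD('k)"
  shows "\<exists>x. x \<notin> S"
proof (rule ccontr)
  assume "\<not> ?thesis"
  then have "S = UNIV" by auto
  then show False using assms vec_dim_card[where 'a = 'a and 'n = 'k] by simp
qed

lemma span_insert_eq:
  assumes "vec.subspace S" "vec.subspace T" "S \<subseteq> T" "x \<in> T" "x \<notin> S" "vec.dim T = Suc (vec.dim S)"
  shows "vec.span (insert x S) = T"
  by (rule vec.subspace_dim_equal) (use assms dim_span_insert[of S x] span_insert_least[of T x S] in auto)

lemma subspace_image:
  assumes "vec.subspace S" "semilinear g"
  shows "vec.subspace (g ` S)"
proof -
  obtain \<tau> where t: "field_aut \<tau>" "\<And>c v. g (c *s v) = \<tau> c *s g v"
    using assms(2) by (auto simp: semilinear_def)
  have add: "g (u + v) = g u + g v" for u v using assms(2) by (simp add: semilinear_def)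
  have "g 0 = 0" using add[of 0 0] by simp
  moreover have "c *s g v \<in> g ` S" if "v \<in> S" for c v
  proof -
    obtain d where d: "\<tau> d = c" using t(1) by (metis bij_pointE field_aut_def)
    then have "c *s g v = g (d *s v)" using t(2) by simp
    then show ?thesis using that assms(1) by (simp add: vec.subspace_scale)
  qed
  moreover have "g u + g v \<in> g ` S" if "u \<in> S" "v \<in> S" for u v
    using that assms(1) by (metis add imageI vec.subspace_add)
  ultimately show ?thesis using assms(1)
    by (auto simp: vec.subspace_def)
qed

lemma dim_semilinear_image_le:
  assumes "semilinear g"
  shows "vec.dim (g ` S) \<le> vec.dim S"
proof -
  obtain B where B: "B \<subseteq> S" "vec.independent B" "S \<subseteq> vec.span B" "card B = vec.dim S"
    using vec.basis_exists[of S] by auto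
  have fin: "finite B" using B(2) by (simp add: vec.finiteI_independent)
  obtain \<tau> where t: "\<And>c v. g (c *s v) = \<tau> c *s g v"
    using assms by (auto simp: semilinear_def)
  have add: "g (u + v) = g u + g v" for u v using assms by (simp add: semilinear_def)
  have "g 0 = 0" using add[of 0 0] by simp
  then have "g x \<in> vec.span (g ` B)" if "x \<in> vec.span B" for x
    using that subsetD[OF vec.span_minimal[of B "{x. g x \<in> vec.span (g ` B)}"]]
    by (auto simp: vec.subspace_def add t vec.span_zero vec.span_add vec.span_scale vec.span_base subset_iff)
  then have "g ` S \<subseteq> vec.span (g ` B)" using B(3) by auto
  then have "vec.dim (g ` S) \<le> card (g ` B)"
    using fin by (intro vec.dim_le_card) auto
  then show ?thesis using card_image_le[OF fin, of g] B(4) by simp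
qed

lemma dim_semilinear_image:
  assumes "semilinear g" "bij g"
  shows "vec.dim (g ` S) = vec.dim S"
proof -
  have "inv_into UNIV g ` g ` S = S" using assms(2) by (simp add: bij_is_inj image_inv_f_f)
  then have "vec.dim S \<le> vec.dim (g ` S)"
    using dim_semilinear_image_le[OF semilinear_inv[OF assms(2,1)], of "g ` S"] by simp
  then show ?thesis using dim_semilinear_image_le[OF assms(1), of S] by simp
qed

lemma image_subspace_sum:
  assumes "semilinear g"
  shows "g ` subspace_sum P Q = subspace_sum (g ` P) (g ` Q)"
proof -
  have add: "g (u + v) = g u + g v" for u v using assms by (simp add: semilinear_def)
  show ?thesis unfolding subspace_sum_def by (force simp: add image_iff)
qed

lemma linear_imp_semilinear:
  assumes "Vector_Spaces.linear (*s) (*s) g"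
  shows "semilinear g"
proof -
  interpret Vector_Spaces.linear "(*s)" "(*s)" g by fact
  have "field_aut id" by (simp add: field_aut_def)
  then show ?thesis unfolding semilinear_def by (auto simp: add scale intro!: exI[of _ id])
qed

text \<open>A basis of \<open>S\<close> extended by \<open>v\<close> leaves the value at
  \<open>v\<close> free. These maps are the building blocks of the shears used later.\<close>

lemma rank_one_map_exists:
  fixes S :: "('a::field ^ 'k::finite) set" and e :: "'a ^ 'k"
  assumes "vec.subspace S" "v \<notin> S"
  shows "\<exists>h. Vector_Spaces.linear (*s) (*s) h \<and> (\<forall>x\<in>S. h x = 0) \<and> h v = e \<and> range h \<subseteq> vec.span {e}"
proof -
  obtain B where B: "B \<subseteq> S" "vec.independent B" "S \<subseteq> vec.span B" "card B = vec.dim S"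
    using vec.basis_exists[of S] by auto
  have v: "v \<notin> vec.span B" using B(1) assms vec.span_minimal[of B S] by auto
  then have ind: "vec.independent (insert v B)" using B(2) vec.independent_insertI by blast
  obtain h where h: "Vector_Spaces.linear (*s) (*s) h"
      "\<forall>x\<in>insert v B. h x = (if x = v then e else 0)"
      "range h = vec.span ((\<lambda>x. if x = v then e else 0) ` insert v B)"
    using vec.linear_independent_extend_subspace[OF ind, of "\<lambda>x. if x = v then e else 0"] by blast
  interpret h: Vector_Spaces.linear "(*s)" "(*s)" h by fact
  have "v \<notin> B" using v vec.span_base by blast
  then have "h x = 0" if "x \<in> B" for x using h(2) that by auto
  then have "h x = 0" if "x \<in> S" for x using h.eq_0_on_span B(3) that by blast
  moreover have "range h \<subseteq> vec.span {e}" unfolding h(3)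
    by (rule vec.span_minimal) (use vec.span_base[of e "{e}"] vec.span_zero in auto)
  moreover have "h v = e" using h(2) by simp
  ultimately show ?thesis using h(1) by metis
qed

subsection \<open>Subspaces meeting E trivially\<close>

locale attenuated =
  fixes E :: "('a::{field,finite} ^ 'k::finite) set"
  assumes subspace_E: "vec.subspace E" and E_nontrivial: "E \<noteq> {0}"
begin

definition sh :: "('a ^ 'k) set \<Rightarrow> ('a ^ 'k) set" where "sh P = subspace_sum P E"

definition Xm :: "nat \<Rightarrow> ('a ^ 'k) set set" where
  "Xm k = {P. vec.subspace P \<and> vec.dim P = k \<and> P \<inter> E = {0}}"

text \<open>The successor avoids a truncated subtraction: for \<open>k = 0\<close> no pair is
  adjacent.\<close>

definition adj :: "nat \<Rightarrow> ('a ^ 'k) set \<Rightarrow> ('a ^ 'k) set \<Rightarrow> bool" where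
  "adj k P Q \<longleftrightarrow> P \<in> Xm k \<and> Q \<in> Xm k \<and> Suc (vec.dim (P \<inter> Q)) = k \<and> sh P \<noteq> sh Q"

lemma XmD:
  assumes "P \<in> Xm k"
  shows "vec.subspace P" "vec.dim P = k" "P \<inter> E = {0}"
  using assms by (auto simp: Xm_def)

lemma XmI: "vec.subspace P \<Longrightarrow> vec.dim P = k \<Longrightarrow> P \<inter> E = {0} \<Longrightarrow> P \<in> Xm k"
  by (simp add: Xm_def)

lemma subspace_sh [simp]: "vec.subspace P \<Longrightarrow> vec.subspace (sh P)"
  unfolding sh_def by (intro subspace_subspace_sum subspace_E)

lemma subspace_Xm [simp]: "P \<in> Xm k \<Longrightarrow> vec.subspace P"
  by (rule XmD)

lemma subset_sh: "P \<subseteq> sh P"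
  unfolding sh_def by (rule subspace_sum_subset_left[OF subspace_E])

lemma E_subset_sh: "vec.subspace P \<Longrightarrow> E \<subseteq> sh P"
  unfolding sh_def by (rule subspace_sum_subset_right)

lemma sh_least: "vec.subspace C \<Longrightarrow> E \<subseteq> C \<Longrightarrow> P \<subseteq> C \<Longrightarrow> sh P \<subseteq> C"
  unfolding sh_def by (rule subspace_sum_least)

lemma sh_mono: "P \<subseteq> Q \<Longrightarrow> sh P \<subseteq> sh Q"
  unfolding sh_def by (intro subspace_sum_mono) auto

lemma in_sh: "x \<in> sh P \<longleftrightarrow> (\<exists>e\<in>E. x + e \<in> P)"
proof
  assume "x \<in> sh P"
  then obtain p e where "p \<in> P" "e \<in> E" "x = p + e" unfolding sh_def subspace_sum_def by blast
  then show "\<exists>e\<in>E. x + e \<in> P" using subspace_E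
    by (intro bexI[of _ "- e"]) (auto simp: vec.subspace_neg)
next
  assume "\<exists>e\<in>E. x + e \<in> P"
  then obtain e where "e \<in> E" "x + e \<in> P" by blast
  moreover from this have "- e \<in> E" using subspace_E by (simp add: vec.subspace_neg)
  ultimately have "(x + e) + (- e) \<in> sh P" unfolding sh_def subspace_sum_def by blast
  then show "x \<in> sh P" by simp
qed

lemma dim_sh: "P \<in> Xm k \<Longrightarrow> vec.dim (sh P) = k + vec.dim E"
  using dim_subspace_sum[OF _ subspace_E, of P] XmD[of P k] unfolding sh_def by simp

text \<open>The sum with \<open>E\<close> has full dimension only if the intersection is zero, so
  membership can be tested on the shadow.\<close>

lemma Xm_dimI:
  assumes "vec.subspace P" "vec.dim (sh P) = vec.dim P + vec.dim E"
  shows "P \<in> Xm (vec.dim P)"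
proof -
  have "vec.dim (P \<inter> E) = 0"
    using dim_subspace_sum[of P E] subspace_E assms unfolding sh_def by simp
  then have "P \<inter> E \<subseteq> {0}" by simp
  moreover have "0 \<in> P \<inter> E" using vec.subspace_0[OF assms(1)] vec.subspace_0[OF subspace_E] by simp
  ultimately have "P \<inter> E = {0}" by blast
  then show ?thesis using assms(1) by (intro XmI) auto
qed

lemma sh_eqI:
  assumes "P \<in> Xm k" "Q \<in> Xm k" "sh P \<subseteq> sh Q"
  shows "sh P = sh Q"
  using assms vec.subspace_dim_equal[of "sh P" "sh Q"] dim_sh[of P k] dim_sh[of Q k] by simp

lemma sub_Xm:
  assumes "P \<in> Xm k" "vec.subspace S" "S \<subseteq> P"
  shows "S \<in> Xm (vec.dim S)"
  using XmD(3)[OF assms(1)] assms(2,3) vec.subspace_0[OF subspace_E] vec.subspace_0[OF assms(2)]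
  by (intro XmI) auto

text \<open>This is the modular law: a subspace between \<open>E\<close> and \<open>P + E\<close> is
  the sum of its trace on \<open>P\<close> and \<open>E\<close>. Hence subspaces of the shadow above
  \<open>E\<close> can be replaced by subspaces of any chosen member of the fibre.\<close>

lemma trace:
  assumes P: "P \<in> Xm k" and C: "vec.subspace C" "E \<subseteq> C" "C \<subseteq> sh P"
  shows "sh (P \<inter> C) = C" "P \<inter> C \<in> Xm (vec.dim (P \<inter> C))" "vec.dim C = vec.dim (P \<inter> C) + vec.dim E"
proof -
  have s: "vec.subspace (P \<inter> C)" using P C by (simp add: vec.subspace_inter)
  show 1: "sh (P \<inter> C) = C"
  proof
    show "sh (P \<inter> C) \<subseteq> C" using C by (intro sh_least) auto
    show "C \<subseteq> sh (P \<inter> C)"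
    proof
      fix c assume c: "c \<in> C"
      then obtain e where e: "e \<in> E" "c + e \<in> P" using C(3) in_sh by blast
      then have "c + e \<in> C" using c C by (meson subsetD vec.subspace_add)
      then show "c \<in> sh (P \<inter> C)" using e in_sh by blast
    qed
  qed
  show 2: "P \<inter> C \<in> Xm (vec.dim (P \<inter> C))" by (rule sub_Xm[OF P s]) simp
  show "vec.dim C = vec.dim (P \<inter> C) + vec.dim E" using dim_sh[OF 2] 1 by simp
qed

text \<open>By \<open>trace\<close>, the left side has the dimension of \<open>S\<close>. Thus a
  subspace of \<open>P\<close> can be read off from its shadow.\<close>

lemma Int_sh_sub:
  assumes "P \<in> Xm k" "vec.subspace S" "S \<subseteq> P"
  shows "P \<inter> sh S = S"
proof -
  have "vec.dim (sh S) = vec.dim S + vec.dim E" using dim_sh[OF sub_Xm[OF assms]] .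
  moreover have "vec.dim (sh S) = vec.dim (P \<inter> sh S) + vec.dim E"
    by (rule trace(3)[OF assms(1)]) (use assms sh_mono E_subset_sh in auto)
  ultimately show ?thesis
    using vec.subspace_dim_equal[of S "P \<inter> sh S"] assms subset_sh[of S] by (auto simp: vec.subspace_inter)
qed

lemma sh_span_insert:
  assumes "vec.subspace P"
  shows "sh (vec.span (insert x P)) = vec.span (insert x (sh P))"
proof
  have "P \<subseteq> vec.span (insert x (sh P))" "E \<subseteq> vec.span (insert x (sh P))" "x \<in> vec.span (insert x (sh P))"
    using subset_sh[of P] E_subset_sh[OF assms] by (auto intro: vec.span_base)
  then show "sh (vec.span (insert x P)) \<subseteq> vec.span (insert x (sh P))"
    by (intro sh_least vec.span_minimal) auto
  have "x \<in> vec.span (insert x P)" by (simp add: vec.span_base)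
  moreover have "P \<subseteq> vec.span (insert x P)" by (auto intro: vec.span_base)
  ultimately show "vec.span (insert x (sh P)) \<subseteq> sh (vec.span (insert x P))"
    using subset_sh sh_mono[of P "vec.span (insert x P)"] by (intro vec.span_minimal) auto
qed

lemma insert_Xm:
  assumes "P \<in> Xm k" "x \<notin> sh P"
  shows "vec.span (insert x P) \<in> Xm (Suc k)"
proof -
  have "x \<notin> P" using assms subset_sh by blast
  then have d: "vec.dim (vec.span (insert x P)) = Suc k" using dim_span_insert[of P x] assms XmD[of P k] by simp
  have "vec.dim (sh (vec.span (insert x P))) = Suc (k + vec.dim E)"
    using sh_span_insert[of P x] dim_span_insert[of "sh P" x] assms dim_sh[of P k] by simp
  then show ?thesis using Xm_dimI[of "vec.span (insert x P)"] d by simp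
qed

lemma dim_sh_insert:
  assumes "P \<in> Xm k" "x \<notin> sh P"
  shows "vec.dim (vec.span (insert x (sh P))) = Suc (k + vec.dim E)"
  using dim_span_insert[of "sh P" x] assms dim_sh[of P k] by simp

lemma adj_sym: "adj k P Q \<longleftrightarrow> adj k Q P"
  by (auto simp: adj_def Int_commute)

lemma dim_sh_Int_less:
  assumes "P \<in> Xm k" "Q \<in> Xm k" "sh P \<noteq> sh Q"
  shows "vec.dim (sh P \<inter> sh Q) < k + vec.dim E"
proof (rule ccontr)
  assume "\<not> ?thesis"
  then have "sh P \<inter> sh Q = sh P"
    using assms dim_sh[of P k] by (intro vec.subspace_dim_equal) (auto simp: vec.subspace_inter)
  then show False using assms sh_eqI by blast
qed

lemma dim_Int_le:
  assumes "P \<in> Xm k" "Q \<in> Xm k"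
  shows "vec.dim (P \<inter> Q) + vec.dim E \<le> vec.dim (sh P \<inter> sh Q)"
proof -
  have "P \<inter> Q \<in> Xm (vec.dim (P \<inter> Q))" using assms by (intro sub_Xm[of P k]) (auto simp: vec.subspace_inter)
  then have "vec.dim (P \<inter> Q) + vec.dim E = vec.dim (sh (P \<inter> Q))" using dim_sh by simp
  also have "\<dots> \<le> vec.dim (sh P \<inter> sh Q)" by (intro vec.dim_subset) (simp add: sh_mono)
  finally show ?thesis .
qed

lemma adj_dim_sh:
  assumes "adj k P Q"
  shows "Suc (vec.dim (sh P \<inter> sh Q)) = k + vec.dim E"
  using assms dim_Int_le[of P k Q] dim_sh_Int_less[of P k Q] unfolding adj_def by simp

text \<open>The shadows of adjacent members meet in the smallest dimension that
  \<open>P \<inter> Q\<close> permits, so the trace of \<open>sh Q\<close> on \<open>P\<close> is no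
  larger than \<open>P \<inter> Q\<close>. Consequently the intersection with a neighbour depends
  only on the fibre of that neighbour.\<close>

lemma adj_Int:
  assumes "adj k P Q"
  shows "P \<inter> sh Q = P \<inter> Q"
proof -
  have PQ: "P \<in> Xm k" "Q \<in> Xm k" using assms by (auto simp: adj_def)
  have "vec.dim (sh P \<inter> sh Q) = vec.dim (P \<inter> (sh P \<inter> sh Q)) + vec.dim E"
    by (rule trace(3)[OF PQ(1)]) (use PQ in \<open>auto simp: vec.subspace_inter E_subset_sh\<close>)
  moreover have "P \<inter> (sh P \<inter> sh Q) = P \<inter> sh Q" using subset_sh by blast
  ultimately have "vec.dim (P \<inter> sh Q) = vec.dim (P \<inter> Q)"
    using adj_dim_sh[OF assms] assms by (simp add: adj_def)
  then show ?thesis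
    using vec.subspace_dim_equal[of "P \<inter> Q" "P \<inter> sh Q"] PQ subset_sh[of Q] by (auto simp: vec.subspace_inter)
qed

lemma mixed_triangle:
  assumes "adj k P Q" "adj k R Q" "sh P = sh R" "P \<noteq> R"
  shows "P \<inter> R = P \<inter> Q" "R \<inter> Q = P \<inter> Q" "Suc (vec.dim (P \<inter> R)) = k"
proof -
  have X: "P \<in> Xm k" "Q \<in> Xm k" "R \<in> Xm k" using assms by (auto simp: adj_def)
  \<comment> \<open>Both intersections are the trace on \<open>Q\<close> of the one shadow that
    \<open>P\<close> and \<open>R\<close> share.\<close>
  have "P \<inter> Q = Q \<inter> sh P" "R \<inter> Q = Q \<inter> sh R"
    using adj_Int[of k Q P] adj_Int[of k Q R] assms adj_sym by blast+
  then show e: "R \<inter> Q = P \<inter> Q" using assms by simp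
  have s: "vec.subspace (P \<inter> R)" "vec.subspace (P \<inter> Q)" using X by (auto simp: vec.subspace_inter)
  have "vec.dim (P \<inter> R) < k"
  proof (rule ccontr)
    assume "\<not> ?thesis"
    then have "P \<inter> R = P" "P \<inter> R = R"
      using X XmD(2)[OF X(1)] XmD(2)[OF X(3)] s vec.subspace_dim_equal[of "P \<inter> R" P]
        vec.subspace_dim_equal[of "P \<inter> R" R] by auto
    then show False using assms(4) by simp
  qed
  moreover have "P \<inter> Q \<subseteq> P \<inter> R" using e by blast
  moreover have "Suc (vec.dim (P \<inter> Q)) = k" using assms by (simp add: adj_def)
  ultimately show "P \<inter> R = P \<inter> Q"
    using vec.subspace_dim_equal[of "P \<inter> Q" "P \<inter> R"] s by auto
  then show "Suc (vec.dim (P \<inter> R)) = k" using \<open>Suc (vec.dim (P \<inter> Q)) = k\<close> by simp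
qed

definition star :: "nat \<Rightarrow> ('a ^ 'k) set \<Rightarrow> ('a ^ 'k) set set" where
  "star k S = {P \<in> Xm k. S \<subseteq> P}"

text \<open>Shadows of different fibres meet in a proper subspace of each, which bounds
  \<open>dim (P \<inter> Q)\<close> by \<open>k\<close>; the subspace \<open>S\<close> attains the
  bound.\<close>

lemma adj_star:
  assumes "P \<in> Xm (Suc k)" "Q \<in> Xm (Suc k)" "S \<in> Xm k" "S \<subseteq> P" "S \<subseteq> Q" "sh P \<noteq> sh Q"
  shows "adj (Suc k) P Q" "P \<inter> Q = S"
proof -
  have s: "vec.subspace (P \<inter> Q)" using assms by (auto simp: vec.subspace_inter)
  have "vec.dim (P \<inter> Q) \<ge> k" using assms XmD[of S k] vec.dim_subset[of S "P \<inter> Q"] by auto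
  moreover have "vec.dim (P \<inter> Q) \<le> k"
    using dim_Int_le[of P "Suc k" Q] dim_sh_Int_less[of P "Suc k" Q] assms by simp
  ultimately have "vec.dim (P \<inter> Q) = k" by simp
  then show "adj (Suc k) P Q" "P \<inter> Q = S" using assms s vec.subspace_dim_equal[of S "P \<inter> Q"] XmD[of S k]
    by (auto simp: adj_def)
qed

text \<open>The right side speaks only of fibres and adjacency, so a bijection respecting both
  carries stars to stars. The case split is forced because adjacency never holds inside a fibre: a
  \<open>T\<close> in the fibre of \<open>P\<close> is tested against \<open>Q\<close>, and any
  other \<open>T\<close> must itself complete \<open>P\<close> and \<open>R\<close> to a mixed
  triangle.\<close>

lemma star_mixed_triangle:
  assumes "adj (Suc k) P Q" "adj (Suc k) R Q" "sh P = sh R" "P \<noteq> R"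
  shows "star (Suc k) (P \<inter> R) = {T \<in> Xm (Suc k). if sh T = sh P then adj (Suc k) T Q
     else adj (Suc k) T P \<and> adj (Suc k) T R}"
proof -
  note m = mixed_triangle[OF assms]
  have X: "P \<in> Xm (Suc k)" "Q \<in> Xm (Suc k)" "R \<in> Xm (Suc k)" using assms by (auto simp: adj_def)
  have S: "P \<inter> R \<in> Xm k" using sub_Xm[of P "Suc k" "P \<inter> R"] X m(3) by (auto simp: vec.subspace_inter)
  have "sh P \<noteq> sh Q" using assms by (simp add: adj_def)
  have "P \<inter> R \<subseteq> T \<longleftrightarrow> (if sh T = sh P then adj (Suc k) T Q else adj (Suc k) T P \<and> adj (Suc k) T R)"
    if T: "T \<in> Xm (Suc k)" for T
  proof (cases "sh T = sh P")
    case True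
    have "adj (Suc k) T Q" if "P \<inter> R \<subseteq> T"
      by (rule adj_star(1)[OF T X(2) S that]) (use m True \<open>sh P \<noteq> sh Q\<close> in auto)
    moreover have "P \<inter> R \<subseteq> T" if a: "adj (Suc k) T Q"
    proof (cases "T = P")
      case False
      then show ?thesis using mixed_triangle[OF a assms(1)] True m by auto
    qed simp
    ultimately show ?thesis using True by auto
  next
    case False
    have "adj (Suc k) T P \<and> adj (Suc k) T R" if "P \<inter> R \<subseteq> T"
      using adj_star(1)[OF T X(1) S that] adj_star(1)[OF T X(3) S that] False assms(3) by auto
    moreover have "P \<inter> R \<subseteq> T" if a: "adj (Suc k) T P" "adj (Suc k) T R"
    proof -
      have "adj (Suc k) P T" "adj (Suc k) R T" using a by (auto simp: adj_sym)
      then show ?thesis using mixed_triangle(1)[of "Suc k" P T R] assms by blast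
    qed
    ultimately show ?thesis using False by auto
  qed
  then show ?thesis unfolding star_def by blast
qed

text \<open>Two vectors \<open>x\<close>, \<open>y\<close> independent modulo \<open>sh S\<close>
  give two different fibres, which requires codimension at least two. A nonzero \<open>e\<close> of
  \<open>E\<close> gives the second member, spanned by \<open>x + e\<close>, in the fibre belonging
  to \<open>x\<close>.\<close>

lemma mixed_triangle_exists:
  assumes S: "S \<in> Xm k" and k: "Suc k + vec.dim E < CARD('k)"
  obtains P Q R where "adj (Suc k) P Q" "adj (Suc k) R Q" "sh P = sh R" "P \<noteq> R" "P \<inter> R = S"
proof -
  have sS: "vec.subspace S" using S by simp
  have "vec.dim (sh S) < CARD('k)" using dim_sh[OF S] k by simp
  then obtain x where x: "x \<notin> sh S"
    using exists_notin by blast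
  have dx: "vec.dim (vec.span (insert x (sh S))) < CARD('k)" using dim_sh_insert[OF S x] k by simp
  then obtain y where y: "y \<notin> vec.span (insert x (sh S))"
    using exists_notin by blast
  obtain e where e: "e \<in> E" "e \<noteq> 0" using E_nontrivial vec.subspace_0[OF subspace_E] by blast
  let ?P = "vec.span (insert x S)" and ?Q = "vec.span (insert y S)" and ?R = "vec.span (insert (x + e) S)"
  have eS: "e \<in> sh S" using subsetD[OF E_subset_sh[OF sS] e(1)] .
  have xe: "x + e \<notin> sh S"
  proof
    assume "x + e \<in> sh S"
    then have "x + e - e \<in> sh S" using eS S by (metis vec.subspace_diff subspace_sh subspace_Xm)
    then show False using x by simp
  qed
  have yS: "y \<notin> sh S" using y by (auto intro: vec.span_base)
  have X: "?P \<in> Xm (Suc k)" "?Q \<in> Xm (Suc k)" "?R \<in> Xm (Suc k)"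
    using insert_Xm[OF S] x yS xe by auto
  have sub: "S \<subseteq> ?P" "S \<subseteq> ?Q" "S \<subseteq> ?R" by (auto intro: vec.span_base)
  have shP: "sh ?P = vec.span (insert x (sh S))" using sh_span_insert[OF sS] .
  have "?R \<subseteq> sh ?P" unfolding shP using eS
    by (intro vec.span_minimal) (auto intro: vec.span_base vec.span_add subsetD[OF subset_sh])
  then have "sh ?R \<subseteq> sh ?P" using X by (intro sh_least E_subset_sh) auto
  then have eq: "sh ?P = sh ?R" using sh_eqI[OF X(3,1)] by simp
  have "y \<in> sh ?Q" using subset_sh[of ?Q] by (auto intro: vec.span_base)
  then have ne: "sh ?P \<noteq> sh ?Q" using y shP by auto
  have "?P \<noteq> ?R"
  proof
    assume "?P = ?R"
    then have "x + e \<in> ?P" "x \<in> ?P" by (auto intro: vec.span_base)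
    then have "x + e - x \<in> ?P" by (intro vec.span_diff)
    then have "e \<in> ?P \<inter> E" using e by simp
    then show False using e XmD(3)[OF X(1)] by auto
  qed
  moreover have "adj (Suc k) ?P ?Q" "adj (Suc k) ?R ?Q"
    using adj_star(1)[OF X(1,2) S] adj_star(1)[OF X(3,2) S] sub ne eq by auto
  moreover have "?P \<inter> ?R = S"
    using mixed_triangle(1)[OF calculation(2,3) eq calculation(1)] adj_star(2)[OF X(1,2) S] sub ne by auto
  ultimately show thesis using that eq by blast
qed

text \<open>A star determines its centre. This is used for the injectivity of the descended map and
  for the faithfulness of the action.\<close>

lemma Inter_star:
  assumes S: "S \<in> Xm k" and k: "Suc k + vec.dim E < CARD('k)"
  shows "\<Inter> (star (Suc k) S) = S" "star (Suc k) S \<noteq> {}"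
proof -
  obtain P Q R where "adj (Suc k) P Q" "adj (Suc k) R Q" "sh P = sh R" "P \<noteq> R" "P \<inter> R = S"
    using mixed_triangle_exists[OF assms] .
  then have "P \<in> star (Suc k) S" "R \<in> star (Suc k) S" by (auto simp: star_def adj_def)
  then show "\<Inter> (star (Suc k) S) = S" "star (Suc k) S \<noteq> {}" using \<open>P \<inter> R = S\<close> by (auto simp: star_def)
qed

end


subsection \<open>Recovering a semilinear map from its action on points\<close>

lemma not_in_span_insert:
  fixes S :: "('a::field ^ 'k::finite) set"
  assumes S: "vec.subspace S" and u: "u \<notin> S" and v: "v \<notin> vec.span (insert u S)"
    and ab: "a *s u + b *s v \<in> S"
  shows "a = 0 \<and> b = 0"
proof -
  have "b = 0"
  proof (rule ccontr)
    assume b: "b \<noteq> 0"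
    have "inverse b *s (a *s u + b *s v) \<in> S" using ab S by (rule vec.subspace_scale[rotated])
    also have "inverse b *s (a *s u + b *s v) = v - (- (inverse b * a)) *s u"
      using b by (simp add: vec.scale_right_distrib)
    finally show False using v span_insert_subspace[OF S] by blast
  qed
  moreover have "a = 0"
  proof (rule ccontr)
    assume a: "a \<noteq> 0"
    have "inverse a *s (a *s u) \<in> S" by (rule vec.subspace_scale[OF S]) (use ab \<open>b = 0\<close> in simp)
    then show False using a u by simp
  qed
  ultimately show ?thesis by simp
qed

text \<open>Additivity is given only for pairs independent modulo \<open>S\<close>, and the values
  of \<open>g\<close> on \<open>S\<close> are discarded. For \<open>e\<close> in \<open>S\<close>
  the increment \<open>g (y + e) - g y\<close> does not depend on \<open>y\<close> and becomes the
  value at \<open>e\<close>. Pairs dependent modulo \<open>S\<close> are compared through a third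
  vector, which exists because \<open>S\<close> has codimension at least two.\<close>

lemma additive_extension:
  fixes S :: "('a::field ^ 'k::finite) set" and g :: "'a ^ 'k \<Rightarrow> 'b::ab_group_add"
  assumes S: "vec.subspace S" and dim: "Suc (vec.dim S) < CARD('k)"
    and g: "\<And>y z. y \<notin> S \<Longrightarrow> z \<notin> vec.span (insert y S) \<Longrightarrow> g (y + z) = g y + g z"
  shows "\<exists>G. (\<forall>u v. G (u + v) = G u + G v) \<and> (\<forall>y. y \<notin> S \<longrightarrow> G y = g y)"
proof -
  let ?N = "\<lambda>y. vec.span (insert y S)"
  have SN: "x \<in> ?N y" if "x \<in> S" for x y using that by (simp add: vec.span_base)
  have yN: "y \<in> ?N y" for y by (simp add: vec.span_base)
  have NN: "?N z \<subseteq> ?N y" if "z \<in> ?N y" for y z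
    using that by (intro vec.span_minimal) (auto simp: SN)
  have ex: "\<exists>z. z \<notin> ?N y" for y
    using dim vec.dim_insert[of y S] by (intro exists_notin) (auto split: if_splits)
  have ex2: "y \<notin> ?N z" if "y \<notin> S" "z \<notin> ?N y" for y z
    using that span_insert_exchange[OF S, of y z] by blast
  have addS: "y + e \<notin> S" if "y \<notin> S" "e \<in> S" for y e
    using that S vec.subspace_diff[OF S, of "y + e" e] by auto
  have addN: "z + e \<notin> ?N y" if "z \<notin> ?N y" "e \<in> ?N y" for y z e
    using that vec.span_diff[of "z + e" "insert y S" e] by auto
  have step1: "g (y + e) - g y = g (z + e) - g z" if "y \<notin> S" "z \<notin> ?N y" "e \<in> S" for y z e
  \<comment> \<open>The value of \<open>g\<close> at \<open>y + z + e\<close> is computed twice,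
    with \<open>e\<close> attached to \<open>z\<close> and with \<open>e\<close> attached to
    \<open>y\<close>.\<close>
  proof -
    have zS: "z \<notin> S" using that SN by blast
    have "g (y + (z + e)) = g y + g (z + e)" using that by (intro g addN SN)
    moreover have "g (z + (y + e)) = g z + g (y + e)" using that zS ex2 by (intro g addN SN)
    moreover have "y + (z + e) = z + (y + e)" by simp
    ultimately show ?thesis by (metis add_diff_cancel_left' add_diff_eq diff_add_eq)
  qed
  have step2: "g (y + e) - g y = g (z + e) - g z" if "y \<notin> S" "z \<notin> S" "e \<in> S" for y z e
  proof (cases "z \<in> ?N y")
    case True
    obtain w where w: "w \<notin> ?N y" using ex by blast
    then have "w \<notin> ?N z" using NN[OF True] by blast
    then show ?thesis using step1[OF that(1) w that(3)] step1[OF that(2) _ that(3)] by simp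
  qed (rule step1[OF that(1) _ that(3)])
  obtain y0 where y0: "y0 \<notin> S" using ex SN by blast
  define G where "G v = (if v \<in> S then g (y0 + v) - g y0 else g v)" for v
  have GS: "g (y + e) = g y + G e" if "y \<notin> S" "e \<in> S" for y e
    using step2[OF that(1) y0 that(2)] that unfolding G_def by (simp add: algebra_simps)
  have "G (u + v) = G u + G v" for u v
  proof -
    consider "u \<in> S" "v \<in> S" | "u \<in> S" "v \<notin> S" | "u \<notin> S" "v \<in> S" | "u \<notin> S" "v \<notin> ?N u"
      | "u \<notin> S" "v \<notin> S" "v \<in> ?N u" by blast
    then show ?thesis
    proof cases
      case 1
      have "g (y0 + u + v) = g (y0 + u) + G v" using GS addS[OF y0] 1 by blast
      moreover have "g (y0 + u) = g y0 + G u" "g (y0 + (u + v)) = g y0 + G (u + v)"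
        using GS y0 1 vec.subspace_add[OF S] by blast+
      ultimately show ?thesis by (simp add: add.assoc)
    next
      case 2
      then show ?thesis using GS[of v u] addS[of v u] by (simp add: G_def add.commute)
    next
      case 3
      then show ?thesis using GS[of u v] addS[of u v] by (simp add: G_def)
    next
      case 4
      then have "v \<notin> S" using SN by blast
      moreover have "u + v \<notin> S" using addN[OF 4(2) yN] SN by (metis add.commute)
      ultimately show ?thesis using 4 g by (simp add: G_def)
    next
      case 5
      obtain w where w: "w \<notin> ?N u" using ex by blast
      then have "w \<notin> S" "w \<notin> ?N v" using SN NN[OF 5(3)] by blast+
      have vw: "v + w \<notin> ?N u" using addN[OF w 5(3)] by (simp add: add.commute)
      have e: "g ((u + v) + w) = g u + g v + g w"
        using g[OF 5(1) vw] g[OF 5(2) \<open>w \<notin> ?N v\<close>] by (simp add: add.assoc)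
      have uv: "u + v \<in> ?N u" using 5 yN by (intro vec.span_add)
      show ?thesis
      proof (cases "u + v \<in> S")
        case True
        have "g (w + (u + v)) = g w + G (u + v)" using GS \<open>w \<notin> S\<close> True by blast
        then have "g w + G (u + v) = g w + (g u + g v)" using e by (simp add: ac_simps)
        then show ?thesis using 5 by (simp add: G_def)
      next
        case False
        have "w \<notin> ?N (u + v)" using NN[OF uv] w by blast
        then have "g ((u + v) + w) = g (u + v) + g w" using g False by blast
        then show ?thesis using e 5 False by (simp add: G_def)
      qed
    qed
  qed
  then show ?thesis by (intro exI[of _ G]) (simp add: G_def)
qed

text \<open>
  A permutation of the points outside \<open>E\<close> is encoded by the relation \<open>R v w\<close>: the point of \<open>v\<close> is sent
  to the point of \<open>w\<close>. The last two assumptions say that it respects cosets of \<open>E\<close> and collinearity.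
\<close>

locale projectivity = attenuated E
  for E :: "('a::{field,finite} ^ 'k::finite) set" +
  fixes R :: "'a ^ 'k \<Rightarrow> 'a ^ 'k \<Rightarrow> bool"
  assumes dim_quot: "vec.dim E + 3 \<le> CARD('k)"
    and R_ex: "v \<notin> E \<Longrightarrow> \<exists>w. R v w"
    and R_notin: "R v w \<Longrightarrow> v \<notin> E \<and> w \<notin> E"
    and R_unique: "R v w \<Longrightarrow> R v w' \<Longrightarrow> \<exists>c. w' = c *s w"
    and R_inj: "R u w \<Longrightarrow> R v w \<Longrightarrow> \<exists>c. v = c *s u"
    and R_scale: "R v w \<Longrightarrow> c \<noteq> 0 \<Longrightarrow> R v (c *s w)" "R v w \<Longrightarrow> c \<noteq> 0 \<Longrightarrow> R (c *s v) w"
    and R_fibre: "R u u' \<Longrightarrow> R v v' \<Longrightarrow> u \<in> vec.span (insert v E) \<longleftrightarrow> u' \<in> vec.span (insert v' E)"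
    and R_line: "R u u' \<Longrightarrow> R v v' \<Longrightarrow> R w w' \<Longrightarrow> u \<notin> vec.span (insert v E) \<Longrightarrow>
      (\<exists>a b. w = a *s u + b *s v) \<longleftrightarrow> (\<exists>a b. w' = a *s u' + b *s v')"
begin

lemma in_span_insert_E: "x \<in> vec.span (insert a E) \<longleftrightarrow> (\<exists>k. x - k *s a \<in> E)"
  by (rule span_insert_subspace[OF subspace_E])

lemmas indep2 = not_in_span_insert[OF subspace_E]

lemma notin_sym:
  assumes "u \<notin> E" "v \<notin> vec.span (insert u E)"
  shows "u \<notin> vec.span (insert v E)" "v \<notin> E"
  using assms span_insert_exchange[OF subspace_E, of u v] by (auto intro: vec.span_base)

text \<open>
  Fixing a representative \<open>g\<close> of the image of \<open>x\<close> normalizes the representatives of all other images.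
\<close>

lemma unique_rep:
  assumes x: "R x g" and y: "y \<notin> vec.span (insert x E)"
  shows "\<exists>!w. R y w \<and> R (x + y) (g + w)"
proof -
  have xE: "x \<notin> E" "g \<notin> E" using R_notin x by blast+
  note y' = notin_sym[OF xE(1) y]
  have xy: "x + y \<notin> E"
  proof
    assume "x + y \<in> E"
    then have "1 *s x + 1 *s y \<in> E" by simp
    then show False using indep2[OF xE(1) y] by fastforce
  qed
  obtain w1 where w1: "R y w1" using R_ex y' by blast
  have w1E: "w1 \<notin> E" using w1 R_notin by blast
  have gw1: "w1 \<notin> vec.span (insert g E)" using R_fibre[OF w1 x] y by simp
  obtain t where t: "R (x + y) t" using R_ex xy by blast
  have tE: "t \<notin> E" using t R_notin by blast
  have "\<exists>a b. x + y = a *s x + b *s y" by (intro exI[of _ 1]) simp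
  then obtain a b where ab: "t = a *s g + b *s w1" using R_line[OF x w1 t y'(1)] by blast
  have a: "a \<noteq> 0"
  proof
    assume "a = 0"
    then have "t = b *s w1" "b \<noteq> 0" using ab tE vec.subspace_0[OF subspace_E] by auto
    then have "R y t" using R_scale w1 by simp
    then obtain c where "x + y = c *s y" using R_inj t by blast
    then have "1 *s x + (1 - c) *s y = 0" by (simp add: algebra_simps vector_sub_rdistrib)
    then show False using indep2[OF xE(1) y, of 1 "1 - c"] vec.subspace_0[OF subspace_E] by simp
  qed
  have b: "b \<noteq> 0"
  proof
    assume "b = 0"
    then have "t = a *s g" using ab by simp
    then have "R x t" using R_scale x a by simp
    then obtain c where "x + y = c *s x" using R_inj t by blast
    then have "(1 - c) *s x + 1 *s y = 0" by (simp add: algebra_simps vector_sub_rdistrib)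
    then show False using indep2[OF xE(1) y, of "1 - c" 1] vec.subspace_0[OF subspace_E] by simp
  qed
  \<comment> \<open>Rescaling \<open>t\<close> so that \<open>g\<close> gets coefficient one leaves
    exactly this multiple of \<open>w1\<close> as the other summand.\<close>
  define w where "w = (b / a) *s w1"
  have w: "R y w" unfolding w_def using R_scale(1)[OF w1] a b by simp
  have "t = a *s (g + w)" using ab a by (simp add: w_def vec.scale_right_distrib)
  then have "g + w = inverse a *s t" using a by simp
  then have 2: "R (x + y) (g + w)" using R_scale(1)[OF t, of "inverse a"] a by simp
  have gw: "w \<notin> vec.span (insert g E)" using R_fibre[OF w x] y by simp
  have "w' = w" if w': "R y w'" "R (x + y) (g + w')" for w'
  proof -
    obtain c where c: "w' = c *s w" using R_unique[OF w w'(1)] by blast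
    obtain d where "g + w' = d *s (g + w)" using R_unique[OF 2 w'(2)] by blast
    then have "(1 - d) *s g + (c - d) *s w = 0"
      unfolding c by (simp add: algebra_simps vector_sub_rdistrib)
    then have "1 - d = 0 \<and> c - d = 0"
      using indep2[OF xE(2) gw, of "1 - d" "c - d"] vec.subspace_0[OF subspace_E] by simp
    then show ?thesis using c by simp
  qed
  then show ?thesis using w 2 by blast
qed

lemma line_notin:
  assumes "R u u'" "R v v'" "R w w'" "v \<notin> vec.span (insert u E)" "w \<notin> vec.span (insert v (vec.span (insert u E)))"
  shows "w' \<noteq> a *s u' + b *s v'"
proof
  assume eq: "w' = a *s u' + b *s v'"
  have "u \<notin> vec.span (insert v E)" using notin_sym(1)[OF _ assms(4)] R_notin assms by blast
  then obtain c d where "w = c *s u + d *s v" using R_line[OF assms(1,2,3)] eq by blast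
  then have "w \<in> vec.span (insert v (vec.span (insert u E)))"
    by (auto intro!: vec.span_add vec.span_scale intro: vec.span_base)
  then show False using assms(5) by simp
qed

lemma rep_add:
  assumes x: "R x g" and y: "y \<notin> vec.span (insert x E)" and z: "z \<notin> vec.span (insert y (vec.span (insert x E)))"
    and Ry: "R y gy" "R (x + y) (g + gy)" and Rz: "R z gz" "R (x + z) (g + gz)"
    and Ryz: "R (y + z) gyz" "R (x + (y + z)) (g + gyz)"
  shows "gyz = gy + gz"
proof -
  let ?N = "vec.span (insert x E)" and ?M = "vec.span (insert y (vec.span (insert x E)))"
  have xE: "x \<notin> E" "g \<notin> E" using R_notin x by blast+
  have sN: "vec.subspace ?N" by simp
  have zx: "z \<notin> ?N" using z vec.span_base by blast
  have "y \<notin> vec.span (insert z ?N)" using span_insert_exchange[OF sN, of y z] y z by blast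
  have zy: "z \<notin> vec.span (insert y E)"
  proof -
    have "vec.span (insert y E) \<subseteq> ?M" by (intro vec.span_minimal) (auto intro: vec.span_base)
    then show ?thesis using z by blast
  qed
  note y' = notin_sym[OF xE(1) y] and z' = notin_sym[OF xE(1) zx]
  note yz' = notin_sym[OF y'(2) zy]
  have xM: "x \<in> ?M" "y \<in> ?M" by (auto intro: vec.span_base)
  have yM: "vec.span (insert (x + y) E) \<subseteq> ?M"
    using xM by (intro vec.span_minimal) (auto intro: vec.span_base vec.span_add)
  have lin: "a = 0 \<and> b = 0 \<and> c = 0" if "a *s g + b *s gy + c *s gz = 0" for a b c
  proof -
    have c: "c = 0"
    proof (rule ccontr)
      assume c: "c \<noteq> 0"
      have "gz = (- (a / c)) *s g + (- (b / c)) *s gy"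
      proof -
        have "inverse c *s (a *s g + b *s gy + c *s gz) = 0" unfolding that by simp
        then show ?thesis using c
          by (simp add: vec.scale_right_distrib divide_inverse mult.commute vec.scale_minus_left eq_neg_iff_add_eq_0 add_eq_0_iff)
      qed
      then show False using line_notin[OF x Ry(1) Rz(1) y z] by blast
    qed
    have "gy \<notin> vec.span (insert g E)" using R_fibre[OF Ry(1) x] y by simp
    then show ?thesis using indep2[OF xE(2), of gy a b] that c vec.subspace_0[OF subspace_E] by simp
  qed
  have eq3: "a = a' \<and> b = b' \<and> c = c'" if "a *s g + b *s gy + c *s gz = a' *s g + b' *s gy + c' *s gz"
    for a b c a' b' c'
    using lin[of "a - a'" "b - b'" "c - c'"] that by (simp add: algebra_simps vector_sub_rdistrib)
  \<comment> \<open>The point of \<open>x + y + z\<close> lies on two lines, whose images meet in the point of \<open>g + gy + gz\<close>.\<close>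
  have one: "\<exists>a b. (x + y) + z = a *s (x + y) + b *s z" "\<exists>a b. (x + z) + y = a *s (x + z) + b *s y"
    "\<exists>a b. y + z = a *s y + b *s z"
    by (intro exI[of _ 1]; simp)+
  have n1: "x + y \<notin> vec.span (insert z E)"
  proof -
    have "z \<notin> vec.span (insert (x + y) E)" using yM z by blast
    then show ?thesis using notin_sym(1)[of "x + y" z] R_notin[OF Ry(2)] by blast
  qed
  have n2: "x + z \<notin> vec.span (insert y E)"
  proof
    assume a: "x + z \<in> vec.span (insert y E)"
    have "vec.span (insert y E) \<subseteq> ?M" by (intro vec.span_minimal) (auto intro: vec.span_base)
    then have "x + z - x \<in> ?M" using a xM by (intro vec.span_diff) blast
    then show False using z by simp
  qed
  have R1: "R ((x + y) + z) (g + gyz)" and R2: "R ((x + z) + y) (g + gyz)"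
    using Ryz(2) by (simp_all add: ac_simps)
  obtain a b where ab: "g + gyz = a *s (g + gy) + b *s gz"
    using R_line[OF Ry(2) Rz(1) R1 n1] one(1) by blast
  obtain c d where cd: "g + gyz = c *s (g + gz) + d *s gy"
    using R_line[OF Rz(2) Ry(1) R2 n2] one(2) by blast
  have "a *s g + a *s gy + b *s gz = c *s g + d *s gy + c *s gz"
    using ab cd by (simp add: vec.scale_right_distrib ac_simps)
  then have "b = a" using eq3 by blast
  then have e1: "g + gyz = a *s g + a *s gy + a *s gz" using ab by (simp add: vec.scale_right_distrib)
  \<comment> \<open>The point of \<open>y + z\<close> is on the line of \<open>y\<close> and
    \<open>z\<close>, so \<open>gyz\<close> has no component along \<open>g\<close>. The coefficient
    of \<open>g\<close> in \<open>g + gyz\<close> is therefore one, which fixes the common scalar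
    \<open>a\<close>.\<close>
  obtain p q where pq: "gyz = p *s gy + q *s gz"
    using R_line[OF Ry(1) Rz(1) Ryz(1) yz'(1)] one(3) by blast
  have "1 *s g + p *s gy + q *s gz = a *s g + a *s gy + a *s gz"
    using e1 pq by (simp add: ac_simps)
  then have "1 = a \<and> p = a \<and> q = a" using eq3 by blast
  then show ?thesis using pq by simp
qed

text \<open>
  The normalized representatives are additive for \<open>y\<close>, \<open>z\<close> independent modulo the span of \<open>x\<close> and \<open>E\<close>, so they extend to
  an additive map on the whole space.
\<close>

theorem semilinear_rep:
  "\<exists>G. semilinear G \<and> bij G \<and> G ` E = E \<and> (\<forall>v. v \<notin> E \<longrightarrow> R v (G v))"
proof -
  obtain x where xE: "x \<notin> E" using dim_quot exists_notin[of E] by auto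
  obtain g0 where x: "R x g0" using R_ex xE by blast
  define S where "S = vec.span (insert x E)"
  have S: "vec.subspace S" unfolding S_def by simp
  have dS: "Suc (vec.dim S) < CARD('k)"
    using dim_span_insert[OF subspace_E xE] dim_quot unfolding S_def by simp
  define gg where "gg y = (THE w. R y w \<and> R (x + y) (g0 + w))" for y
  have gg: "R y (gg y)" "R (x + y) (g0 + gg y)" if "y \<notin> S" for y
    using theI'[OF unique_rep[OF x, of y]] that unfolding gg_def S_def by blast+
  have ES: "e \<in> S" if "e \<in> E" for e using that unfolding S_def by (simp add: vec.span_base)
  have SN: "e \<in> vec.span (insert y S)" if "e \<in> S" for e y using that by (simp add: vec.span_base)
  have EN: "vec.span (insert y E) \<subseteq> vec.span (insert y S)" for y
    using ES by (intro vec.span_mono) auto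
  have yN: "y \<in> vec.span (insert y S)" for y by (simp add: vec.span_base)
  have "gg (y + z) = gg y + gg z" if "y \<notin> S" "z \<notin> vec.span (insert y S)" for y z
  proof -
    have "y + z \<notin> S"
    proof
      assume "y + z \<in> S"
      then have "y + z - y \<in> vec.span (insert y S)" by (intro vec.span_diff SN yN)
      then show False using that by simp
    qed
    moreover have "z \<notin> S" using that SN by blast
    ultimately show ?thesis
      by (intro rep_add[OF x _ _ gg(1,2)[of y] gg(1,2)[of z] gg(1,2)[of "y + z"]]) (use that S_def in auto)
  qed
  then obtain G where add: "\<And>u v. G (u + v) = G u + G v" and Ggg: "\<And>y. y \<notin> S \<Longrightarrow> G y = gg y"
    using additive_extension[OF S dS, of gg] by metis
  have RG: "R y (G y)" if "y \<notin> S" for y using gg(1) Ggg that by simp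
  have G0: "G 0 = 0" using add[of 0 0] by simp
  have Gdiff: "G (u - v) = G u - G v" for u v using add[of "u - v" v] by simp
  have ex: "\<exists>z. z \<notin> vec.span (insert y S)" for y
    using dS vec.dim_insert[of y S] by (intro exists_notin) (auto split: if_splits)
  have cS: "c *s y \<notin> S" if "y \<notin> S" "c \<noteq> 0" for c y
    using that vec.subspace_scale[OF S, of "c *s y" "inverse c"] by auto
  have GyE: "G y \<notin> E" if "y \<notin> S" for y using RG[OF that] R_notin by blast
  have Gy0: "G y \<noteq> 0" if "y \<notin> S" for y using GyE[OF that] vec.subspace_0[OF subspace_E] by auto
  have indG: "a = 0 \<and> b = 0" if "y \<notin> S" "z \<notin> vec.span (insert y S)" "a *s G y + b *s G z \<in> E" for y z a b
  proof -
    have zS: "z \<notin> S" using that SN by blast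
    have "z \<notin> vec.span (insert y E)" using EN that by blast
    then have "G z \<notin> vec.span (insert (G y) E)" using R_fibre[OF RG[OF zS] RG[OF that(1)]] by simp
    then show ?thesis using indep2[OF GyE[OF that(1)]] that(3) by blast
  qed
  have ex_t: "\<exists>t. G (c *s y) = t *s G y" if "y \<notin> S" for c y
  proof (cases "c = 0")
    case False
    then have "R (c *s y) (G y)" "R (c *s y) (G (c *s y))"
      using RG[OF that] R_scale(2) RG[OF cS[OF that False]] by auto
    then show ?thesis using R_unique by blast
  qed (use G0 in \<open>auto intro: exI[of _ 0]\<close>)
  obtain y0 where y0: "y0 \<notin> S" using ex SN by blast
  obtain \<tau> where t0: "\<And>c. G (c *s y0) = \<tau> c *s G y0" using ex_t[OF y0] by metis
  \<comment> \<open>Expanding \<open>G (c *s (y + z))\<close> additively and as a multiple of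
    \<open>G (y + z)\<close> forces the scalars belonging to \<open>y\<close> and \<open>z\<close>
    to agree.\<close>
  have transfer: "G (c *s z) = t *s G z" if "G (c *s y) = t *s G y" "y \<notin> S" "z \<notin> vec.span (insert y S)" for c t y z
  proof -
    have zS: "z \<notin> S" using that SN by blast
    have yz: "y + z \<notin> S"
    proof
      assume "y + z \<in> S"
      then have "y + z - y \<in> vec.span (insert y S)" by (intro vec.span_diff SN yN)
      then show False using that by simp
    qed
    obtain p q where p: "G (c *s z) = p *s G z" and q: "G (c *s (y + z)) = q *s G (y + z)"
      using ex_t[OF zS] ex_t[OF yz] by blast
    have "t *s G y + p *s G z = q *s G y + q *s G z"
      using q that(1) p by (simp add: add vec.scale_right_distrib)
    then have "(t - q) *s G y + (p - q) *s G z = 0" by (simp add: algebra_simps vector_sub_rdistrib)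
    then have "t - q = 0 \<and> p - q = 0"
      using indG[OF that(2,3), of "t - q" "p - q"] vec.subspace_0[OF subspace_E] by simp
    then show ?thesis using p by simp
  qed
  have scaleS: "G (c *s y) = \<tau> c *s G y" if "y \<notin> S" for c y
  proof (cases "y \<in> vec.span (insert y0 S)")
    case False
    then show ?thesis using transfer[OF t0 y0] by blast
  next
    case True
    \<comment> \<open>When \<open>y\<close> and \<open>y0\<close> are dependent modulo
      \<open>S\<close>, the scalar is passed from \<open>y0\<close> to \<open>w\<close> and from
      \<open>w\<close> to \<open>y\<close>.\<close>
    obtain w where w: "w \<notin> vec.span (insert y0 S)" using ex by blast
    have wS: "w \<notin> S" using w SN by blast
    have "vec.span (insert y S) \<subseteq> vec.span (insert y0 S)"
      using True by (intro vec.span_minimal) (auto simp: SN)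
    then have "w \<notin> vec.span (insert y S)" using w by blast
    then have "y \<notin> vec.span (insert w S)" using span_insert_exchange[OF S, of y w] that by blast
    then show ?thesis using transfer[OF transfer[OF t0 y0 w] wS] by blast
  qed
  have scale: "G (c *s v) = \<tau> c *s G v" for c v
  proof (cases "v \<in> S")
    case True
    then have "v + y0 \<notin> S" using y0 vec.subspace_diff[OF S, of "v + y0" v] by auto
    then have "G (c *s (v + y0)) = \<tau> c *s G (v + y0)" by (rule scaleS)
    then show ?thesis using t0[of c] by (simp add: vec.scale_right_distrib add)
  qed (rule scaleS)
  have cancel: "c = d" if "c *s G y0 = d *s G y0" for c d
    using that Gy0[OF y0] by (simp add: vec.scale_right_imp_eq)
  have "\<tau> (c + d) = \<tau> c + \<tau> d" for c d
    using scale[of "c + d" y0] by (intro cancel) (simp only: vec.scale_left_distrib add scale)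
  moreover have "\<tau> (c * d) = \<tau> c * \<tau> d" for c d
    using scale[of "c * d" y0] scale[of c "d *s y0"] scale[of d y0]
    by (intro cancel) (simp only: vector_smult_assoc)
  moreover have "inj \<tau>"
  proof (rule injI, rule ccontr)
    fix c d assume cd: "\<tau> c = \<tau> d" "c \<noteq> d"
    have "G ((c - d) *s y0) = 0" using cd by (simp add: vector_sub_rdistrib Gdiff scale)
    moreover have "(c - d) *s y0 \<notin> S" using cS[OF y0] cd by simp
    ultimately show False using Gy0 by blast
  qed
  then have "bij \<tau>" by (simp add: bij_def finite_UNIV_inj_surj)
  ultimately have "field_aut \<tau>" by (simp add: field_aut_def)
  then have semi: "semilinear G" using add scale unfolding semilinear_def by blast
  have shift: "v + y \<notin> vec.span (insert y E)" if v: "v \<in> S" "v \<notin> E" and y: "y \<notin> S" for v y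
  proof
    assume "v + y \<in> vec.span (insert y E)"
    then obtain c where c: "v + y - c *s y \<in> E" using in_span_insert_E by blast
    have "(v + y - c *s y) - v \<in> S" by (rule vec.subspace_diff[OF S ES[OF c] v(1)])
    then have "(1 - c) *s y \<in> S" by (simp add: vector_sub_rdistrib)
    then have "c = 1" using cS[OF y, of "1 - c"] by auto
    then show False using c v by simp
  qed
  \<comment> \<open>A vector \<open>v\<close> of \<open>S\<close> outside \<open>E\<close> lies on
    the line of \<open>v + y0\<close>, \<open>y0\<close> and on the line of \<open>v + z\<close>,
    \<open>z\<close>. At these four vectors \<open>G\<close> is already known to represent
    \<open>R\<close>, and the two image lines meet only in the point of \<open>G v\<close>;
    otherwise \<open>z\<close> would be on the first line.\<close>
  have RGE: "R v (G v)" if vE: "v \<notin> E" for v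
  proof (cases "v \<in> S")
    case True
    obtain w where w: "R v w" using R_ex vE by blast
    obtain z where z: "z \<notin> vec.span (insert y0 S)" using ex by blast
    have zS: "z \<notin> S" using z SN by blast
    have *: "\<exists>a b. w = a *s G (v + y) + b *s G y" if y: "y \<notin> S" for y
    proof -
      have vy: "v + y \<notin> S" using y True vec.subspace_diff[OF S, of "v + y" v] by auto
      have "v + y \<notin> vec.span (insert y E)" by (rule shift[OF True vE y])
      moreover have "v = 1 *s (v + y) + (-1) *s y" by simp
      ultimately show ?thesis using R_line[OF RG[OF vy] RG[OF y] w] by blast
    qed
    obtain a b where ab: "w = a *s G (v + y0) + b *s G y0" using *[OF y0] by blast
    obtain c d where cd: "w = c *s G (v + z) + d *s G z" using *[OF zS] by blast
    have "c + d = 0"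
    proof (rule ccontr)
      assume nz: "c + d \<noteq> 0"
      have "(c + d) *s G z = (a - c) *s G (v + y0) + (b + c) *s G y0"
        using ab cd by (simp add: add algebra_simps vector_sub_rdistrib vec.scale_left_distrib)
      then have e: "inverse (c + d) *s ((c + d) *s G z) = inverse (c + d) *s ((a - c) *s G (v + y0) + (b + c) *s G y0)"
        by simp
      then have e: "G z = (inverse (c + d) * (a - c)) *s G (v + y0) + (inverse (c + d) * (b + c)) *s G y0"
        using nz by (simp add: vec.scale_right_distrib)
      have vy: "v + y0 \<notin> S" using y0 True vec.subspace_diff[OF S, of "v + y0" v] by auto
      obtain p q where "z = p *s (v + y0) + q *s y0"
        using R_line[OF RG[OF vy] RG[OF y0] RG[OF zS] shift[OF True vE y0]] e by blast
      then have "z \<in> vec.span (insert y0 S)"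
        using SN[OF True] yN[of y0] by (auto intro!: vec.span_add vec.span_scale)
      then show False using z by simp
    qed
    then have "w = c *s G v"
      using cd by (simp add: add vec.scale_right_distrib vec.scale_left_distrib[symmetric] add.assoc)
    moreover have "c \<noteq> 0" using R_notin[OF w] vec.subspace_0[OF subspace_E] calculation by auto
    ultimately show ?thesis using R_scale(1)[OF w, of "inverse c"] by simp
  qed (rule RG)
  obtain z where z: "z \<notin> vec.span (insert y0 S)" using ex by blast
  have zS: "z \<notin> S" using z SN by blast
  \<comment> \<open>Modulo \<open>E\<close>, the vector \<open>G e\<close> is a multiple of
    \<open>G y0\<close> as well as of \<open>G z\<close>. As these are independent modulo
    \<open>E\<close>, it vanishes there.\<close>
  have GE: "G e \<in> E" if e: "e \<in> E" for e
  proof -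
    have *: "\<exists>k. G e - k *s G y \<in> E" if y: "y \<notin> S" for y
    proof -
      have ye: "y + e \<notin> S" using y ES[OF e] vec.subspace_diff[OF S, of "y + e" e] by auto
      have "y + e \<in> vec.span (insert y E)" using e by (intro vec.span_add) (auto intro: vec.span_base)
      then have "G y + G e \<in> vec.span (insert (G y) E)"
        using R_fibre[OF RG[OF ye] RG[OF y]] by (simp add: add)
      then obtain k where "G y + G e - k *s G y \<in> E" using in_span_insert_E by blast
      then show ?thesis by (intro exI[of _ "k - 1"]) (simp add: vector_sub_rdistrib algebra_simps)
    qed
    obtain k where k: "G e - k *s G y0 \<in> E" using *[OF y0] by blast
    obtain j where j: "G e - j *s G z \<in> E" using *[OF zS] by blast
    have "(G e - j *s G z) - (G e - k *s G y0) \<in> E" by (rule vec.subspace_diff[OF subspace_E j k])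
    then have "k *s G y0 + (- j) *s G z \<in> E" by (simp add: algebra_simps)
    then have "k = 0" using indG[OF y0 z] by blast
    then show ?thesis using k by simp
  qed
  \<comment> \<open>A kernel vector must lie in \<open>E\<close>, since \<open>R\<close> only takes
    values outside \<open>E\<close>. Then \<open>y0\<close> and \<open>y0 + v\<close> represent
    points with the same image and hence are proportional, which is impossible for nonzero
    \<open>v\<close> in \<open>S\<close>.\<close>
  have ker: "v = 0" if v: "G v = 0" for v
  proof (rule ccontr)
    assume nz: "v \<noteq> 0"
    have "v \<in> E" using RGE[of v] R_notin[of v 0] v vec.subspace_0[OF subspace_E] by auto
    then have "y0 + v \<notin> S" using y0 ES[of v] vec.subspace_diff[OF S, of "y0 + v" v] by auto
    then have "R (y0 + v) (G y0)" using RG[of "y0 + v"] v by (simp add: add)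
    then obtain c where c: "y0 + v = c *s y0" using R_inj[OF RG[OF y0]] by blast
    then have "(c - 1) *s y0 = v" by (simp add: vector_sub_rdistrib algebra_simps)
    then have "c = 1" using cS[OF y0, of "c - 1"] ES[OF \<open>v \<in> E\<close>] by auto
    then show False using \<open>(c - 1) *s y0 = v\<close> nz by simp
  qed
  have injG: "inj G"
  proof (rule injI)
    fix u v assume "G u = G v"
    then have "u - v = 0" using ker[of "u - v"] Gdiff by simp
    then show "u = v" by simp
  qed
  then have "bij G" by (simp add: bij_def finite_UNIV_inj_surj)
  moreover have "G ` E = E"
    using GE injG by (intro endo_inj_surj) (auto intro: inj_on_subset)
  ultimately show ?thesis using semi RGE by blast
qed

end


subsection \<open>Descending to points\<close>

lemma intermediate_subspace:
  fixes T P :: "('a::field ^ 'k::finite) set"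
  assumes "vec.subspace T" "vec.subspace P" "T \<subseteq> P" "vec.dim T \<le> j" "j \<le> vec.dim P"
  shows "\<exists>S. vec.subspace S \<and> T \<subseteq> S \<and> S \<subseteq> P \<and> vec.dim S = j"
  using assms(4,5)
proof (induction j rule: dec_induct)
  case base
  then show ?case using assms by blast
next
  case (step j)
  then obtain S where S: "vec.subspace S" "T \<subseteq> S" "S \<subseteq> P" "vec.dim S = j" by auto
  obtain x where x: "x \<in> P" "x \<notin> S"
    using subspace_dim_less_exists[OF S(1) assms(2)] S step.prems by auto
  have "vec.dim (vec.span (insert x S)) = Suc j" using dim_span_insert[OF S(1) x(2)] S by simp
  moreover have "vec.span (insert x S) \<subseteq> P" using assms S x by (intro span_insert_least) auto
  moreover have "T \<subseteq> vec.span (insert x S)" using S by (auto intro: vec.span_base)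
  ultimately show ?case by (intro exI[of _ "vec.span (insert x S)"]) simp
qed

lemma in_span_pair: "w \<in> vec.span {u, v} \<longleftrightarrow> (\<exists>a b. w = a *s u + b *s v)"
proof -
  have "w \<in> vec.span {u, v} \<longleftrightarrow> (\<exists>a. w - a *s u \<in> vec.span {v})"
    by (simp add: vec.span_breakdown_eq)
  also have "\<dots> \<longleftrightarrow> (\<exists>a b. w - a *s u = b *s v)" by (auto simp: vec.span_singleton)
  finally show ?thesis by (simp add: diff_eq_eq add.commute)
qed

context attenuated
begin

lemma Xm_eqI: "P \<in> Xm k \<Longrightarrow> Q \<in> Xm k \<Longrightarrow> P \<subseteq> Q \<Longrightarrow> P = Q"
  using XmD(2)[of P k] XmD(2)[of Q k] by (intro vec.subspace_dim_equal) auto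

lemma sh_point: "sh (vec.span {v}) = vec.span (insert v E)"
proof
  show "sh (vec.span {v}) \<subseteq> vec.span (insert v E)"
    by (intro sh_least) (auto intro: vec.span_base vec.span_mono[THEN subsetD])
  show "vec.span (insert v E) \<subseteq> sh (vec.span {v})"
    using E_subset_sh[of "vec.span {v}"] subset_sh[of "vec.span {v}"]
    by (intro vec.span_minimal) (auto intro: vec.span_base)
qed

lemma point_Xm:
  assumes "v \<notin> E" shows "vec.span {v} \<in> Xm 1"
proof -
  have "v \<noteq> 0" using assms vec.subspace_0[OF subspace_E] by auto
  then have "vec.dim (vec.span {v}) = 1" by simp
  moreover have "vec.dim (sh (vec.span {v})) = Suc (vec.dim E)"
    unfolding sh_point by (rule dim_span_insert[OF subspace_E assms])
  ultimately show ?thesis using Xm_dimI[of "vec.span {v}"] by simp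
qed

lemma Xm_point:
  assumes "p \<in> Xm 1" obtains v where "v \<notin> E" "p = vec.span {v}"
proof -
  have "p \<noteq> {0}" using XmD(2)[OF assms] by auto
  then obtain v where v: "v \<in> p" "v \<noteq> 0" using vec.subspace_0[OF XmD(1)[OF assms]] by blast
  have "vec.span {v} = p"
    using v XmD[OF assms] by (intro vec.subspace_dim_equal vec.span_minimal) auto
  moreover have "v \<notin> E" using v XmD(3)[OF assms] by blast
  ultimately show thesis using that by blast
qed

lemma point_subset: "vec.subspace L \<Longrightarrow> vec.span {v} \<subseteq> L \<longleftrightarrow> v \<in> L"
  by (auto intro: vec.span_base dest: vec.span_minimal[of "{v}", THEN subsetD, rotated 2])

text \<open>The passage from points to representing vectors. The hypothesis on lines asks only for
  some \<open>L'\<close>, but \<open>L'\<close> contains two image points from different fibres and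
  has dimension two, so it is their span; collinearity is thus preserved and reflected.\<close>

theorem point_map_semilinear:
  assumes dimq: "vec.dim E + 3 \<le> CARD('k)"
    and s: "bij_betw s (Xm 1) (Xm 1)"
    and fib: "\<And>p q. p \<in> Xm 1 \<Longrightarrow> q \<in> Xm 1 \<Longrightarrow> sh p = sh q \<longleftrightarrow> sh (s p) = sh (s q)"
    and line: "\<And>L. L \<in> Xm 2 \<Longrightarrow> \<exists>L'\<in>Xm 2. \<forall>p\<in>Xm 1. p \<subseteq> L \<longleftrightarrow> s p \<subseteq> L'"
  shows "\<exists>G. semilinear G \<and> bij G \<and> G ` E = E \<and> (\<forall>p\<in>Xm 1. s p = G ` p)"
proof -
  define R where "R v w \<longleftrightarrow> v \<notin> E \<and> w \<notin> E \<and> s (vec.span {v}) = vec.span {w}" for v w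
  have fib': "u \<in> vec.span (insert v E) \<longleftrightarrow> sh (vec.span {u}) = sh (vec.span {v})" if "u \<notin> E" "v \<notin> E" for u v
  proof
    assume "u \<in> vec.span (insert v E)"
    then have "sh (vec.span {u}) \<subseteq> sh (vec.span {v})"
      unfolding sh_point by (intro vec.span_minimal) (auto intro: vec.span_base)
    then show "sh (vec.span {u}) = sh (vec.span {v})"
      using sh_eqI[of "vec.span {u}" 1 "vec.span {v}"] point_Xm that by blast
  next
    assume "sh (vec.span {u}) = sh (vec.span {v})"
    then show "u \<in> vec.span (insert v E)" unfolding sh_point using vec.span_base[of u "insert u E"] by blast
  qed
  have fibre: "u \<in> vec.span (insert v E) \<longleftrightarrow> u' \<in> vec.span (insert v' E)" if "R u u'" "R v v'" for u u' v v'
    using that fib'[of u v] fib'[of u' v'] fib[of "vec.span {u}" "vec.span {v}"] point_Xm unfolding R_def by auto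
  interpret projectivity E R
  proof
    show "vec.dim E + 3 \<le> CARD('k)" by (rule dimq)
  next
    fix v assume "v \<notin> E"
    then have "s (vec.span {v}) \<in> Xm 1" using point_Xm s bij_betwE by blast
    then show "\<exists>w. R v w" using Xm_point \<open>v \<notin> E\<close> unfolding R_def by metis
  next
    fix v w assume "R v w"
    then show "v \<notin> E \<and> w \<notin> E" by (simp add: R_def)
  next
    fix v w w' assume "R v w" "R v w'"
    then have "w' \<in> vec.span {w}" unfolding R_def using vec.span_base[of w' "{w'}"] by auto
    then show "\<exists>c. w' = c *s w" by (auto simp: vec.span_singleton)
  next
    fix u v w assume "R u w" "R v w"
    then have "vec.span {v} = vec.span {u}" unfolding R_def
      using s point_Xm by (metis bij_betw_imp_inj_on inj_onD)
    then have "v \<in> vec.span {u}" using vec.span_base[of v "{v}"] by auto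
    then show "\<exists>c. v = c *s u" by (auto simp: vec.span_singleton)
  next
    fix v w and c :: 'a assume R: "R v w" and c: "c \<noteq> 0"
    have sp: "vec.span {c *s x} = vec.span {x}" for x :: "'a ^ 'k"
    proof -
      have "x = inverse c *s (c *s x)" using c by simp
      then have "x \<in> vec.span {c *s x}" using vec.span_scale vec.span_base by (metis insertI1)
      moreover have "c *s x \<in> vec.span {x}" by (intro vec.span_scale vec.span_base) simp
      ultimately show ?thesis by (intro subset_antisym vec.span_minimal) auto
    qed
    have nE: "c *s x \<notin> E" if "x \<notin> E" for x
      using that c vec.subspace_scale[OF subspace_E, of "c *s x" "inverse c"] by auto
    show "R v (c *s w)" "R (c *s v) w" using R nE sp unfolding R_def by auto
  next
    fix u u' v v' assume "R u u'" "R v v'"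
    then show "u \<in> vec.span (insert v E) \<longleftrightarrow> u' \<in> vec.span (insert v' E)" by (rule fibre)
  next
    fix u u' v v' w w' assume R: "R u u'" "R v v'" "R w w'" and uv: "u \<notin> vec.span (insert v E)"
    have nE: "u \<notin> E" "v \<notin> E" "w \<notin> E" "u' \<notin> E" "v' \<notin> E" "w' \<notin> E" using R by (auto simp: R_def)
    have two: "vec.span {x, y} \<in> Xm 2" if "y \<notin> E" "x \<notin> vec.span (insert y E)" for x y
    proof -
      have "vec.span (insert x (vec.span {y})) \<in> Xm (Suc 1)"
        using insert_Xm[OF point_Xm[OF that(1)], of x] that(2) sh_point by simp
      moreover have "vec.span (insert x (vec.span {y})) = vec.span {x, y}"
        using vec.span_Un[of "{x}" "vec.span {y}"] vec.span_Un[of "{x}" "{y}"]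
        by (simp add: vec.span_span insert_commute[of x y "{}"])
      ultimately show ?thesis by (simp add: numeral_2_eq_2)
    qed
    have L: "vec.span {u, v} \<in> Xm 2" using two nE uv by blast
    obtain L' where L': "L' \<in> Xm 2" "\<forall>p\<in>Xm 1. p \<subseteq> vec.span {u, v} \<longleftrightarrow> s p \<subseteq> L'"
      using line[OF L] by (elim bexE)
    have mem: "x \<in> vec.span {u, v} \<longleftrightarrow> x' \<in> L'" if "R x x'" for x x'
      using bspec[OF L'(2) point_Xm[of x]] that point_subset[of "vec.span {u, v}" x]
        point_subset[OF subspace_Xm[OF L'(1)], of x'] by (simp add: R_def)
    have "u' \<in> L'" "v' \<in> L'" using mem[OF R(1)] mem[OF R(2)] by (auto intro: vec.span_base)
    then have "vec.span {u', v'} \<subseteq> L'" using L'(1) by (intro vec.span_minimal) auto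
    moreover have "vec.span {u', v'} \<in> Xm 2" using two nE uv fibre[OF R(1,2)] by blast
    ultimately have "vec.span {u', v'} = L'"
      using Xm_eqI[OF _ L'(1)] by blast
    then show "(\<exists>a b. w = a *s u + b *s v) \<longleftrightarrow> (\<exists>a b. w' = a *s u' + b *s v')"
      using mem[OF R(3)] in_span_pair[of w u v] in_span_pair[of w' u' v'] by simp
  qed
  obtain G where G: "semilinear G" "bij G" "G ` E = E" "\<And>v. v \<notin> E \<Longrightarrow> R v (G v)"
    using semilinear_rep by blast
  have "s p = G ` p" if p: "p \<in> Xm 1" for p
  proof -
    obtain v where v: "v \<notin> E" "p = vec.span {v}" using Xm_point p .
    have Rv: "R v (G v)" using G v by blast
    then have "G v \<notin> E" "s p = vec.span {G v}" using v by (auto simp: R_def)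
    moreover have sub: "vec.subspace (G ` p)" using subspace_image[OF _ G(1)] p by simp
    moreover have "G v \<in> G ` p" using v by (auto intro: vec.span_base)
    moreover have "vec.dim (G ` p) = 1" using dim_semilinear_image[OF G(1,2)] XmD(2)[OF p] by simp
    moreover have "vec.dim (vec.span {G v}) = 1" using XmD(2)[OF point_Xm[OF \<open>G v \<notin> E\<close>]] .
    ultimately show ?thesis
      using vec.subspace_dim_equal[of "vec.span {G v}" "G ` p"] vec.span_minimal[of "{G v}" "G ` p"] by auto
  qed
  then show ?thesis using G by blast
qed

section \<open>Descent from dimension k + 1 to dimension k\<close>

definition preserving :: "nat \<Rightarrow> (('a ^ 'k) set \<Rightarrow> ('a ^ 'k) set) \<Rightarrow> bool" where
  "preserving k \<sigma> \<longleftrightarrow> bij_betw \<sigma> (Xm k) (Xm k) \<and>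
    (\<forall>P\<in>Xm k. \<forall>Q\<in>Xm k. (sh P = sh Q \<longleftrightarrow> sh (\<sigma> P) = sh (\<sigma> Q)) \<and> (adj k P Q \<longleftrightarrow> adj k (\<sigma> P) (\<sigma> Q)))"

text \<open>Together with \<open>adj_iff\<close> this expresses the structure in dimension
  \<open>k\<close> through inclusions and fibres in dimension \<open>k + 1\<close>. If some
  \<open>y\<close> in \<open>sh S'\<close> is missing from \<open>sh S\<close>, then there is a
  \<open>P\<close> above \<open>S\<close> whose shadow still avoids \<open>y\<close>, whereas every
  member above \<open>S'\<close> has \<open>y\<close> in its shadow.\<close>

lemma fibre_iff:
  assumes S: "S \<in> Xm k" "S' \<in> Xm k" and k: "Suc k + vec.dim E < CARD('k)"
  shows "sh S = sh S' \<longleftrightarrow> (\<forall>P\<in>Xm (Suc k). S \<subseteq> P \<longrightarrow> (\<exists>P'\<in>Xm (Suc k). S' \<subseteq> P' \<and> sh P' = sh P))"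
proof
  assume eq: "sh S = sh S'"
  show "\<forall>P\<in>Xm (Suc k). S \<subseteq> P \<longrightarrow> (\<exists>P'\<in>Xm (Suc k). S' \<subseteq> P' \<and> sh P' = sh P)"
  proof (intro ballI impI)
    fix P assume P: "P \<in> Xm (Suc k)" "S \<subseteq> P"
    obtain x where x: "x \<in> P" "x \<notin> S"
      using subspace_dim_less_exists[of S P] S P XmD(2)[OF S(1)] XmD(2)[OF P(1)] by auto
    have xs: "x \<notin> sh S" using Int_sh_sub[OF P(1) _ P(2)] S x by auto
    have "vec.span (insert x S) = P"
      using S P x XmD(2)[OF S(1)] XmD(2)[OF P(1)] by (intro span_insert_eq) auto
    then have "sh P = vec.span (insert x (sh S))" using sh_span_insert[of S x] S by auto
    also have "\<dots> = sh (vec.span (insert x S'))" using sh_span_insert[of S' x] S eq by auto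
    finally show "\<exists>P'\<in>Xm (Suc k). S' \<subseteq> P' \<and> sh P' = sh P"
      using insert_Xm[OF S(2)] xs eq by (intro bexI[of _ "vec.span (insert x S')"]) (auto intro: vec.span_base)
  qed
next
  assume a: "\<forall>P\<in>Xm (Suc k). S \<subseteq> P \<longrightarrow> (\<exists>P'\<in>Xm (Suc k). S' \<subseteq> P' \<and> sh P' = sh P)"
  show "sh S = sh S'"
  proof (rule ccontr)
    assume "sh S \<noteq> sh S'"
    then obtain y where y: "y \<in> sh S'" "y \<notin> sh S" using sh_eqI[OF S(2,1)] by blast
    obtain x where x: "x \<notin> vec.span (insert y (sh S))"
      using exists_notin[of "vec.span (insert y (sh S))"] dim_sh_insert[OF S(1) y(2)] k by auto
    then have xs: "x \<notin> sh S" by (auto intro: vec.span_base)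
    have "S \<subseteq> vec.span (insert x S)" by (auto intro: vec.span_base)
    then obtain P' where P': "S' \<subseteq> P'" "sh P' = sh (vec.span (insert x S))"
      using a insert_Xm[OF S(1) xs] by blast
    then have "y \<in> vec.span (insert x (sh S))" using y sh_mono[OF P'(1)] sh_span_insert[of S x] S by auto
    then show False using span_insert_exchange[of "sh S" y x] x y S by auto
  qed
qed

text \<open>The common superspace of an adjacent pair is the sum. Conversely, distinct hyperplanes
  of one \<open>P\<close> belong to different fibres, because \<open>Int_sh_sub\<close> recovers
  each from its shadow.\<close>

lemma adj_iff:
  assumes S: "S \<in> Xm k" "S' \<in> Xm k"
  shows "adj k S S' \<longleftrightarrow> S \<noteq> S' \<and> (\<exists>P\<in>Xm (Suc k). S \<subseteq> P \<and> S' \<subseteq> P)"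
proof
  have sS: "vec.subspace S" "vec.subspace S'" using S by auto
  note dj = dim_subspace_sum[OF sS] XmD(2)[OF S(1)] XmD(2)[OF S(2)]
  {
    assume a: "adj k S S'"
    have d: "vec.dim (subspace_sum S S') = Suc k" using a dj by (simp add: adj_def)
    have "vec.dim (subspace_sum (sh S) (sh S')) = Suc k + vec.dim E"
      using adj_dim_sh[OF a] dim_subspace_sum[of "sh S" "sh S'"] dim_sh[OF S(1)] dim_sh[OF S(2)] sS by simp
    moreover have "subspace_sum (sh S) (sh S') \<subseteq> sh (subspace_sum S S')"
      using sS subspace_sum_subset_left[OF sS(2), of S] subspace_sum_subset_right[OF sS(1), of S']
      by (intro subspace_sum_least sh_mono subspace_sh subspace_subspace_sum)
    ultimately have "Suc k + vec.dim E \<le> vec.dim (sh (subspace_sum S S'))" by (metis vec.dim_subset)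
    moreover have "vec.dim (sh (subspace_sum S S')) \<le> Suc k + vec.dim E"
      using dim_subspace_sum[OF subspace_subspace_sum[OF sS] subspace_E] d unfolding sh_def by simp
    ultimately have "subspace_sum S S' \<in> Xm (Suc k)"
      using Xm_dimI[OF subspace_subspace_sum[OF sS]] d by simp
    then show "S \<noteq> S' \<and> (\<exists>P\<in>Xm (Suc k). S \<subseteq> P \<and> S' \<subseteq> P)"
      using a subspace_sum_subset_left[OF sS(2), of S] subspace_sum_subset_right[OF sS(1), of S'] by (auto simp: adj_def)
  }
  {
    assume "S \<noteq> S' \<and> (\<exists>P\<in>Xm (Suc k). S \<subseteq> P \<and> S' \<subseteq> P)"
    then obtain P where P: "S \<noteq> S'" "P \<in> Xm (Suc k)" "S \<subseteq> P" "S' \<subseteq> P" by blast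
    have "subspace_sum S S' \<subseteq> P" using P by (intro subspace_sum_least) auto
    then have "vec.dim (subspace_sum S S') \<le> Suc k" using vec.dim_subset XmD(2)[OF P(2)] by metis
    moreover have "k < vec.dim (subspace_sum S S')"
    proof (rule ccontr)
      assume "\<not> ?thesis"
      then have "S = subspace_sum S S'" "S' = subspace_sum S S'"
        using vec.subspace_dim_equal[OF sS(1) subspace_subspace_sum[OF sS] subspace_sum_subset_left[OF sS(2)]]
          vec.subspace_dim_equal[OF sS(2) subspace_subspace_sum[OF sS] subspace_sum_subset_right[OF sS(1)]] dj by simp_all
      then show False using P(1) by simp
    qed
    ultimately have "Suc (vec.dim (S \<inter> S')) = k" using dj by simp
    moreover have "sh S \<noteq> sh S'"
      using Int_sh_sub[OF P(2) sS(1) P(3)] Int_sh_sub[OF P(2) sS(2) P(4)] P(1) by auto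
    ultimately show "adj k S S'" using S by (simp add: adj_def)
  }
qed

text \<open>Write \<open>S\<close> as the intersection of the two members of one fibre in a mixed
  triangle. The image of the triangle is again mixed, and the intersection of the corresponding two
  images serves as \<open>s S\<close>; since its star is the image of the star of \<open>S\<close>,
  inclusions are preserved both ways.\<close>

lemma descend:
  assumes \<sigma>: "preserving (Suc k) \<sigma>" and k: "Suc k + vec.dim E < CARD('k)"
  shows "\<exists>s. preserving k s \<and> (\<forall>S\<in>Xm k. \<forall>P\<in>Xm (Suc k). S \<subseteq> P \<longleftrightarrow> s S \<subseteq> \<sigma> P)"
proof -
  have bij: "bij_betw \<sigma> (Xm (Suc k)) (Xm (Suc k))" using \<sigma> by (simp add: preserving_def)
  then have inj: "inj_on \<sigma> (Xm (Suc k))" and im: "\<sigma> ` Xm (Suc k) = Xm (Suc k)"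
    by (auto simp: bij_betw_def)
  have mem: "\<sigma> P \<in> Xm (Suc k)" if "P \<in> Xm (Suc k)" for P using im that by blast
  have fib: "sh P = sh Q \<longleftrightarrow> sh (\<sigma> P) = sh (\<sigma> Q)" and ad: "adj (Suc k) P Q \<longleftrightarrow> adj (Suc k) (\<sigma> P) (\<sigma> Q)"
    if "P \<in> Xm (Suc k)" "Q \<in> Xm (Suc k)" for P Q
    using \<sigma> that by (auto simp: preserving_def)
  have "\<exists>S'\<in>Xm k. star (Suc k) S' = \<sigma> ` star (Suc k) S" if S: "S \<in> Xm k" for S
  proof -
    obtain P Q R where t: "adj (Suc k) P Q" "adj (Suc k) R Q" "sh P = sh R" "P \<noteq> R" "P \<inter> R = S"
      using mixed_triangle_exists[OF S k] .
    have X: "P \<in> Xm (Suc k)" "Q \<in> Xm (Suc k)" "R \<in> Xm (Suc k)" using t by (auto simp: adj_def)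
    have "\<sigma> P \<noteq> \<sigma> R" using inj X t(4) by (auto dest: inj_onD)
    then have t': "adj (Suc k) (\<sigma> P) (\<sigma> Q)" "adj (Suc k) (\<sigma> R) (\<sigma> Q)" "sh (\<sigma> P) = sh (\<sigma> R)" "\<sigma> P \<noteq> \<sigma> R"
      using t X fib ad by blast+
    have "star (Suc k) (\<sigma> P \<inter> \<sigma> R) = \<sigma> ` star (Suc k) S"
      unfolding star_mixed_triangle[OF t'] t(5)[symmetric] star_mixed_triangle[OF t(1-4)]
    proof (intro equalityI subsetI)
      fix T' assume T': "T' \<in> {T \<in> Xm (Suc k). if sh T = sh (\<sigma> P) then adj (Suc k) T (\<sigma> Q)
         else adj (Suc k) T (\<sigma> P) \<and> adj (Suc k) T (\<sigma> R)}"
      then obtain T where T: "T \<in> Xm (Suc k)" "T' = \<sigma> T" using im by blast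
      show "T' \<in> \<sigma> ` {T \<in> Xm (Suc k). if sh T = sh P then adj (Suc k) T Q
         else adj (Suc k) T P \<and> adj (Suc k) T R}"
        unfolding T(2) using T' T fib[OF T(1) X(1)] ad[OF T(1)] X by (intro imageI) simp
    next
      fix T' assume "T' \<in> \<sigma> ` {T \<in> Xm (Suc k). if sh T = sh P then adj (Suc k) T Q
         else adj (Suc k) T P \<and> adj (Suc k) T R}"
      then obtain T where T: "T \<in> Xm (Suc k)" "T' = \<sigma> T" "if sh T = sh P then adj (Suc k) T Q
         else adj (Suc k) T P \<and> adj (Suc k) T R" by blast
      then show "T' \<in> {T \<in> Xm (Suc k). if sh T = sh (\<sigma> P) then adj (Suc k) T (\<sigma> Q)
         else adj (Suc k) T (\<sigma> P) \<and> adj (Suc k) T (\<sigma> R)}"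
        using fib[OF T(1) X(1)] ad[OF T(1) X(1)] ad[OF T(1) X(2)] ad[OF T(1) X(3)] mem[OF T(1)]
        by (simp split: if_splits)
    qed
    moreover have "\<sigma> P \<inter> \<sigma> R \<in> Xm k"
      using sub_Xm[OF mem[OF X(1)], of "\<sigma> P \<inter> \<sigma> R"] mixed_triangle(3)[OF t']
        vec.subspace_inter[OF subspace_Xm[OF mem[OF X(1)]] subspace_Xm[OF mem[OF X(3)]]]
      by simp
    ultimately show ?thesis by blast
  qed
  then obtain s where sX: "\<And>S. S \<in> Xm k \<Longrightarrow> s S \<in> Xm k"
    and star: "\<And>S. S \<in> Xm k \<Longrightarrow> star (Suc k) (s S) = \<sigma> ` star (Suc k) S" by metis
  have inc: "S \<subseteq> P \<longleftrightarrow> s S \<subseteq> \<sigma> P" if "S \<in> Xm k" "P \<in> Xm (Suc k)" for S P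
  proof -
    have sub: "star (Suc k) S \<subseteq> Xm (Suc k)" by (auto simp: star_def)
    have "S \<subseteq> P \<longleftrightarrow> P \<in> star (Suc k) S" using that by (simp add: star_def)
    also have "\<dots> \<longleftrightarrow> \<sigma> P \<in> \<sigma> ` star (Suc k) S" using inj_on_image_mem_iff[OF inj that(2) sub] by simp
    also have "\<dots> \<longleftrightarrow> s S \<subseteq> \<sigma> P" using star[OF that(1)] mem[OF that(2)] by (auto simp: star_def)
    finally show ?thesis .
  qed
  have injs: "inj_on s (Xm k)"
  proof (rule inj_onI)
    fix S S' assume S: "S \<in> Xm k" "S' \<in> Xm k" "s S = s S'"
    have "star (Suc k) S \<subseteq> Xm (Suc k)" "star (Suc k) S' \<subseteq> Xm (Suc k)" by (auto simp: star_def)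
    then have "star (Suc k) S = star (Suc k) S'"
      using star[OF S(1)] star[OF S(2)] S(3) inj by (metis inj_on_image_eq_iff)
    then have "\<Inter> (star (Suc k) S) = \<Inter> (star (Suc k) S')" by (rule arg_cong)
    then show "S = S'" unfolding Inter_star(1)[OF S(1) k] Inter_star(1)[OF S(2) k] .
  qed
  have bijs: "bij_betw s (Xm k) (Xm k)"
    unfolding bij_betw_def using injs sX endo_inj_surj[OF finite _ injs] by blast
  \<comment> \<open>Since \<open>\<sigma>\<close> is onto, quantifiers over dimension k + 1 may
    range over images. This turns the characterizations of fibres and adjacency for
    \<open>s S\<close>, \<open>s S'\<close> into those for \<open>S\<close>,
    \<open>S'\<close>.\<close>
  have ex: "(\<exists>P\<in>Xm (Suc k). \<phi> P) \<longleftrightarrow> (\<exists>P\<in>Xm (Suc k). \<phi> (\<sigma> P))" for \<phi>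
    using im by (metis imageE imageI)
  have all: "(\<forall>P\<in>Xm (Suc k). \<phi> P) \<longleftrightarrow> (\<forall>P\<in>Xm (Suc k). \<phi> (\<sigma> P))" for \<phi>
    using im by (metis imageE imageI)
  have "sh S = sh S' \<longleftrightarrow> sh (s S) = sh (s S')" if S: "S \<in> Xm k" "S' \<in> Xm k" for S S'
    unfolding fibre_iff[OF S k] fibre_iff[OF sX[OF S(1)] sX[OF S(2)] k]
    by (subst (2) all, subst (2) ex) (auto simp: inc S fib)
  moreover have "adj k S S' \<longleftrightarrow> adj k (s S) (s S')" if S: "S \<in> Xm k" "S' \<in> Xm k" for S S'
    unfolding adj_iff[OF S] adj_iff[OF sX[OF S(1)] sX[OF S(2)]]
    using S injs by (subst (2) ex) (auto simp: inc dest: inj_onD)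
  ultimately show ?thesis using bijs inc unfolding preserving_def by blast
qed

text \<open>Every vector of \<open>P\<close> lies in a \<open>k\<close>-dimensional subspace of
  \<open>P\<close> because \<open>k \<ge> 1\<close>, so the inclusions alone force \<open>G\<close>
  to map \<open>P\<close> into \<open>\<sigma> P\<close>.\<close>

lemma lift_semilinear:
  assumes k: "k \<ge> 1" and G: "semilinear G" "bij G" and s: "\<And>S. S \<in> Xm k \<Longrightarrow> s S = G ` S"
    and inc: "\<And>S P. S \<in> Xm k \<Longrightarrow> P \<in> Xm (Suc k) \<Longrightarrow> S \<subseteq> P \<Longrightarrow> s S \<subseteq> \<sigma> P"
    and P: "P \<in> Xm (Suc k)" "\<sigma> P \<in> Xm (Suc k)"
  shows "\<sigma> P = G ` P"
proof -
  have "G v \<in> \<sigma> P" if v: "v \<in> P" for v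
  proof -
    have "vec.dim (vec.span {v}) \<le> k" using k by simp
    then obtain S where S: "vec.subspace S" "vec.span {v} \<subseteq> S" "S \<subseteq> P" "vec.dim S = k"
      using intermediate_subspace[of "vec.span {v}" P k] P v XmD(2)[OF P(1)] point_subset[of P v] by auto
    then have "S \<in> Xm k" using sub_Xm[OF P(1)] by blast
    moreover have "v \<in> S" using S by (auto intro: vec.span_base)
    ultimately show ?thesis using inc[OF _ P(1) S(3)] s by blast
  qed
  then have "G ` P \<subseteq> \<sigma> P" by blast
  moreover have "vec.subspace (G ` P)" using subspace_image[OF subspace_Xm[OF P(1)] G(1)] .
  moreover have "vec.dim (G ` P) = Suc k" using dim_semilinear_image[OF G] XmD(2)[OF P(1)] by simp
  ultimately show ?thesis
    using vec.subspace_dim_equal[of "G ` P" "\<sigma> P"] P XmD(2)[OF P(2)] by simp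
qed

text \<open>The induction starts at two, where the members are lines and give the collinearity
  hypothesis for the descended point map. In higher dimensions the semilinear map found one step
  below also induces the map above.\<close>

theorem preserving_semilinear:
  assumes "2 \<le> m" "m + vec.dim E < CARD('k)" "preserving m \<sigma>"
  shows "\<exists>G. semilinear G \<and> bij G \<and> G ` E = E \<and> (\<forall>P\<in>Xm m. \<sigma> P = G ` P)"
  using assms
proof (induction m arbitrary: \<sigma> rule: dec_induct)
  case base
  have p: "preserving (Suc 1) \<sigma>" using base by (simp add: numeral_2_eq_2)
  then obtain s where s: "preserving 1 s" "\<And>S P. S \<in> Xm 1 \<Longrightarrow> P \<in> Xm 2 \<Longrightarrow> S \<subseteq> P \<longleftrightarrow> s S \<subseteq> \<sigma> P"
    using descend[OF p] base by (auto simp: numeral_2_eq_2)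
  have mem: "\<sigma> P \<in> Xm 2" if "P \<in> Xm 2" for P using base(2) that by (auto simp: preserving_def dest: bij_betwE)
  have "\<exists>G. semilinear G \<and> bij G \<and> G ` E = E \<and> (\<forall>p\<in>Xm 1. s p = G ` p)"
  proof (rule point_map_semilinear)
    show "vec.dim E + 3 \<le> CARD('k)" using base by simp
    show "bij_betw s (Xm 1) (Xm 1)" using s by (simp add: preserving_def)
    show "sh p = sh q \<longleftrightarrow> sh (s p) = sh (s q)" if "p \<in> Xm 1" "q \<in> Xm 1" for p q
      using s that by (simp add: preserving_def)
    show "\<exists>L'\<in>Xm 2. \<forall>p\<in>Xm 1. p \<subseteq> L \<longleftrightarrow> s p \<subseteq> L'" if "L \<in> Xm 2" for L
      using s(2)[OF _ that] mem[OF that] by (intro bexI[of _ "\<sigma> L"]) auto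
  qed
  then obtain G where G: "semilinear G" "bij G" "G ` E = E" "\<forall>p\<in>Xm 1. s p = G ` p"
    by (elim exE conjE)
  have "\<sigma> P = G ` P" if "P \<in> Xm 2" for P
    using lift_semilinear[of 1 G s \<sigma> P] G s(2) that mem by (simp add: numeral_2_eq_2)
  then show ?case using G by blast
next
  case (step m)
  obtain s where s: "preserving m s" "\<And>S P. S \<in> Xm m \<Longrightarrow> P \<in> Xm (Suc m) \<Longrightarrow> S \<subseteq> P \<longleftrightarrow> s S \<subseteq> \<sigma> P"
    using descend[OF step.prems(2)] step.prems by auto
  have "m + vec.dim E < CARD('k)" using step.prems(1) by simp
  from step.IH[OF this s(1)]
  obtain G where G: "semilinear G" "bij G" "G ` E = E" "\<forall>S\<in>Xm m. s S = G ` S"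
    by (elim exE conjE)
  have "\<sigma> P \<in> Xm (Suc m)" if "P \<in> Xm (Suc m)" for P
    using step.prems that by (auto simp: preserving_def dest: bij_betwE)
  then have "\<sigma> P = G ` P" if "P \<in> Xm (Suc m)" for P
    using lift_semilinear[of m G s \<sigma> P] G s(2) that step.hyps by simp
  then show ?case using G by blast
qed

end


subsection \<open>Automorphisms preserve fibres and adjacency\<close>

lemma factor_through:
  assumes "\<And>a b. a \<in> A \<Longrightarrow> b \<in> A \<Longrightarrow> f a = f b \<Longrightarrow> g a = g b"
  shows "\<exists>\<phi>. \<forall>a\<in>A. g a = \<phi> (f a)"
proof (intro exI ballI)
  fix a assume a: "a \<in> A"
  then have "(SOME b. b \<in> A \<and> f b = f a) \<in> A \<and> f (SOME b. b \<in> A \<and> f b = f a) = f a"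
    by (intro someI[of "\<lambda>b. b \<in> A \<and> f b = f a" a]) simp
  then show "g a = (\<lambda>i. g (SOME b. b \<in> A \<and> f b = i)) (f a)" using assms[OF a] by metis
qed

context attenuated
begin

text \<open>
  For members of \<open>X m\<close> this is (m - i + l, m - j) in terms of the index pair (i, j - i) of their relation.
\<close>

definition idx :: "('a ^ 'k) set \<Rightarrow> ('a ^ 'k) set \<Rightarrow> nat \<times> nat" where
  "idx P Q = (vec.dim (sh P \<inter> sh Q), vec.dim (P \<inter> Q))"

section \<open>Semilinear maps fixing E, and shears\<close>

lemma sh_image: "semilinear g \<Longrightarrow> g ` E = E \<Longrightarrow> sh (g ` P) = g ` sh P"
  unfolding sh_def by (simp add: image_subspace_sum)

lemma Xm_image:
  assumes g: "semilinear g" "bij g" "g ` E = E" and P: "P \<in> Xm k"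
  shows "g ` P \<in> Xm k"
proof (rule XmI)
  show "vec.subspace (g ` P)" using subspace_image[OF subspace_Xm[OF P] g(1)] .
  show "vec.dim (g ` P) = k" using dim_semilinear_image[OF g(1,2)] XmD(2)[OF P] by simp
  have "g (0 + 0) = g 0 + g 0" using g(1) unfolding semilinear_def by blast
  then have "g 0 = 0" by simp
  have "g ` P \<inter> E = g ` (P \<inter> E)" using g by (metis bij_is_inj image_Int)
  then show "g ` P \<inter> E = {0}" using XmD(3)[OF P] \<open>g 0 = 0\<close> by simp
qed

lemma idx_image:
  assumes g: "semilinear g" "bij g" "g ` E = E"
  shows "idx (g ` P) (g ` Q) = idx P Q"
proof -
  have "sh (g ` P) \<inter> sh (g ` Q) = g ` (sh P \<inter> sh Q)" "g ` P \<inter> g ` Q = g ` (P \<inter> Q)"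
    using g by (simp_all add: sh_image image_Int bij_is_inj)
  then show ?thesis unfolding idx_def using dim_semilinear_image[OF g(1,2)] by simp
qed

text \<open>Such an \<open>h\<close> factors through the quotient by \<open>E\<close> and takes
  values in \<open>E\<close>. Adding it to the identity gives a unipotent map that is trivial on
  \<open>E\<close> and on the quotient; it moves subspaces inside their fibres and preserves index
  pairs.\<close>

definition shear :: "('a ^ 'k \<Rightarrow> 'a ^ 'k) \<Rightarrow> bool" where
  "shear h \<longleftrightarrow> Vector_Spaces.linear (*s) (*s) h \<and> (\<forall>v. h v \<in> E) \<and> (\<forall>e\<in>E. h e = 0)"

lemma shear_map:
  assumes h: "shear h"
  shows "semilinear (\<lambda>v. v + h v)" "bij (\<lambda>v. v + h v)" "(\<lambda>v. v + h v) ` E = E"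
proof -
  have hE: "h v \<in> E" "e \<in> E \<Longrightarrow> h e = 0" for v e using h by (auto simp: shear_def)
  interpret h: Vector_Spaces.linear "(*s)" "(*s)" h using h by (simp add: shear_def)
  have lin: "Vector_Spaces.linear (*s) (*s) (\<lambda>v. v + h v)"
    by unfold_locales (simp_all add: h.add h.scale vec.scale_right_distrib)
  then show "semilinear (\<lambda>v. v + h v)" by (rule linear_imp_semilinear)
  have "inj (\<lambda>v. v + h v)"
  proof (rule injI)
    fix u v assume "u + h u = v + h v"
    then have eq: "u - v = h (v - u)" by (simp add: h.diff algebra_simps)
    then have "v - u \<in> E" using hE(1)[of "u - v"] h.diff[of u v] h.diff[of v u]
      by (metis hE(1) minus_diff_eq subspace_E vec.subspace_neg)
    then show "u = v" using eq hE(2) by simp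
  qed
  then show "bij (\<lambda>v. v + h v)" by (simp add: bij_def finite_UNIV_inj_surj)
  show "(\<lambda>v. v + h v) ` E = E" using hE(2) by force
qed

lemma shear_Xm:
  assumes "shear h" "P \<in> Xm k"
  shows "(\<lambda>v. v + h v) ` P \<in> Xm k" "sh ((\<lambda>v. v + h v) ` P) = sh P"
proof -
  show X: "(\<lambda>v. v + h v) ` P \<in> Xm k" by (rule Xm_image[OF shear_map[OF assms(1)] assms(2)])
  have "(\<lambda>v. v + h v) ` P \<subseteq> sh P"
    unfolding sh_def subspace_sum_def using assms(1) by (auto simp: shear_def)
  then have "sh ((\<lambda>v. v + h v) ` P) \<subseteq> sh P" using assms(2) by (intro sh_least E_subset_sh) auto
  then show "sh ((\<lambda>v. v + h v) ` P) = sh P" by (rule sh_eqI[OF X assms(2)])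
qed

lemma shear_exists:
  assumes S: "vec.subspace S" "E \<subseteq> S" and v: "v \<notin> S" and e: "e \<in> E"
  shows "\<exists>h. shear h \<and> (\<forall>x\<in>S. h x = 0) \<and> h v = e \<and> range h \<subseteq> vec.span {e}"
proof -
  obtain h where h: "Vector_Spaces.linear (*s) (*s) h" "\<forall>x\<in>S. h x = 0" "h v = e" "range h \<subseteq> vec.span {e}"
    using rank_one_map_exists[OF S(1) v, of e] by blast
  have "vec.span {e} \<subseteq> E" using e subspace_E by (intro vec.span_minimal) auto
  then have "shear h" using h S(2) unfolding shear_def by blast
  then show ?thesis using h by blast
qed

definition near :: "nat \<Rightarrow> ('a ^ 'k) set \<Rightarrow> ('a ^ 'k) set \<Rightarrow> bool" where
  "near k P Q \<longleftrightarrow> P \<in> Xm k \<and> Q \<in> Xm k \<and> sh P = sh Q \<and> Suc (vec.dim (P \<inter> Q)) = k"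

text \<open>The kernel of \<open>h\<close> on \<open>P\<close> is a hyperplane of \<open>P\<close>
  that is fixed vectorwise. The image differs from \<open>P\<close> because it contains
  \<open>v + h v\<close>, and a nonzero vector of \<open>E\<close> is not in
  \<open>P\<close>.\<close>

lemma near_shear:
  assumes h: "shear h" "range h \<subseteq> vec.span {h v}" "h v \<noteq> 0" and P: "P \<in> Xm k" "v \<in> P"
  shows "near k P ((\<lambda>v. v + h v) ` P)"
proof -
  let ?T = "\<lambda>v. v + h v"
  interpret h: Vector_Spaces.linear "(*s)" "(*s)" h using h by (simp add: shear_def)
  let ?K = "{x \<in> P. h x = 0}"
  have sP: "vec.subspace P" using P by simp
  have sK: "vec.subspace ?K"
    using sP by (auto simp: vec.subspace_def h.add h.scale)
  have "P \<subseteq> vec.span (insert v ?K)"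
  proof
    fix x assume x: "x \<in> P"
    obtain c where "h x = c *s h v" using h(2) by (auto simp: vec.span_singleton)
    then have "x - c *s v \<in> ?K" using x P sP by (simp add: h.diff h.scale vec.subspace_diff vec.subspace_scale)
    then show "x \<in> vec.span (insert v ?K)" using span_insert_subspace[OF sK] by blast
  qed
  then have "vec.dim P \<le> vec.dim (vec.span (insert v ?K))" by (rule vec.dim_subset)
  then have "vec.dim P \<le> Suc (vec.dim ?K)" by (simp add: vec.dim_insert split: if_splits)
  moreover have "?K \<subseteq> P \<inter> ?T ` P" by force
  then have "vec.dim ?K \<le> vec.dim (P \<inter> ?T ` P)" by (rule vec.dim_subset)
  moreover have "vec.dim (P \<inter> ?T ` P) < k"
  proof (rule ccontr)
    assume "\<not> ?thesis"
    then have "P \<inter> ?T ` P = P"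
      using vec.subspace_dim_equal[of "P \<inter> ?T ` P" P] sP shear_Xm(1)[OF h(1) P(1)] XmD(2)[OF P(1)]
      by (simp add: vec.subspace_inter)
    then have "P = ?T ` P" using Xm_eqI[OF P(1) shear_Xm(1)[OF h(1) P(1)]] by blast
    then have "v + h v \<in> P" using P by blast
    then have "v + h v - v \<in> P" using P sP by (intro vec.subspace_diff)
    then have "h v \<in> P \<inter> E" using h(1) by (simp add: shear_def)
    then show False using XmD(3)[OF P(1)] h(3) by blast
  qed
  ultimately show ?thesis unfolding near_def using P shear_Xm[OF h(1) P(1)] XmD(2)[OF P(1)] by simp
qed

text \<open>Any two members of a fibre are joined by steps of distance one: a shear vanishing on
  \<open>P \<inter> Q\<close> moves one further vector of \<open>P\<close> into \<open>Q\<close>, so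
  the intersection with \<open>Q\<close> grows strictly.\<close>

lemma fibre_connected:
  assumes refl: "\<And>P. P \<in> Xm k \<Longrightarrow> r P P"
    and trans: "\<And>P Q R. P \<in> Xm k \<Longrightarrow> Q \<in> Xm k \<Longrightarrow> R \<in> Xm k \<Longrightarrow> r P Q \<Longrightarrow> r Q R \<Longrightarrow> r P R"
    and near: "\<And>P Q. near k P Q \<Longrightarrow> r P Q"
    and PQ: "P \<in> Xm k" "Q \<in> Xm k" "sh P = sh Q"
  shows "r P Q"
  using PQ
proof (induction "k - vec.dim (P \<inter> Q)" arbitrary: P rule: less_induct)
  case less
  show ?case
  proof (cases "P \<subseteq> Q")
    case True
    then show ?thesis using Xm_eqI[OF less.prems(1,2)] refl less.prems by blast
  next
    case False
    then obtain p where p: "p \<in> P" "p \<notin> Q" by blast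
    have sPQ: "vec.subspace (P \<inter> Q)" using less.prems by (simp add: vec.subspace_inter)
    have "p \<in> sh Q" using p less.prems(3) subset_sh by blast
    then obtain e where e: "e \<in> E" "p + e \<in> Q" using in_sh by blast
    have "e \<noteq> 0" using e p by auto
    have "P \<inter> sh (P \<inter> Q) = P \<inter> Q" by (rule Int_sh_sub[OF less.prems(1) sPQ]) simp
    then have "p \<notin> sh (P \<inter> Q)" using p by blast
    then obtain h where h: "shear h" "\<forall>x\<in>sh (P \<inter> Q). h x = 0" "h p = e" "range h \<subseteq> vec.span {e}"
      using shear_exists[of "sh (P \<inter> Q)" p e] e(1) sPQ E_subset_sh[OF sPQ] by auto
    let ?P = "(\<lambda>v. v + h v) ` P"
    have n: "near k P ?P" using near_shear[OF h(1) _ _ less.prems(1) p(1)] h \<open>e \<noteq> 0\<close> by simp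
    have X: "?P \<in> Xm k" "sh ?P = sh Q" using n less.prems by (auto simp: near_def)
    have sP'Q: "vec.subspace (?P \<inter> Q)" using X(1) less.prems(2) by (simp add: vec.subspace_inter)
    have sub: "P \<inter> Q \<subseteq> ?P \<inter> Q"
    proof
      fix x assume x: "x \<in> P \<inter> Q"
      then have "h x = 0" using h(2) subset_sh by blast
      then show "x \<in> ?P \<inter> Q" using x by (auto intro!: image_eqI[of _ _ x])
    qed
    have in': "p + e \<in> ?P \<inter> Q" using e p h(3) by auto
    have notin: "p + e \<notin> P"
    proof
      assume "p + e \<in> P"
      then have "p + e - p \<in> P" using p less.prems by (intro vec.subspace_diff) auto
      then show False using e(1) \<open>e \<noteq> 0\<close> XmD(3)[OF less.prems(1)] by auto
    qed
    have lt: "vec.dim (P \<inter> Q) < vec.dim (?P \<inter> Q)"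
    proof (rule ccontr)
      assume "\<not> ?thesis"
      then have "P \<inter> Q = ?P \<inter> Q" by (intro vec.subspace_dim_equal[OF sPQ sP'Q sub]) (simp only: not_less)
      then have "p + e \<in> P \<inter> Q" using in' by (simp only:)
      then show False using notin by blast
    qed
    moreover have "vec.dim (P \<inter> Q) < k"
      using lt vec.dim_subset[of "?P \<inter> Q" Q] XmD(2)[OF less.prems(2)] by simp
    ultimately have "r ?P Q" using less.hyps[OF _ X(1) less.prems(2) X(2)] by auto
    then show ?thesis using trans[OF less.prems(1) X(1) less.prems(2)] near[OF n] by blast
  qed
qed

lemma sh_eq_iff_idx:
  assumes "P \<in> Xm k" "Q \<in> Xm k"
  shows "sh P = sh Q \<longleftrightarrow> fst (idx P Q) = k + vec.dim E"
proof
  assume "sh P = sh Q"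
  then show "fst (idx P Q) = k + vec.dim E" using dim_sh[OF assms(2)] by (simp add: idx_def)
next
  assume "fst (idx P Q) = k + vec.dim E"
  then show "sh P = sh Q" using dim_sh_Int_less[OF assms] unfolding idx_def by fastforce
qed

lemma near_idx: "near k P Q \<Longrightarrow> idx P Q = (k + vec.dim E, k - 1)"
  using sh_eq_iff_idx[of P k Q] by (auto simp: near_def idx_def)

lemma adj_idx: "adj k P Q \<longleftrightarrow> P \<in> Xm k \<and> Q \<in> Xm k \<and> k \<ge> 1 \<and> idx P Q = (k - 1 + vec.dim E, k - 1)"
proof
  assume "adj k P Q"
  then show "P \<in> Xm k \<and> Q \<in> Xm k \<and> k \<ge> 1 \<and> idx P Q = (k - 1 + vec.dim E, k - 1)"
    using adj_dim_sh[of k P Q] by (auto simp: adj_def idx_def)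
next
  assume "P \<in> Xm k \<and> Q \<in> Xm k \<and> k \<ge> 1 \<and> idx P Q = (k - 1 + vec.dim E, k - 1)"
  then show "adj k P Q" using sh_eq_iff_idx[of P k Q] by (auto simp: adj_def idx_def)
qed

section \<open>Permutations of the index pairs; invariance of the fibres\<close>

definition idx_map :: "nat \<Rightarrow> (('a ^ 'k) set \<Rightarrow> ('a ^ 'k) set) \<Rightarrow> bool" where
  "idx_map k \<sigma> \<longleftrightarrow> bij_betw \<sigma> (Xm k) (Xm k) \<and>
    (\<forall>P\<in>Xm k. \<forall>Q\<in>Xm k. \<forall>P'\<in>Xm k. \<forall>Q'\<in>Xm k. idx P Q = idx P' Q' \<longleftrightarrow> idx (\<sigma> P) (\<sigma> Q) = idx (\<sigma> P') (\<sigma> Q'))"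

text \<open>
  The induced map on the finitely many index pairs is onto because \<open>\<sigma>\<close> is, hence it is injective.
\<close>

lemma idx_mapI:
  assumes bij: "bij_betw \<sigma> (Xm k) (Xm k)"
    and \<sigma>: "\<And>P Q P' Q'. P \<in> Xm k \<Longrightarrow> Q \<in> Xm k \<Longrightarrow> P' \<in> Xm k \<Longrightarrow> Q' \<in> Xm k \<Longrightarrow>
      idx P Q = idx P' Q' \<Longrightarrow> idx (\<sigma> P) (\<sigma> Q) = idx (\<sigma> P') (\<sigma> Q')"
  shows "idx_map k \<sigma>"
proof -
  let ?A = "Xm k \<times> Xm k"
  have im: "\<sigma> ` Xm k = Xm k" using bij by (simp add: bij_betw_def)
  have "\<exists>\<phi>. \<forall>a\<in>?A. (\<lambda>(P, Q). idx (\<sigma> P) (\<sigma> Q)) a = \<phi> ((\<lambda>(P, Q). idx P Q) a)"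
    by (rule factor_through) (use \<sigma> in auto)
  then obtain \<phi> where \<phi>: "\<And>P Q. P \<in> Xm k \<Longrightarrow> Q \<in> Xm k \<Longrightarrow> idx (\<sigma> P) (\<sigma> Q) = \<phi> (idx P Q)"
    by auto
  define I where "I = (\<lambda>(P, Q). idx P Q) ` ?A"
  have "finite I" by (simp add: I_def)
  have "\<phi> ` I = I"
  proof (intro equalityI subsetI)
    fix i assume "i \<in> \<phi> ` I"
    then obtain P Q where PQ: "P \<in> Xm k" "Q \<in> Xm k" "i = \<phi> (idx P Q)" by (auto simp: I_def)
    then have "i = idx (\<sigma> P) (\<sigma> Q)" "\<sigma> P \<in> Xm k" "\<sigma> Q \<in> Xm k" using \<phi> im by auto
    then show "i \<in> I" by (auto simp: I_def)
  next
    fix i assume "i \<in> I"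
    then obtain P Q where PQ: "P \<in> Xm k" "Q \<in> Xm k" "i = idx P Q" by (auto simp: I_def)
    then have "P \<in> \<sigma> ` Xm k" "Q \<in> \<sigma> ` Xm k" using im by simp_all
    then obtain P' Q' where PQ': "P' \<in> Xm k" "Q' \<in> Xm k" "P = \<sigma> P'" "Q = \<sigma> Q'"
      by (elim imageE)
    then have "i = \<phi> (idx P' Q')" using PQ \<phi> by simp
    moreover have "idx P' Q' \<in> I" using PQ' by (auto simp: I_def)
    ultimately show "i \<in> \<phi> ` I" by blast
  qed
  then have "inj_on \<phi> I" using \<open>finite I\<close> by (simp add: finite_surj_inj)
  moreover have "idx P Q \<in> I" if "P \<in> Xm k" "Q \<in> Xm k" for P Q using that by (auto simp: I_def)
  ultimately have "idx P Q = idx P' Q' \<longleftrightarrow> idx (\<sigma> P) (\<sigma> Q) = idx (\<sigma> P') (\<sigma> Q')"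
    if "P \<in> Xm k" "Q \<in> Xm k" "P' \<in> Xm k" "Q' \<in> Xm k" for P Q P' Q'
    using that \<phi> by (metis inj_onD)
  then show ?thesis using bij by (simp add: idx_map_def)
qed

lemma idx_map_fibre:
  assumes \<sigma>: "idx_map k \<sigma>" and PQ: "P \<in> Xm k" "Q \<in> Xm k"
  shows "sh P = sh Q \<longleftrightarrow> sh (\<sigma> P) = sh (\<sigma> Q)"
proof -
  have bij: "bij_betw \<sigma> (Xm k) (Xm k)" using \<sigma> by (simp add: idx_map_def)
  then have inj: "inj_on \<sigma> (Xm k)" and im: "\<sigma> ` Xm k = Xm k" by (auto simp: bij_betw_def)
  have mem: "\<sigma> P \<in> Xm k" if "P \<in> Xm k" for P using im that by blast
  have id: "idx P Q = idx P' Q' \<Longrightarrow> idx (\<sigma> P) (\<sigma> Q) = idx (\<sigma> P') (\<sigma> Q')"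
    if "P \<in> Xm k" "Q \<in> Xm k" "P' \<in> Xm k" "Q' \<in> Xm k" for P Q P' Q'
    using \<sigma> that by (simp add: idx_map_def)
  define F where "F = {(P, Q) \<in> Xm k \<times> Xm k. sh P = sh Q}"
  define G where "G = {(P, Q) \<in> Xm k \<times> Xm k. sh (\<sigma> P) = sh (\<sigma> Q)}"
  have G_inv: "sh (\<sigma> P') = sh (\<sigma> Q')"
    if "P \<in> Xm k" "Q \<in> Xm k" "P' \<in> Xm k" "Q' \<in> Xm k" "idx P Q = idx P' Q'" "sh (\<sigma> P) = sh (\<sigma> Q)" for P Q P' Q'
    using id[OF that(1-5)] that(6) sh_eq_iff_idx[OF mem[OF that(1)] mem[OF that(2)]]
      sh_eq_iff_idx[OF mem[OF that(3)] mem[OF that(4)]] by simp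
  have "G \<subseteq> F \<or> F \<subseteq> G"
  proof (cases "G \<subseteq> F")
    case False
    then obtain P Q where PQ: "P \<in> Xm k" "Q \<in> Xm k" "sh (\<sigma> P) = sh (\<sigma> Q)" "sh P \<noteq> sh Q"
      by (auto simp: F_def G_def)
    have "\<not> Q \<subseteq> sh P"
      using sh_eqI[OF PQ(2,1)] sh_least[of "sh P" Q] E_subset_sh[of P] PQ by auto
    then obtain q where q: "q \<in> Q" "q \<notin> sh P" by blast
    obtain e where e: "e \<in> E" "e \<noteq> 0" using E_nontrivial vec.subspace_0[OF subspace_E] by blast
    obtain h where h: "shear h" "\<forall>x\<in>sh P. h x = 0" "h q = e" "range h \<subseteq> vec.span {e}"
      using shear_exists[of "sh P" q e] e q PQ(1) E_subset_sh[of P] by auto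
    let ?Q = "(\<lambda>v. v + h v) ` Q"
    have n: "near k Q ?Q" using near_shear[OF h(1) _ _ PQ(2) q(1)] h e by simp
    then have Q': "?Q \<in> Xm k" by (simp add: near_def)
    have hP: "h x = 0" if "x \<in> P" for x using h(2) subset_sh that by blast
    have TP: "(\<lambda>v. v + h v) ` P = P" using hP by force
    have "idx P Q = idx P ?Q" using idx_image[OF shear_map[OF h(1)], of P Q] TP by simp
    then have "sh (\<sigma> P) = sh (\<sigma> ?Q)" using G_inv[OF PQ(1,2) PQ(1) Q' _ PQ(3)] by blast
    then have r: "sh (\<sigma> Q) = sh (\<sigma> ?Q)" using PQ(3) by simp
    have "sh (\<sigma> A) = sh (\<sigma> B)" if "A \<in> Xm k" "B \<in> Xm k" "sh A = sh B" for A B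
    proof (rule fibre_connected[where r = "\<lambda>A B. sh (\<sigma> A) = sh (\<sigma> B)", OF _ _ _ that])
      \<comment> \<open>All pairs at distance one in a fibre have the same index pair, so the single
        related pair \<open>Q\<close>, \<open>?Q\<close> suffices to relate them all.\<close>
      fix A B assume ab: "near k A B"
      then have "idx Q ?Q = idx A B" "A \<in> Xm k" "B \<in> Xm k" using near_idx n by (simp_all add: near_def)
      then show "sh (\<sigma> A) = sh (\<sigma> B)" using G_inv[OF PQ(2) Q' _ _ _ r] by blast
    qed simp_all
    then show ?thesis by (auto simp: F_def G_def)
  qed blast
  moreover have "card G = card F"
  proof -
    have "inj_on (map_prod \<sigma> \<sigma>) G" using inj by (auto simp: G_def inj_on_def)
    moreover have "map_prod \<sigma> \<sigma> ` G = F"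
    proof (intro equalityI subsetI)
      fix x assume "x \<in> map_prod \<sigma> \<sigma> ` G"
      then show "x \<in> F" using mem by (auto simp: F_def G_def)
    next
      fix x assume "x \<in> F"
      then obtain A B where AB: "x = (A, B)" "A \<in> Xm k" "B \<in> Xm k" "sh A = sh B" by (auto simp: F_def)
      then have "A \<in> \<sigma> ` Xm k" "B \<in> \<sigma> ` Xm k" using im by simp_all
      then obtain A' B' where "A' \<in> Xm k" "B' \<in> Xm k" "A = \<sigma> A'" "B = \<sigma> B'"
        by (elim imageE)
      then show "x \<in> map_prod \<sigma> \<sigma> ` G" using AB by (intro image_eqI[of _ _ "(A', B')"]) (auto simp: G_def)
    qed
    ultimately show ?thesis using card_image by metis
  qed
  ultimately have "G = F" by (metis card_subset_eq finite)
  then have "(P, Q) \<in> F \<longleftrightarrow> (P, Q) \<in> G" by simp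
  then show ?thesis using PQ by (simp add: F_def G_def)
qed

section \<open>Counting inside a fibre\<close>

definition fibre_nbrs :: "nat \<Rightarrow> ('a ^ 'k) set \<Rightarrow> ('a ^ 'k) set \<Rightarrow> ('a ^ 'k) set set" where
  "fibre_nbrs k P Q = {Q' \<in> Xm k. sh Q' = sh Q \<and> idx P Q' = idx P Q}"

text \<open>By \<open>adj_Int\<close> all these \<open>Q'\<close> contain the same hyperplane
  \<open>P \<inter> Q\<close>. For a fixed \<open>q\<close> of \<open>Q\<close> outside it,
  \<open>Q'\<close> is determined by a vector \<open>e\<close> of \<open>E\<close> with
  \<open>q + e\<close> in \<open>Q'\<close>.\<close>

lemma card_fibre_nbrs_adj:
  assumes a: "adj k P Q"
  shows "card (fibre_nbrs k P Q) \<le> card E"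
proof -
  have X: "P \<in> Xm k" "Q \<in> Xm k" "sh P \<noteq> sh Q" using a by (auto simp: adj_def)
  let ?D = "P \<inter> Q"
  have sD: "vec.subspace ?D" using X by (simp add: vec.subspace_inter)
  have dD: "Suc (vec.dim ?D) = k" using a by (simp add: adj_def)
  obtain q where q: "q \<in> Q" "q \<notin> ?D"
    using subspace_dim_less_exists[OF sD, of Q] X(2) dD XmD(2)[OF X(2)] by auto
  have "\<exists>e\<in>E. q + e \<in> Q' \<and> Q' = vec.span (insert (q + e) ?D)" if Q': "Q' \<in> fibre_nbrs k P Q" for Q'
  proof -
    have Q'X: "Q' \<in> Xm k" "sh Q' = sh Q" "idx P Q' = idx P Q" using Q' by (auto simp: fibre_nbrs_def)
    then have a': "adj k P Q'" using a adj_idx by simp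
    have D: "P \<inter> Q' = ?D" using adj_Int[OF a] adj_Int[OF a'] Q'X(2) by simp
    have "q \<in> sh Q'" using q Q'X(2) subset_sh by blast
    then obtain e where e: "e \<in> E" "q + e \<in> Q'" using in_sh by blast
    have "q + e \<notin> ?D"
    proof
      assume qe: "q + e \<in> ?D"
      then have "q + e - q \<in> Q" using q X(2) by (intro vec.subspace_diff) auto
      then have "e = 0" using e(1) XmD(3)[OF X(2)] by auto
      then show False using qe q by simp
    qed
    then have "vec.span (insert (q + e) ?D) = Q'"
      using D e Q'X(1) XmD(2)[OF Q'X(1)] dD by (intro span_insert_eq sD) auto
    then show ?thesis using e by blast
  qed
  then obtain f where f: "\<And>Q'. Q' \<in> fibre_nbrs k P Q \<Longrightarrow> f Q' \<in> E \<and> Q' = vec.span (insert (q + f Q') ?D)"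
    by metis
  then have "inj_on f (fibre_nbrs k P Q)" by (metis inj_onI)
  moreover have "f ` fibre_nbrs k P Q \<subseteq> E" using f by blast
  ultimately show ?thesis by (intro card_inj_on_le) auto
qed

text \<open>The hypothesis provides \<open>a\<close>, \<open>b\<close> in \<open>Q\<close>
  independent modulo \<open>sh P\<close>. Shears vanishing on \<open>sh P\<close> can move them by
  an arbitrary pair from \<open>E\<close>, and different pairs give different subspaces, since a
  member contains at most one translate of a given vector by \<open>E\<close>. This yields the
  square of \<open>card E\<close>.\<close>

lemma card_fibre_nbrs_far:
  assumes X: "P \<in> Xm k" "Q \<in> Xm k" and far: "vec.dim (sh P \<inter> sh Q) + 2 \<le> k + vec.dim E"
  shows "card E < card (fibre_nbrs k P Q)"
proof -
  let ?S = "sh P"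
  have sS: "vec.subspace ?S" using X by simp
  have "\<not> Q \<subseteq> ?S"
  proof
    assume "Q \<subseteq> ?S"
    then have "sh Q \<subseteq> ?S" using X E_subset_sh[of P] by (intro sh_least) auto
    then have "sh P \<inter> sh Q = sh Q" by blast
    then show False using far dim_sh[OF X(2)] by simp
  qed
  then obtain a where a: "a \<in> Q" "a \<notin> ?S" by blast
  have "\<not> Q \<subseteq> vec.span (insert a ?S)"
  proof
    assume q: "Q \<subseteq> vec.span (insert a ?S)"
    have "E \<subseteq> vec.span (insert a ?S)" using E_subset_sh[of P] X by (auto intro: vec.span_base)
    then have "sh Q \<subseteq> vec.span (insert a ?S)" using q by (intro sh_least) auto
    then have "subspace_sum (sh P) (sh Q) \<subseteq> vec.span (insert a ?S)" by (intro subspace_sum_least) (auto intro: vec.span_base)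
    then have "vec.dim (subspace_sum (sh P) (sh Q)) \<le> vec.dim (vec.span (insert a ?S))" by (rule vec.dim_subset)
    then show False
      using dim_sh_insert[OF X(1) a(2)] dim_subspace_sum[of "sh P" "sh Q"] X dim_sh[OF X(1)] dim_sh[OF X(2)] far by simp
  qed
  then obtain b where b: "b \<in> Q" "b \<notin> vec.span (insert a ?S)" by blast
  have bS: "b \<notin> ?S" using b by (auto intro: vec.span_base)
  have a': "a \<notin> vec.span (insert b ?S)" using span_insert_exchange[OF sS, of a b] a(2) b(2) by blast
  have "\<exists>h. shear h \<and> (\<forall>x\<in>?S. h x = 0) \<and> h a = c \<and> h b = d" if cd: "c \<in> E" "d \<in> E" for c d
  proof -
    have E': "E \<subseteq> vec.span (insert b ?S)" "E \<subseteq> vec.span (insert a ?S)"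
      using E_subset_sh[of P] X by (auto intro: vec.span_base)
    \<comment> \<open>Two shears, each vanishing on the vector whose displacement the other
      prescribes, are added.\<close>
    obtain h1 where h1: "shear h1" "\<forall>x\<in>vec.span (insert b ?S). h1 x = 0" "h1 a = c"
      using shear_exists[OF _ E'(1) a' cd(1)] by auto
    obtain h2 where h2: "shear h2" "\<forall>x\<in>vec.span (insert a ?S). h2 x = 0" "h2 b = d"
      using shear_exists[OF _ E'(2) b(2) cd(2)] by auto
    interpret h1: Vector_Spaces.linear "(*s)" "(*s)" h1 using h1 by (simp add: shear_def)
    interpret h2: Vector_Spaces.linear "(*s)" "(*s)" h2 using h2 by (simp add: shear_def)
    have "Vector_Spaces.linear (*s) (*s) (\<lambda>v. h1 v + h2 v)"
      by unfold_locales (simp_all add: h1.add h1.scale h2.add h2.scale vec.scale_right_distrib)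
    then have "shear (\<lambda>v. h1 v + h2 v)" using h1(1) h2(1) subspace_E by (auto simp: shear_def vec.subspace_add)
    moreover have "?S \<subseteq> vec.span (insert b ?S)" "?S \<subseteq> vec.span (insert a ?S)"
      "b \<in> vec.span (insert b ?S)" "a \<in> vec.span (insert a ?S)" by (auto intro: vec.span_base)
    then have "(\<forall>x\<in>?S. h1 x + h2 x = 0) \<and> h1 a + h2 a = c \<and> h1 b + h2 b = d"
      using h1(2,3) h2(2,3) by (simp add: subset_iff)
    ultimately show ?thesis by blast
  qed
  then obtain h where h: "\<And>c d. c \<in> E \<Longrightarrow> d \<in> E \<Longrightarrow>
      shear (h c d) \<and> (\<forall>x\<in>?S. h c d x = 0) \<and> h c d a = c \<and> h c d b = d" by metis
  define \<psi> where "\<psi> = (\<lambda>(c, d). (\<lambda>v. v + h c d v) ` Q)"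
  have \<psi>X: "\<psi> (c, d) \<in> fibre_nbrs k P Q" if cd: "c \<in> E" "d \<in> E" for c d
  proof -
    have s: "shear (h c d)" using h cd by blast
    have "(\<lambda>v. v + h c d v) ` P = P"
    proof -
      have "h c d x = 0" if "x \<in> P" for x using h[OF cd] subset_sh that by blast
      then show ?thesis by force
    qed
    then have "idx P (\<psi> (c, d)) = idx P Q" using idx_image[OF shear_map[OF s], of P Q] by (simp add: \<psi>_def)
    then show ?thesis using shear_Xm[OF s X(2)] by (simp add: fibre_nbrs_def \<psi>_def)
  qed
  have det: "x = y" if "x \<in> E" "y \<in> E" "u + x \<in> R" "u + y \<in> R" "R \<in> Xm k" for x y u R
  proof -
    have "(u + x) - (u + y) \<in> R" using that by (intro vec.subspace_diff) auto
    moreover have "x - y \<in> E" using that subspace_E by (intro vec.subspace_diff)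
    ultimately have "x - y \<in> R \<inter> E" by simp
    then have "x - y \<in> {0}" unfolding XmD(3)[OF that(5)] .
    then show ?thesis by simp
  qed
  have img: "u + h c d u \<in> \<psi> (c, d)" if "u \<in> Q" for u c d using that by (simp add: \<psi>_def)
  have "inj_on \<psi> (E \<times> E)"
  proof (rule inj_onI, clarify)
    fix c d c' d' assume cd: "c \<in> E" "d \<in> E" "c' \<in> E" "d' \<in> E" and eq: "\<psi> (c, d) = \<psi> (c', d')"
    have m: "a + c \<in> \<psi> (c, d)" "b + d \<in> \<psi> (c, d)" "a + c' \<in> \<psi> (c', d')" "b + d' \<in> \<psi> (c', d')"
      using h[OF cd(1,2)] h[OF cd(3,4)] img[OF a(1)] img[OF b(1)] by metis+
    have "\<psi> (c, d) \<in> Xm k" using \<psi>X[OF cd(1,2)] by (simp add: fibre_nbrs_def)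
    then show "c = c' \<and> d = d'" using det cd m eq by metis
  qed
  moreover have "\<psi> ` (E \<times> E) \<subseteq> fibre_nbrs k P Q" using \<psi>X by auto
  ultimately have le: "card (E \<times> E) \<le> card (fibre_nbrs k P Q)" by (intro card_inj_on_le) auto
  obtain e where e: "e \<in> E" "e \<noteq> 0" using E_nontrivial vec.subspace_0[OF subspace_E] by blast
  have "card {0, e} \<le> card E" using e vec.subspace_0[OF subspace_E] by (intro card_mono) auto
  then have "2 \<le> card E" using e by simp
  then have "card E < card E * card E" by simp
  also have "\<dots> \<le> card (fibre_nbrs k P Q)" using le by (simp add: card_cartesian_product)
  finally show ?thesis .
qed

text \<open>Members counted for the image pair come from members counted for \<open>P\<close>,
  \<open>Q\<close>. The upper bound for adjacent pairs thus passes to the images and excludes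
  shadows meeting in codimension two or more.\<close>

lemma idx_map_adj_dim:
  assumes \<sigma>: "idx_map k \<sigma>" and a: "adj k P Q"
  shows "Suc (vec.dim (sh (\<sigma> P) \<inter> sh (\<sigma> Q))) = k + vec.dim E"
proof -
  have bij: "bij_betw \<sigma> (Xm k) (Xm k)" using \<sigma> by (simp add: idx_map_def)
  then have inj: "inj_on \<sigma> (Xm k)" and im: "\<sigma> ` Xm k = Xm k" by (auto simp: bij_betw_def)
  have X: "P \<in> Xm k" "Q \<in> Xm k" "sh P \<noteq> sh Q" using a by (auto simp: adj_def)
  have mem: "\<sigma> P \<in> Xm k" "\<sigma> Q \<in> Xm k" using im X by blast+
  have "fibre_nbrs k (\<sigma> P) (\<sigma> Q) \<subseteq> \<sigma> ` fibre_nbrs k P Q"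
  proof
    fix R' assume R': "R' \<in> fibre_nbrs k (\<sigma> P) (\<sigma> Q)"
    then have "R' \<in> \<sigma> ` Xm k" using im by (simp add: fibre_nbrs_def)
    then obtain R where R: "R \<in> Xm k" "R' = \<sigma> R" by blast
    have "idx P R = idx P Q" using R' R X \<sigma> by (simp add: fibre_nbrs_def idx_map_def)
    moreover have "sh R = sh Q" using R' R idx_map_fibre[OF \<sigma> R(1) X(2)] by (simp add: fibre_nbrs_def)
    ultimately show "R' \<in> \<sigma> ` fibre_nbrs k P Q" using R by (auto simp: fibre_nbrs_def)
  qed
  then have "card (fibre_nbrs k (\<sigma> P) (\<sigma> Q)) \<le> card (fibre_nbrs k P Q)" by (intro surj_card_le) auto
  then have "\<not> vec.dim (sh (\<sigma> P) \<inter> sh (\<sigma> Q)) + 2 \<le> k + vec.dim E"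
    using card_fibre_nbrs_far[OF mem] card_fibre_nbrs_adj[OF a] by fastforce
  moreover have "sh (\<sigma> P) \<noteq> sh (\<sigma> Q)" using idx_map_fibre[OF \<sigma> X(1,2)] X(3) by blast
  ultimately show ?thesis using dim_sh_Int_less[OF mem] by simp
qed


section \<open>Triples of pairwise adjacent fibres\<close>

lemma adj_sh_Int:
  assumes a: "adj k P Q"
  shows "sh P \<inter> sh Q = sh (P \<inter> Q)"
proof -
  have X: "P \<in> Xm k" "Q \<in> Xm k" using a by (auto simp: adj_def)
  have s: "vec.subspace (P \<inter> Q)" using X by (simp add: vec.subspace_inter)
  have "P \<inter> Q \<in> Xm (vec.dim (P \<inter> Q))" by (rule sub_Xm[OF X(1) s]) simp
  then have d: "vec.dim (sh (P \<inter> Q)) = vec.dim (P \<inter> Q) + vec.dim E" by (rule dim_sh)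
  have "sh (P \<inter> Q) = sh P \<inter> sh Q"
  proof (rule vec.subspace_dim_equal)
    show "vec.subspace (sh (P \<inter> Q))" using s by simp
    show "vec.subspace (sh P \<inter> sh Q)" using X by (simp add: vec.subspace_inter)
    show "sh (P \<inter> Q) \<subseteq> sh P \<inter> sh Q" by (simp add: sh_mono)
    show "vec.dim (sh P \<inter> sh Q) \<le> vec.dim (sh (P \<inter> Q))"
      using adj_dim_sh[OF a] a d by (simp add: adj_def)
  qed
  then show ?thesis by simp
qed

text \<open>If \<open>p\<close> and \<open>q\<close> extend \<open>P \<inter> Q\<close> to
  \<open>P\<close> and \<open>Q\<close>, the third member is its span with \<open>p + q\<close>.
  This choice works over every field, including the one with two elements.\<close>

lemma adj_third:
  assumes a: "adj k P Q"
  shows "\<exists>R. adj k P R \<and> adj k Q R \<and> P \<inter> R = P \<inter> Q \<and> Q \<inter> R = P \<inter> Q"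
proof -
  have X: "P \<in> Xm k" "Q \<in> Xm k" "sh P \<noteq> sh Q" using a by (auto simp: adj_def)
  obtain j where k: "k = Suc j" using a by (auto simp: adj_def)
  let ?D = "P \<inter> Q"
  have sD: "vec.subspace ?D" using X by (simp add: vec.subspace_inter)
  have dD: "vec.dim ?D = j" using a k by (simp add: adj_def)
  have D: "?D \<in> Xm j" using sub_Xm[OF X(1) sD] dD by simp
  obtain p where p: "p \<in> P" "p \<notin> ?D"
    using subspace_dim_less_exists[OF sD, of P] X(1) dD XmD(2)[OF X(1)] k by auto
  obtain q where q: "q \<in> Q" "q \<notin> ?D"
    using subspace_dim_less_exists[OF sD, of Q] X(2) dD XmD(2)[OF X(2)] k by auto
  have pQ: "p \<notin> sh Q" using p adj_Int[OF a] by blast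
  have qP: "q \<notin> sh P" using q adj_Int[of k Q P] a adj_sym by blast
  have pP: "p \<in> sh P" "q \<in> sh Q" using p q subset_sh by blast+
  have P': "p + q \<notin> sh P"
  proof
    assume "p + q \<in> sh P"
    then have "p + q - p \<in> sh P" using pP X(1) by (intro vec.subspace_diff) auto
    then show False using qP by simp
  qed
  have Q': "p + q \<notin> sh Q"
  proof
    assume "p + q \<in> sh Q"
    then have "p + q - q \<in> sh Q" using pP X(2) by (intro vec.subspace_diff) auto
    then show False using pQ by simp
  qed
  have "sh ?D \<subseteq> sh P" by (simp add: sh_mono)
  then have "p + q \<notin> sh ?D" using P' by blast
  then have R: "vec.span (insert (p + q) ?D) \<in> Xm (Suc j)" by (rule insert_Xm[OF D])
  have sub: "?D \<subseteq> vec.span (insert (p + q) ?D)" by (auto intro: vec.span_base)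
  have "p + q \<in> sh (vec.span (insert (p + q) ?D))"
    by (rule subsetD[OF subset_sh]) (simp add: vec.span_base)
  then have ne: "sh P \<noteq> sh (vec.span (insert (p + q) ?D))" "sh Q \<noteq> sh (vec.span (insert (p + q) ?D))"
    using P' Q' by blast+
  have "P \<in> Xm (Suc j)" "Q \<in> Xm (Suc j)" using X k by auto
  then show ?thesis
    using adj_star[OF _ R D _ sub ne(1)] adj_star[OF _ R D _ sub ne(2)] k by blast
qed

text \<open>A neighbour of \<open>Q\<close> meets \<open>Q\<close> in the trace of its shadow. With
  a common \<open>C\<close> this is \<open>Q \<inter> C\<close> for both neighbours, so
  \<open>P\<close> and \<open>R\<close> share that hyperplane.\<close>

lemma adj_pencil_trans:
  assumes PQ: "adj k P Q" and QR: "adj k Q R" and X: "P \<in> Xm k" "R \<in> Xm k" and PR: "sh P \<noteq> sh R"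
    and C: "sh P \<inter> sh Q = C" "sh Q \<inter> sh R = C" "sh P \<inter> sh R = C"
  shows "adj k P R"
proof -
  have 1: "P \<inter> Q = Q \<inter> C"
    using adj_Int[of k Q P] PQ adj_sym[of k P Q] C(1) subset_sh[of Q] by blast
  have 2: "Q \<inter> R = Q \<inter> C" using adj_Int[OF QR] C(2) subset_sh[of Q] by blast
  obtain j where k: "k = Suc j" using PQ by (auto simp: adj_def)
  have Q: "Q \<in> Xm k" using PQ by (simp add: adj_def)
  have "vec.subspace (P \<inter> Q)" "vec.dim (P \<inter> Q) = j"
    using X Q PQ k by (auto simp: vec.subspace_inter adj_def)
  then have D: "P \<inter> Q \<in> Xm j" using sub_Xm[OF X(1), of "P \<inter> Q"] by simp
  have sub: "P \<inter> Q \<subseteq> P" "P \<inter> Q \<subseteq> R" using 1 2 by auto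
  have "P \<in> Xm (Suc j)" "R \<in> Xm (Suc j)" using X k by auto
  then show ?thesis using adj_star(1)[OF _ _ D sub PR] k by blast
qed

text \<open>Taken at the codimension of \<open>E\<close>, this supplies a complement of
  \<open>E\<close>.\<close>

lemma Xm_nonempty:
  assumes "j + vec.dim E \<le> CARD('k)"
  shows "Xm j \<noteq> {}"
  using assms
proof (induction j)
  case 0
  have "{0} \<in> Xm 0" using vec.subspace_0[OF subspace_E] by (intro XmI) auto
  then show ?case by blast
next
  case (Suc j)
  then obtain P where P: "P \<in> Xm j" by auto
  then obtain x where "x \<notin> sh P" using exists_notin[of "sh P"] dim_sh[OF P] Suc.prems by auto
  then show ?case using insert_Xm[OF P] by blast
qed

text \<open>A basis of \<open>N\<close> is extended to one of \<open>M\<close>, and a basis of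
  \<open>E\<close> is joined to it, which stays independent because \<open>M\<close> meets
  \<open>E\<close> trivially. The basis vectors of \<open>M\<close> outside that of \<open>N\<close>
  are sent injectively into the basis of \<open>E\<close>; the dimension bound leaves room for
  this.\<close>

lemma shear_with_kernel:
  assumes N: "vec.subspace N" "N \<subseteq> M" and M: "vec.subspace M" "M \<inter> E = {0}"
    and d: "vec.dim M \<le> vec.dim N + vec.dim E"
  shows "\<exists>h. shear h \<and> (\<forall>x\<in>M. h x = 0 \<longleftrightarrow> x \<in> N)"
proof -
  obtain B where B: "B \<subseteq> N" "vec.independent B" "N \<subseteq> vec.span B" "card B = vec.dim N"
    using vec.basis_exists by blast
  obtain A where A: "B \<subseteq> A" "A \<subseteq> M" "vec.independent A" "M \<subseteq> vec.span A"
    using vec.maximal_independent_subset_extend[of B M] B N(2) by blast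
  obtain D where D: "D \<subseteq> E" "vec.independent D" "E \<subseteq> vec.span D" "card D = vec.dim E"
    using vec.basis_exists by blast
  have cA: "card A = vec.dim M" using vec.basis_card_eq_dim[OF A(2,4,3)] .
  have fin: "finite A" "finite D" "finite B" by simp_all
  have sA: "vec.span A = M" using A M(1) by (intro equalityI vec.span_minimal)
  have sD: "vec.span D = E" using D subspace_E by (intro equalityI vec.span_minimal)
  have sB: "vec.span B = N" using B N(1) by (intro equalityI vec.span_minimal)
  have ind: "vec.independent (A \<union> D)"
  proof (rule vec.card_le_dim_spanning[of _ "subspace_sum M E"])
    show "A \<union> D \<subseteq> subspace_sum M E"
      using A(2) D(1) subspace_sum_subset_left[OF subspace_E, of M] subspace_sum_subset_right[OF M(1), of E] by blast
    show "subspace_sum M E \<subseteq> vec.span (A \<union> D)" unfolding subspace_sum_def vec.span_Un sA sD by blast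
    show "card (A \<union> D) \<le> vec.dim (subspace_sum M E)"
      using dim_subspace_sum[OF M(1) subspace_E] M(2) card_Un_le[of A D] cA D(4) by simp
  qed simp
  have AD: "A \<inter> D = {}"
  proof -
    have "0 \<notin> A" using A(3) vec.dependent_zero by blast
    moreover have "A \<inter> D \<subseteq> {0}" using Int_mono[OF A(2) D(1)] M(2) by (simp only:)
    ultimately show ?thesis by auto
  qed
  have "card (A - B) \<le> card D" using card_Diff_subset[OF fin(3) A(1)] cA B(4) D(4) d by simp
  then obtain c where c: "c ` (A - B) \<subseteq> D" "inj_on c (A - B)"
    using card_le_inj[of "A - B" D] fin by auto
  let ?f = "\<lambda>x. if x \<in> A - B then c x else 0"
  obtain h where h: "Vector_Spaces.linear (*s) (*s) h" "\<forall>x\<in>A \<union> D. h x = ?f x"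
      "range h = vec.span (?f ` (A \<union> D))"
    using vec.linear_independent_extend_subspace[OF ind, of ?f] by blast
  interpret h: Vector_Spaces.linear "(*s)" "(*s)" h by fact
  have "?f ` (A \<union> D) \<subseteq> E" using c(1) D(1) vec.subspace_0[OF subspace_E] by auto
  then have "range h \<subseteq> E" unfolding h(3) using subspace_E by (rule vec.span_minimal)
  moreover have "h x = 0" if "x \<in> D" for x using h(2) that AD by auto
  then have "h e = 0" if "e \<in> E" for e using h.eq_0_on_span[of D e] that sD by blast
  ultimately have "shear h" using h(1) by (auto simp: shear_def)
  moreover have "h x = 0 \<longleftrightarrow> x \<in> N" if x: "x \<in> M" for x
  proof
    have hB: "h b = 0" if "b \<in> B" for b using h(2) that A(1) by auto
    then have hN: "h y = 0" if "y \<in> N" for y using h.eq_0_on_span[of B y] that sB by blast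
    then show "x \<in> N \<Longrightarrow> h x = 0" by blast
    assume hx: "h x = 0"
    have "B \<union> (A - B) = A" using A(1) by blast
    then have "x \<in> vec.span (B \<union> (A - B))" using x sA by simp
    then obtain y z where yz: "x = y + z" "y \<in> vec.span B" "z \<in> vec.span (A - B)"
      unfolding vec.span_Un by blast
    have "h z = 0" using hx yz hN sB by (simp add: h.add)
    have hc: "h ` (A - B) = c ` (A - B)" "inj_on h (A - B)"
      using h(2) c(2) by (auto simp: inj_on_def)
    have "vec.independent (h ` (A - B))" unfolding hc(1) by (rule vec.independent_mono[OF D(2) c(1)])
    then have "inj_on h (vec.span (A - B))" using h.inj_on_span_independent_image hc(2) by blast
    then have "z = 0" using yz(3) \<open>h z = 0\<close> vec.span_zero[of "A - B"] h.zero by (metis inj_onD)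
    then show "x \<in> N" using yz sB by simp
  qed
  ultimately show ?thesis by blast
qed

text \<open>One shear must cut both hyperplanes down to dimension \<open>d\<close>. If they differ,
  a kernel \<open>K\<close> of dimension \<open>d\<close> inside \<open>Y \<inter> Z\<close> could
  require a rank on \<open>Y + Z\<close> exceeding \<open>dim E\<close> by one. Adding
  \<open>y - z\<close>, which lies in neither hyperplane, lowers the rank by one without changing
  the traces on \<open>Y\<close> and \<open>Z\<close>.\<close>

lemma shear_with_two_kernels:
  assumes X: "Q \<in> Xm k" and Y: "vec.subspace Y" "Y \<subseteq> Q" "Suc (vec.dim Y) = k"
    and Z: "vec.subspace Z" "Z \<subseteq> Q" "Suc (vec.dim Z) = k"
    and d: "d < vec.dim Y" "vec.dim Y \<le> d + vec.dim E"
  shows "\<exists>h. shear h \<and> vec.dim {y \<in> Y. h y = 0} = d \<and> vec.dim {z \<in> Z. h z = 0} = d"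
proof -
  have sW: "vec.subspace (Y \<inter> Z)" using Y Z by (simp add: vec.subspace_inter)
  have dj: "vec.dim (subspace_sum Y Z) + vec.dim (Y \<inter> Z) = vec.dim Y + vec.dim Z" by (rule dim_subspace_sum[OF Y(1) Z(1)])
  have jQ: "subspace_sum Y Z \<subseteq> Q" using X Y Z by (intro subspace_sum_least) auto
  have "vec.dim (subspace_sum Y Z) \<le> k" using vec.dim_subset[OF jQ] XmD(2)[OF X] by simp
  then have dW: "d \<le> vec.dim (Y \<inter> Z)" "vec.dim Y \<le> Suc (vec.dim (Y \<inter> Z))" using dj d Y(3) Z(3) by simp_all
  obtain K where K: "vec.subspace K" "K \<subseteq> Y \<inter> Z" "vec.dim K = d"
    using intermediate_subspace[of "{0}" "Y \<inter> Z" d] sW dW vec.subspace_0[OF sW] by auto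
  have jE: "subspace_sum Y Z \<inter> E = {0}" "vec.subspace (subspace_sum Y Z)"
    using XmD(3)[OF sub_Xm[OF X subspace_subspace_sum[OF Y(1) Z(1)] jQ]] subspace_subspace_sum[OF Y(1) Z(1)] by auto
  have main: ?thesis if N: "vec.subspace N" "N \<subseteq> subspace_sum Y Z" "vec.dim (subspace_sum Y Z) \<le> vec.dim N + vec.dim E"
      "Y \<inter> N = K" "Z \<inter> N = K" for N
  proof -
    obtain h where h: "shear h" "\<forall>x\<in>subspace_sum Y Z. h x = 0 \<longleftrightarrow> x \<in> N"
      using shear_with_kernel[OF N(1,2) jE(2,1) N(3)] by blast
    have "Y \<subseteq> subspace_sum Y Z" "Z \<subseteq> subspace_sum Y Z" by (rule subspace_sum_subset_left[OF Z(1)], rule subspace_sum_subset_right[OF Y(1)])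
    then have "{y \<in> Y. h y = 0} = K" "{z \<in> Z. h z = 0} = K" using h(2) N(4,5) by auto
    then show ?thesis using h(1) K(3) by auto
  qed
  show ?thesis
  proof (cases "Y = Z")
    case True
    then have "vec.dim (subspace_sum Y Z) = vec.dim Y" using dj by simp
    then show ?thesis
      by (intro main[of K]) (use K True d subspace_sum_subset_left[OF Z(1), of Y] in auto)
  next
    case False
    have "\<not> Y \<subseteq> Z" using False Y Z vec.subspace_dim_equal[of Y Z] by auto
    then obtain y where y: "y \<in> Y" "y \<notin> Z" by blast
    have "\<not> Z \<subseteq> Y" using False Y Z vec.subspace_dim_equal[of Z Y] by auto
    then obtain z where z: "z \<in> Z" "z \<notin> Y" by blast
    have yz: "y - z \<notin> Y" "y - z \<notin> Z"
      using y z vec.subspace_diff[OF Y(1), of y "y - z"] vec.subspace_add[OF Z(1), of "y - z" z] by auto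
    let ?N = "vec.span (insert (y - z) K)"
    have "y \<in> subspace_sum Y Z" "z \<in> subspace_sum Y Z"
      using y z subspace_sum_subset_left[OF Z(1), of Y] subspace_sum_subset_right[OF Y(1), of Z] by blast+
    then have "y - z \<in> subspace_sum Y Z" using jE(2) by (intro vec.subspace_diff)
    moreover have "K \<subseteq> subspace_sum Y Z" using K(2) subspace_sum_subset_left[OF Z(1), of Y] by blast
    ultimately have NM: "?N \<subseteq> subspace_sum Y Z" using jE(2) by (intro vec.span_minimal) auto
    have "y - z \<notin> K" using yz K by blast
    then have dN: "vec.dim ?N = Suc d" using dim_span_insert[OF K(1)] K(3) by simp
    have KN: "K \<subseteq> ?N" by (auto intro: vec.span_base)
    have int: "S \<inter> ?N = K" if S: "vec.subspace S" "K \<subseteq> S" "y - z \<notin> S" for S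
    proof (intro equalityI subsetI)
      fix x assume x: "x \<in> S \<inter> ?N"
      then obtain c where c: "x - c *s (y - z) \<in> K" using span_insert_subspace[OF K(1)] by blast
      have "x \<in> S" using x by blast
      moreover have "x - c *s (y - z) \<in> S" using c S(2) by blast
      ultimately have "x - (x - c *s (y - z)) \<in> S" by (rule vec.subspace_diff[OF S(1)])
      then have cyz: "c *s (y - z) \<in> S" by simp
      have "c = 0"
      proof (rule ccontr)
        assume "c \<noteq> 0"
        moreover have "inverse c *s (c *s (y - z)) \<in> S" by (rule vec.subspace_scale[OF S(1) cyz])
        ultimately show False using S(3) by simp
      qed
      then show "x \<in> K" using c by simp
    qed (use S KN in blast)
    show ?thesis
    proof (rule main[of ?N])
      show "vec.dim (subspace_sum Y Z) \<le> vec.dim ?N + vec.dim E" using dN dj dW d Y(3) Z(3) by simp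
      show "Y \<inter> ?N = K" "Z \<inter> ?N = K" using int[OF Y(1) _ yz(1)] int[OF Z(1) _ yz(2)] K by auto
    qed (use NM in simp_all)
  qed
qed

text \<open>Since \<open>Q\<close> has codimension \<open>dim E\<close> in \<open>sh Q\<close>,
  passing from the trace of \<open>sh Q\<close> on \<open>P\<close> to \<open>P \<inter> Q\<close>
  loses at most that much. In the scheme this is the bound l on the second index.\<close>

lemma dim_sh_Int_le:
  assumes X: "P \<in> Xm k" "Q \<in> Xm k"
  shows "vec.dim (sh P \<inter> sh Q) \<le> vec.dim (P \<inter> Q) + 2 * vec.dim E"
proof -
  have s: "vec.subspace P" "vec.subspace Q" using X by auto
  have C: "vec.subspace (sh P \<inter> sh Q)" "E \<subseteq> sh P \<inter> sh Q"
    using s E_subset_sh by (auto simp: vec.subspace_inter)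
  have 1: "vec.dim (sh P \<inter> sh Q) = vec.dim (P \<inter> (sh P \<inter> sh Q)) + vec.dim E"
    by (rule trace(3)[OF X(1) C]) blast
  have sS: "vec.subspace (P \<inter> (sh P \<inter> sh Q))" using s C by (simp add: vec.subspace_inter)
  have "subspace_sum (P \<inter> (sh P \<inter> sh Q)) Q \<subseteq> sh Q" using s subset_sh[of Q] by (intro subspace_sum_least) auto
  then have "vec.dim (subspace_sum (P \<inter> (sh P \<inter> sh Q)) Q) \<le> k + vec.dim E"
    using vec.dim_subset dim_sh[OF X(2)] by metis
  moreover have "P \<inter> (sh P \<inter> sh Q) \<inter> Q = P \<inter> Q" using subset_sh by blast
  ultimately show ?thesis using dim_subspace_sum[OF sS s(2)] 1 XmD(2)[OF X(2)] by simp
qed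

text \<open>
  Hence having intersection of dimension d < k - 1 is not transitive on three pairwise adjacent
  fibres, in contrast to adjacency along a pencil: inside a complement U of E, shear P' and R' simultaneously
  and leave Q' in place.
\<close>

lemma non_adj_triple:
  assumes X: "P \<in> Xm k" "Q \<in> Xm k" "R \<in> Xm k"
    and C: "Suc (vec.dim (sh P \<inter> sh Q)) = k + vec.dim E" "Suc (vec.dim (sh Q \<inter> sh R)) = k + vec.dim E"
      "Suc (vec.dim (sh P \<inter> sh R)) = k + vec.dim E"
    and d: "Suc d < k" "k \<le> Suc (d + vec.dim E)"
  shows "\<exists>P'\<in>Xm k. \<exists>Q'\<in>Xm k. \<exists>R'\<in>Xm k. sh P' = sh P \<and> sh Q' = sh Q \<and> sh R' = sh R \<and>
    vec.dim (P' \<inter> Q') = d \<and> vec.dim (Q' \<inter> R') = d \<and> Suc (vec.dim (P' \<inter> R')) = k"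
proof -
  have "vec.dim E \<le> CARD('k)" using vec.dim_subset[OF subset_UNIV, of E] unfolding vec_dim_card .
  then have "CARD('k) - vec.dim E + vec.dim E \<le> CARD('k)" by simp
  then obtain U where U: "U \<in> Xm (CARD('k) - vec.dim E)" using Xm_nonempty by blast
  have "vec.dim (sh U) = CARD('k)" using dim_sh[OF U] \<open>vec.dim E \<le> CARD('k)\<close> by simp
  then have shU: "sh U = UNIV"
    using vec.subspace_dim_equal[of "sh U" UNIV] U vec_dim_card[where 'a = 'a and 'n = 'k] by simp
  have t: "sh (U \<inter> C) = C" "vec.dim C = vec.dim (U \<inter> C) + vec.dim E" "U \<inter> C \<in> Xm (vec.dim (U \<inter> C))"
    if "vec.subspace C" "E \<subseteq> C" for C
    using trace[OF U that] shU by auto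
  \<comment> \<open>Every fibre has a representative inside the complement \<open>U\<close>, and
    these representatives meet as their shadows do, with dimensions lowered by that of
    \<open>E\<close>.\<close>
  define P0 Q0 R0 where "P0 = U \<inter> sh P" and "Q0 = U \<inter> sh Q" and "R0 = U \<inter> sh R"
  have sE: "vec.subspace (sh A)" "E \<subseteq> sh A" if "A \<in> Xm k" for A using that E_subset_sh by auto
  have X0: "P0 \<in> Xm k" "Q0 \<in> Xm k" "R0 \<in> Xm k"
    using t(2,3)[OF sE[OF X(1)]] t(2,3)[OF sE[OF X(2)]] t(2,3)[OF sE[OF X(3)]]
      dim_sh[OF X(1)] dim_sh[OF X(2)] dim_sh[OF X(3)] by (simp_all add: P0_def Q0_def R0_def)
  have sh0: "sh P0 = sh P" "sh Q0 = sh Q" "sh R0 = sh R"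
    using t(1) sE X by (simp_all add: P0_def Q0_def R0_def)
  have dint: "Suc (vec.dim (U \<inter> sh A \<inter> (U \<inter> sh B))) = k"
    if "A \<in> Xm k" "B \<in> Xm k" "Suc (vec.dim (sh A \<inter> sh B)) = k + vec.dim E" for A B
  proof -
    have "vec.subspace (sh A \<inter> sh B)" "E \<subseteq> sh A \<inter> sh B" using sE that by (auto simp: vec.subspace_inter)
    then have "vec.dim (sh A \<inter> sh B) = vec.dim (U \<inter> (sh A \<inter> sh B)) + vec.dim E" by (rule t(2))
    moreover have "U \<inter> sh A \<inter> (U \<inter> sh B) = U \<inter> (sh A \<inter> sh B)" by blast
    ultimately show ?thesis using that(3) by simp
  qed
  have D: "Suc (vec.dim (P0 \<inter> Q0)) = k" "Suc (vec.dim (R0 \<inter> Q0)) = k" "Suc (vec.dim (P0 \<inter> R0)) = k"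
    using dint[OF X(1,2) C(1)] dint[OF X(2,3) C(2)] dint[OF X(1,3) C(3)]
    unfolding P0_def Q0_def R0_def by (simp_all add: Int_commute)
  have s: "vec.subspace (P0 \<inter> Q0)" "vec.subspace (R0 \<inter> Q0)" using X0 by (simp_all add: vec.subspace_inter)
  obtain h where h: "shear h" "vec.dim {y \<in> P0 \<inter> Q0. h y = 0} = d" "vec.dim {z \<in> R0 \<inter> Q0. h z = 0} = d"
    using shear_with_two_kernels[OF X0(2) s(1) _ D(1) s(2) _ D(2), of d] d D by auto
  let ?T = "\<lambda>v. v + h v"
  \<comment> \<open>For \<open>x\<close> in \<open>U\<close>, the vector \<open>x + h x\<close>
    stays in \<open>U\<close> only if \<open>h x\<close> is zero, because \<open>U\<close> meets
    \<open>E\<close> trivially.\<close>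
  have int: "?T ` (U \<inter> S) \<inter> (U \<inter> S') = {y \<in> (U \<inter> S) \<inter> (U \<inter> S'). h y = 0}" for S S'
  proof (intro equalityI subsetI)
    fix w assume "w \<in> ?T ` (U \<inter> S) \<inter> (U \<inter> S')"
    then obtain x where x: "x \<in> U" "x \<in> S" "w = x + h x" "w \<in> U" "w \<in> S'" by blast
    then have "x + h x - x \<in> U" using U by (intro vec.subspace_diff) auto
    then have "h x \<in> U \<inter> E" using h(1) by (simp add: shear_def)
    then have "h x = 0" using XmD(3)[OF U] by blast
    then show "w \<in> {y \<in> (U \<inter> S) \<inter> (U \<inter> S'). h y = 0}" using x by simp
  next
    fix w assume "w \<in> {y \<in> (U \<inter> S) \<inter> (U \<inter> S'). h y = 0}"
    then show "w \<in> ?T ` (U \<inter> S) \<inter> (U \<inter> S')" by (auto intro!: image_eqI[of _ _ w])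
  qed
  have "vec.dim (?T ` P0 \<inter> Q0) = d" using h(2) int unfolding P0_def Q0_def by simp
  moreover have "vec.dim (Q0 \<inter> ?T ` R0) = d"
    using h(3) int[of "sh R" "sh Q"] Int_commute[of Q0 "?T ` R0"] unfolding R0_def Q0_def by argo
  moreover have "Suc (vec.dim (?T ` P0 \<inter> ?T ` R0)) = k"
    using idx_image[OF shear_map[OF h(1)], of P0 R0] D(3) by (simp add: idx_def)
  moreover have "sh (?T ` P0) = sh P" "sh (?T ` R0) = sh R"
    using shear_Xm(2)[OF h(1) X0(1)] shear_Xm(2)[OF h(1) X0(3)] sh0 by simp_all
  ultimately show ?thesis
    by (intro rev_bexI[OF shear_Xm(1)[OF h(1) X0(1)]] rev_bexI[OF X0(2)]
        rev_bexI[OF shear_Xm(1)[OF h(1) X0(3)]] conjI sh0(2))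
qed

text \<open>If the images met in a smaller dimension, \<open>non_adj_triple\<close> would give a
  triple in the image fibres with the index pair of \<open>\<sigma> P\<close>,
  \<open>\<sigma> Q\<close> on two sides but not on the third. Its preimages lie in the fibres of
  \<open>P\<close>, \<open>Q\<close>, \<open>R\<close>, which form a pencil, so transitivity of
  adjacency gives the contradiction. The image fibres are not assumed to form one.\<close>

lemma idx_map_adj:
  assumes \<sigma>: "idx_map k \<sigma>" and a: "adj k P Q"
  shows "adj k (\<sigma> P) (\<sigma> Q)"
proof -
  have bij: "bij_betw \<sigma> (Xm k) (Xm k)" using \<sigma> by (simp add: idx_map_def)
  then have im: "\<sigma> ` Xm k = Xm k" by (auto simp: bij_betw_def)
  have mem: "\<sigma> A \<in> Xm k" if "A \<in> Xm k" for A using im that by blast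
  have idx_iff: "idx A B = idx A' B' \<longleftrightarrow> idx (\<sigma> A) (\<sigma> B) = idx (\<sigma> A') (\<sigma> B')"
    if "A \<in> Xm k" "B \<in> Xm k" "A' \<in> Xm k" "B' \<in> Xm k" for A B A' B'
    using \<sigma> that by (simp add: idx_map_def)
  note fib = idx_map_fibre[OF \<sigma>]
  obtain R where R: "adj k P R" "adj k Q R" "P \<inter> R = P \<inter> Q" "Q \<inter> R = P \<inter> Q"
    using adj_third[OF a] by blast
  have X: "P \<in> Xm k" "Q \<in> Xm k" "R \<in> Xm k" using a R by (auto simp: adj_def)
  define d where "d = vec.dim (\<sigma> P \<inter> \<sigma> Q)"
  note dims = idx_map_adj_dim[OF \<sigma> a] idx_map_adj_dim[OF \<sigma> R(2)] idx_map_adj_dim[OF \<sigma> R(1)]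
  have same: "idx P Q = idx A B" if "adj k A B" for A B using that a adj_idx by simp
  have le: "d + vec.dim E \<le> vec.dim (sh (\<sigma> P) \<inter> sh (\<sigma> Q))"
    unfolding d_def by (rule dim_Int_le[OF mem[OF X(1)] mem[OF X(2)]])
  have ge: "k \<le> Suc (d + vec.dim E)"
    using dim_sh_Int_le[OF mem[OF X(1)] mem[OF X(2)]] dims(1) unfolding d_def by simp
  show ?thesis
  proof (cases "Suc d = k")
    case True
    moreover have "sh (\<sigma> P) \<noteq> sh (\<sigma> Q)" using fib[OF X(1,2)] a by (simp add: adj_def)
    ultimately show ?thesis using mem X by (simp add: adj_def d_def)
  next
    case False
    then have "Suc d < k" using le dims(1) by simp
    then obtain P' Q' R' where X': "P' \<in> Xm k" "Q' \<in> Xm k" "R' \<in> Xm k"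
      and sh': "sh P' = sh (\<sigma> P)" "sh Q' = sh (\<sigma> Q)" "sh R' = sh (\<sigma> R)"
      and d': "vec.dim (P' \<inter> Q') = d" "vec.dim (Q' \<inter> R') = d" "Suc (vec.dim (P' \<inter> R')) = k"
      using non_adj_triple[OF mem[OF X(1)] mem[OF X(2)] mem[OF X(3)] dims _ ge] by blast
    have "P' \<in> \<sigma> ` Xm k" "Q' \<in> \<sigma> ` Xm k" "R' \<in> \<sigma> ` Xm k" using X' im by simp_all
    then obtain A B C where A: "A \<in> Xm k" "P' = \<sigma> A" and B: "B \<in> Xm k" "Q' = \<sigma> B"
      and C: "C \<in> Xm k" "R' = \<sigma> C" by (elim imageE)
    have shA: "sh A = sh P" "sh B = sh Q" "sh C = sh R"
      using fib[OF A(1) X(1)] fib[OF B(1) X(2)] fib[OF C(1) X(3)] sh' A B C by simp_all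
    have i: "idx (\<sigma> A) (\<sigma> B) = idx (\<sigma> P) (\<sigma> Q)" "idx (\<sigma> B) (\<sigma> C) = idx (\<sigma> P) (\<sigma> Q)"
      using sh' d' A B C dims unfolding idx_def d_def by simp_all
    have "idx A B = idx P Q" "idx B C = idx P Q"
      using i idx_iff[OF A(1) B(1) X(1,2)] idx_iff[OF B(1) C(1) X(1,2)] by simp_all
    then have adj: "adj k A B" "adj k B C" using A B C a by (simp_all add: adj_idx)
    have "sh A \<noteq> sh C" using shA R(1) by (simp add: adj_def)
    moreover have "sh A \<inter> sh B = sh (P \<inter> Q)" "sh B \<inter> sh C = sh (P \<inter> Q)" "sh A \<inter> sh C = sh (P \<inter> Q)"
      using shA adj_sh_Int[OF a] adj_sh_Int[OF R(1)] adj_sh_Int[OF R(2)] R(3,4) by simp_all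
    ultimately have "adj k A C" using adj_pencil_trans[OF adj A(1) C(1)] by blast
    then have "idx (\<sigma> P) (\<sigma> Q) = idx (\<sigma> A) (\<sigma> C)"
      using idx_iff[OF X(1,2) A(1) C(1)] same by blast
    then have "d = vec.dim (P' \<inter> R')" using A C by (simp add: idx_def d_def)
    then show ?thesis using d' False by simp
  qed
qed

lemma idx_map_inv:
  assumes \<sigma>: "idx_map k \<sigma>"
  shows "idx_map k (inv_into (Xm k) \<sigma>)"
proof -
  have bij: "bij_betw \<sigma> (Xm k) (Xm k)" using \<sigma> by (simp add: idx_map_def)
  have inv: "\<sigma> (inv_into (Xm k) \<sigma> A) = A" "inv_into (Xm k) \<sigma> A \<in> Xm k" if "A \<in> Xm k" for A
    using bij that by (auto simp: bij_betw_inv_into_right dest: bij_betw_inv_into bij_betwE)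
  show ?thesis
    unfolding idx_map_def using bij_betw_inv_into[OF bij] \<sigma> inv unfolding idx_map_def by simp
qed

theorem idx_map_preserving:
  assumes \<sigma>: "idx_map k \<sigma>"
  shows "preserving k \<sigma>"
proof -
  have bij: "bij_betw \<sigma> (Xm k) (Xm k)" using \<sigma> by (simp add: idx_map_def)
  have "adj k P Q \<longleftrightarrow> adj k (\<sigma> P) (\<sigma> Q)" if "P \<in> Xm k" "Q \<in> Xm k" for P Q
    using idx_map_adj[OF \<sigma>, of P Q] idx_map_adj[OF idx_map_inv[OF \<sigma>], of "\<sigma> P" "\<sigma> Q"]
      bij_betw_inv_into_left[OF bij] that by auto
  then show ?thesis unfolding preserving_def using bij idx_map_fibre[OF \<sigma>] by blast
qed


subsection \<open>The stabilizer of E and the automorphism group\<close>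

text \<open>Being fixed passes down one dimension at a time, since \<open>S\<close> is the
  intersection of its star.\<close>

lemma fixes_points:
  assumes G: "semilinear G" "bij G" "G ` E = E" and k: "1 \<le> k" "k + vec.dim E < CARD('k)"
    and fixed: "\<forall>P\<in>Xm k. G ` P = P"
  shows "\<forall>p\<in>Xm 1. G ` p = p"
  using k fixed
proof (induction k rule: dec_induct)
  case (step k)
  have "\<forall>S\<in>Xm k. G ` S = S"
  proof
    fix S assume S: "S \<in> Xm k"
    have "G ` S \<subseteq> P" if P: "P \<in> star (Suc k) S" for P
    proof -
      have "G ` S \<subseteq> G ` P" using P by (auto simp: star_def)
      then show ?thesis using step.prems(2) P by (simp add: star_def)
    qed
    then have "G ` S \<subseteq> \<Inter> (star (Suc k) S)" by blast
    then have "G ` S \<subseteq> S" using Inter_star(1)[OF S step.prems(1)] by simp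
    then show "G ` S = S" using Xm_eqI[OF Xm_image[OF G S] S] by blast
  qed
  moreover have "k + vec.dim E < CARD('k)" using step.prems(1) by simp
  ultimately show ?case using step.IH by blast
qed simp

text \<open>Vectors independent modulo \<open>E\<close> have equal eigenvalues because their sum is
  an eigenvector too. The vectors in the span of \<open>v\<close> and \<open>E\<close>, in
  particular those of \<open>E\<close>, are reached as differences of vectors outside it.\<close>

lemma scalar_if_fixes_points:
  assumes G: "semilinear G" "bij G" and dim: "vec.dim E + 2 \<le> CARD('k)"
    and fixed: "\<forall>p\<in>Xm 1. G ` p = p"
  shows "\<exists>c. c \<noteq> 0 \<and> (\<forall>v. G v = c *s v)"
proof -
  have add: "G (u + v) = G u + G v" for u v using G(1) by (simp add: semilinear_def)
  have ev: "\<exists>c. G v = c *s v" if v: "v \<notin> E" for v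
  proof -
    have "G ` vec.span {v} = vec.span {v}" using fixed point_Xm[OF v] by blast
    moreover have "v \<in> vec.span {v}" by (simp add: vec.span_base)
    ultimately have "G v \<in> vec.span {v}" by blast
    then show ?thesis by (auto simp: vec.span_singleton)
  qed
  obtain v where v: "v \<notin> E" using exists_notin[of E] dim by auto
  obtain c where c: "G v = c *s v" using ev v by blast
  have off: "G w = c *s w" if w: "w \<notin> vec.span (insert v E)" for w
  proof -
    have wE: "w \<notin> E" using w by (auto intro: vec.span_base)
    have vw: "v + w \<notin> E"
    proof
      assume "v + w \<in> E"
      then have "1 *s v + 1 *s w \<in> E" by simp
      then show False using not_in_span_insert[OF subspace_E v w, of 1 1] by simp
    qed
    obtain a b where ab: "G w = a *s w" "G (v + w) = b *s (v + w)" using ev wE vw by metis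
    then have "b *s v + b *s w = c *s v + a *s w" using add[of v w] c by (simp add: vec.scale_right_distrib)
    then have "(b - c) *s v + (b - a) *s w = 0" by (simp add: algebra_simps vector_sub_rdistrib)
    then have "(b - c) *s v + (b - a) *s w \<in> E" by (simp only: vec.subspace_0[OF subspace_E])
    then have "b - c = 0 \<and> b - a = 0" by (rule not_in_span_insert[OF subspace_E v w])
    then have "a = c" by auto
    then show ?thesis using ab by simp
  qed
  have "vec.dim (vec.span (insert v E)) < CARD('k)" using dim_span_insert[OF subspace_E v] dim by simp
  then obtain z where z: "z \<notin> vec.span (insert v E)" using exists_notin by blast
  have all: "G w = c *s w" for w
  proof (cases "w \<in> vec.span (insert v E)")
    case True
    have "z + w \<notin> vec.span (insert v E)"
    proof
      assume "z + w \<in> vec.span (insert v E)"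
      then have "z + w - w \<in> vec.span (insert v E)" using True by (rule vec.span_diff)
      then show False using z by simp
    qed
    then have "G (z + w) = c *s (z + w)" by (rule off)
    then show ?thesis using off[OF z] add[of z w] by (simp add: vec.scale_right_distrib)
  qed (rule off)
  have "c \<noteq> 0"
  proof
    assume "c = 0"
    then have "G v = G 0" using all[of v] all[of 0] by simp
    then have "v = 0" using G(2) by (simp add: bij_is_inj inj_eq)
    then show False using v vec.subspace_0[OF subspace_E] by simp
  qed
  then show ?thesis using all by blast
qed

end

section \<open>Coordinates and the relations of the scheme\<close>

lemma in_E_space:
  fixes v :: "'a::field ^ ('n::finite + 'l::finite)"
  shows "v \<in> E_space \<longleftrightarrow> first_part v = 0"
proof
  have "vec.subspace {v :: 'a ^ ('n + 'l). first_part v = 0}"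
    by (auto simp: vec.subspace_def first_part_def vec_eq_iff)
  moreover have "range (\<lambda>j::'l. axis (Inr j) 1) \<subseteq> {v :: 'a ^ ('n + 'l). first_part v = 0}"
    by (auto simp: first_part_def vec_eq_iff axis_def)
  ultimately have "E_space \<subseteq> {v :: 'a ^ ('n + 'l). first_part v = 0}"
    unfolding E_space_def by (intro vec.span_minimal)
  then show "v \<in> E_space \<Longrightarrow> first_part v = 0" by blast
next
  assume v: "first_part v = 0"
  have "(v $ i) *s axis i 1 \<in> (E_space :: ('a ^ ('n + 'l)) set)" for i
  proof (cases i)
    case (Inl j)
    then have "v $ i = 0" using v by (simp add: first_part_def vec_eq_iff)
    then show ?thesis by (simp add: E_space_def vec.span_zero)
  next
    case (Inr j)
    have "axis (Inr j) 1 \<in> (E_space :: ('a ^ ('n + 'l)) set)"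
      unfolding E_space_def by (rule vec.span_base) (rule rangeI)
    then show ?thesis unfolding E_space_def Inr by (rule vec.span_scale)
  qed
  then have "(\<Sum>i\<in>UNIV. (v $ i) *s axis i 1) \<in> E_space"
    unfolding E_space_def by (intro vec.span_sum) simp
  then show "v \<in> E_space" by (simp add: basis_expansion)
qed

lemma dim_E_space: "vec.dim (E_space :: ('a::field ^ ('n::finite + 'l::finite)) set) = CARD('l)"
proof -
  let ?B = "range (\<lambda>j::'l. axis (Inr j) 1) :: ('a ^ ('n + 'l)) set"
  have "?B \<subseteq> cart_basis" by (auto simp: cart_basis_def)
  then have "vec.independent ?B" using independent_cart_basis vec.independent_mono by blast
  then have "vec.dim (E_space :: ('a ^ ('n + 'l)) set) = card ?B"
    unfolding E_space_def by (rule vec.dim_span_eq_card_independent)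
  also have "card ?B = CARD('l)" by (rule card_image) (auto simp: inj_on_def axis_eq_axis)
  finally show ?thesis .
qed

interpretation att: attenuated "E_space :: ('a::{field,finite} ^ ('n::finite + 'l::finite)) set"
proof
  show "vec.subspace (E_space :: ('a ^ ('n + 'l)) set)" by (simp add: E_space_def)
  show "(E_space :: ('a ^ ('n + 'l)) set) \<noteq> {0}"
    using dim_E_space[where 'a = 'a and 'n = 'n and 'l = 'l] by (metis less_irrefl vec.dim_singleton zero_less_card_finite)
qed

lemma X_eq: "X m = (att.Xm m :: ('a::{field,finite} ^ ('n::finite + 'l::finite)) set set)"
proof -
  have "vec.dim (P \<inter> E_space) = 0 \<longleftrightarrow> P \<inter> E_space = {0}" if "vec.subspace P" for P :: "('a ^ ('n + 'l)) set"
    using vec.subspace_0[OF that] vec.subspace_0[OF att.subspace_E] by auto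
  then show ?thesis unfolding X_def has_type_def att.Xm_def by auto
qed

lemma linear_first_part: "Vector_Spaces.linear (*s) (*s) (first_part :: 'a::field ^ ('n::finite + 'l::finite) \<Rightarrow> 'a ^ 'n)"
  by unfold_locales (auto simp: first_part_def vec_eq_iff)

text \<open>\<open>first_part\<close> is the quotient map by \<open>E_space\<close>, and the shadows
  are the full preimages of the prime parts.\<close>

lemma prime_part_Int:
  fixes P Q :: "('a::{field,finite} ^ ('n::finite + 'l::finite)) set"
  shows "prime_part P \<inter> prime_part Q = first_part ` (att.sh P \<inter> att.sh Q)"
proof (intro equalityI subsetI)
  interpret Vector_Spaces.linear "(*s)" "(*s)" "first_part :: 'a ^ ('n + 'l) \<Rightarrow> 'a ^ 'n" by (rule linear_first_part)
  fix x :: "'a ^ 'n" assume "x \<in> prime_part P \<inter> prime_part Q"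
  then obtain p q where pq: "p \<in> P" "q \<in> Q" "x = first_part p" "x = first_part q"
    unfolding prime_part_def by blast
  then have "q - p \<in> E_space" by (simp add: in_E_space diff)
  moreover have "p + (q - p) \<in> Q" using pq by simp
  ultimately have "p \<in> att.sh Q" unfolding att.in_sh by blast
  then show "x \<in> first_part ` (att.sh P \<inter> att.sh Q)" using pq att.subset_sh[of P] by blast
next
  interpret Vector_Spaces.linear "(*s)" "(*s)" "first_part :: 'a ^ ('n + 'l) \<Rightarrow> 'a ^ 'n" by (rule linear_first_part)
  have *: "first_part v \<in> prime_part R" if "v \<in> att.sh R" for v and R :: "('a ^ ('n + 'l)) set"
  proof -
    obtain e where e: "e \<in> E_space" "v + e \<in> R" using \<open>v \<in> att.sh R\<close> unfolding att.in_sh by blast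
    then have "first_part v = first_part (v + e)" by (simp add: in_E_space add)
    then show ?thesis using e by (simp add: prime_part_def)
  qed
  fix x :: "'a ^ 'n" assume "x \<in> first_part ` (att.sh P \<inter> att.sh Q)"
  then show "x \<in> prime_part P \<inter> prime_part Q" using * by blast
qed

lemma dim_prime_part_Int:
  fixes P Q :: "('a::{field,finite} ^ ('n::finite + 'l::finite)) set"
  assumes "P \<in> att.Xm m" "Q \<in> att.Xm m"
  shows "vec.dim (prime_part P \<inter> prime_part Q) + CARD('l) = vec.dim (att.sh P \<inter> att.sh Q)"
proof -
  interpret Vector_Spaces.linear "(*s)" "(*s)" "first_part :: 'a ^ ('n + 'l) \<Rightarrow> 'a ^ 'n" by (rule linear_first_part)
  let ?C = "att.sh P \<inter> att.sh Q"
  have C: "vec.subspace ?C" "E_space \<subseteq> ?C" "?C \<subseteq> att.sh P"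
    using assms att.E_subset_sh[OF att.subspace_Xm[OF assms(1)]] att.E_subset_sh[OF att.subspace_Xm[OF assms(2)]]
    by (auto simp: vec.subspace_inter)
  note t = att.trace[OF assms(1) C]
  have sW: "vec.subspace (P \<inter> ?C)" using assms C by (simp add: vec.subspace_inter)
  have "first_part ` ?C = first_part ` (P \<inter> ?C)"
  proof -
    have "prime_part (P \<inter> ?C) = prime_part (P \<inter> ?C) \<inter> prime_part (P \<inter> ?C)" by simp
    also have "\<dots> = first_part ` ?C" unfolding prime_part_Int t(1) by simp
    finally show ?thesis by (simp add: prime_part_def)
  qed
  moreover have "inj_on (first_part :: 'a ^ ('n + 'l) \<Rightarrow> 'a ^ 'n) (P \<inter> ?C)"
  proof (rule inj_onI)
    fix u v :: "'a ^ ('n + 'l)"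
    assume uv: "u \<in> P \<inter> ?C" "v \<in> P \<inter> ?C" "first_part u = (first_part v :: 'a ^ 'n)"
    have "u - v \<in> P \<inter> ?C" using vec.subspace_diff[OF sW uv(1,2)] .
    moreover have "u - v \<in> E_space" using uv(3) by (simp add: in_E_space diff)
    ultimately have "u - v \<in> {0}" using att.XmD(3)[OF assms(1)] by blast
    then show "u = v" by simp
  qed
  then have "vec.dim (first_part ` (P \<inter> ?C) :: ('a ^ 'n) set) = vec.dim (P \<inter> ?C)"
    using sW by (intro vec.dim_image_eq linear_first_part) (simp add: vec.span_eq_iff[THEN iffD2])
  ultimately show ?thesis using t(3) prime_part_Int[of P Q] by (simp add: dim_E_space)
qed

lemma scheme_rel_iff:
  fixes P Q :: "('a::{field,finite} ^ ('n::finite + 'l::finite)) set"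
  shows "(P, Q) \<in> scheme_rel m i j \<longleftrightarrow> P \<in> att.Xm m \<and> Q \<in> att.Xm m \<and>
    att.idx P Q = (m - i + CARD('l), m - j)"
  using dim_prime_part_Int[of P m Q] unfolding scheme_rel_def X_eq att.idx_def by auto

text \<open>The index bounds follow from dimension formulas: the sum of the two shadows fits into
  the whole space, and \<open>dim_sh_Int_le\<close> limits the loss from the prime parts to the
  subspaces.\<close>

lemma scheme_rel_exists:
  fixes P Q :: "('a::{field,finite} ^ ('n::finite + 'l::finite)) set"
  assumes PQ: "P \<in> att.Xm m" "Q \<in> att.Xm m" and m: "m \<le> CARD('n)"
  shows "\<exists>R\<in>scheme_rels m. (P, Q) \<in> R"
proof -
  define a where "a = vec.dim (prime_part P \<inter> prime_part Q)"
  define b where "b = vec.dim (P \<inter> Q)"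
  have a: "a + CARD('l) = vec.dim (att.sh P \<inter> att.sh Q)"
    unfolding a_def by (rule dim_prime_part_Int[OF PQ])
  have am: "a \<le> m"
    using vec.dim_subset[of "att.sh P \<inter> att.sh Q" "att.sh P"] att.dim_sh[OF PQ(1)] a by (simp add: dim_E_space)
  have ba: "b \<le> a" using att.dim_Int_le[OF PQ] a unfolding b_def by (simp add: dim_E_space)
  have ab: "a \<le> b + CARD('l)" using att.dim_sh_Int_le[OF PQ] a unfolding b_def by (simp add: dim_E_space)
  have "vec.dim (subspace_sum (att.sh P) (att.sh Q)) \<le> CARD('n) + CARD('l)"
    using vec.dim_subset[OF subset_UNIV, of "subspace_sum (att.sh P) (att.sh Q)"] unfolding vec_dim_card by simp
  then have mn: "2 * m \<le> CARD('n) + a"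
    using dim_subspace_sum[of "att.sh P" "att.sh Q"] PQ a att.dim_sh[OF PQ(1)] att.dim_sh[OF PQ(2)]
    by (simp add: dim_E_space)
  have "(P, Q) \<in> scheme_rel m (m - a) (m - b)"
    using PQ am ba a unfolding scheme_rel_iff att.idx_def b_def by simp
  moreover have "scheme_rel m (m - a) (m - b) \<in> (scheme_rels m :: (('a ^ ('n + 'l)) set \<times> _) set set)"
  proof -
    have "m - a \<le> min m (CARD('n) - m)" "m - a \<le> m - b"
      "m - b - (m - a) \<le> min (min (m - (m - a)) (m - b)) CARD('l)"
      using am ba ab mn m by (simp_all add: le_diff_conv diff_le_mono)
    then show ?thesis unfolding scheme_rels_def by blast
  qed
  ultimately show ?thesis by blast
qed

text \<open>All pairs in one relation have the same index pair, so mapping relations into relations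
  keeps equal index pairs equal.\<close>

lemma scheme_auts_idx_map:
  fixes \<sigma> :: "('a::{field,finite} ^ ('n::finite + 'l::finite)) set \<Rightarrow> ('a ^ ('n + 'l)) set"
  assumes \<sigma>: "\<sigma> \<in> scheme_auts (X m) (scheme_rels m)" and m: "m \<le> CARD('n)"
  shows "att.idx_map m \<sigma>"
proof (rule att.idx_mapI)
  show "bij_betw \<sigma> (att.Xm m) (att.Xm m)" using \<sigma> by (simp add: scheme_auts_def Bij_def X_eq)
  fix P Q P' Q' :: "('a ^ ('n + 'l)) set"
  assume X: "P \<in> att.Xm m" "Q \<in> att.Xm m" "P' \<in> att.Xm m" "Q' \<in> att.Xm m" and eq: "att.idx P Q = att.idx P' Q'"
  obtain R where R: "R \<in> scheme_rels m" "(P, Q) \<in> R" using scheme_rel_exists[OF X(1,2) m] by blast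
  have R': "(P', Q') \<in> R" using R X eq by (auto simp: scheme_rels_def scheme_rel_iff)
  obtain S where S: "S \<in> scheme_rels m" "\<forall>(x, y)\<in>R. (\<sigma> x, \<sigma> y) \<in> S" using \<sigma> R(1) unfolding scheme_auts_def by blast
  then have "(\<sigma> P, \<sigma> Q) \<in> S" "(\<sigma> P', \<sigma> Q') \<in> S" using R(2) R' by auto
  then show "att.idx (\<sigma> P) (\<sigma> Q) = att.idx (\<sigma> P') (\<sigma> Q')"
    using S(1) by (auto simp: scheme_rels_def scheme_rel_iff)
qed

lemma image_scheme_aut:
  fixes g :: "'a::{field,finite} ^ ('n::finite + 'l::finite) \<Rightarrow> 'a ^ ('n + 'l)"
  assumes g: "semilinear g" "bij g" "g ` E_space = E_space"
  shows "(\<lambda>P\<in>X m. g ` P) \<in> scheme_auts (X m) (scheme_rels m)"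
proof -
  have inj: "inj_on (\<lambda>P\<in>X m. g ` P) (X m)"
    using bij_is_inj[OF g(2)] by (auto simp: inj_on_def inj_image_eq_iff)
  moreover have "(\<lambda>P\<in>X m. g ` P) ` X m \<subseteq> X m" using att.Xm_image[OF g] by (auto simp: X_eq)
  ultimately have "bij_betw (\<lambda>P\<in>X m. g ` P) (X m) (X m)"
    unfolding bij_betw_def using endo_inj_surj[OF finite] by blast
  then have "(\<lambda>P\<in>X m. g ` P) \<in> Bij (X m)" by (simp add: Bij_def)
  moreover have "\<forall>(P, Q)\<in>R. ((\<lambda>P\<in>X m. g ` P) P, (\<lambda>P\<in>X m. g ` P) Q) \<in> R" if "R \<in> scheme_rels m" for R
    using that att.Xm_image[OF g] att.idx_image[OF g] by (auto simp: scheme_rels_def scheme_rel_iff X_eq)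
  ultimately show ?thesis unfolding scheme_auts_def by blast
qed

section \<open>The action as an isomorphism of groups\<close>

lemma PGammaL_E_carrier:
  "C \<in> carrier PGammaL_E \<longleftrightarrow>
    (\<exists>g. semilinear g \<and> bij g \<and> g ` E_space = E_space \<and> C = scalar_maps #>\<^bsub>GammaL\<^esub> g)"
proof -
  have "C \<in> carrier PGammaL_E \<longleftrightarrow>
      (\<exists>g\<in>carrier GammaL. C = scalar_maps #>\<^bsub>GammaL\<^esub> g \<and> pact C E_space = E_space)"
    unfolding PGammaL_E_def PGammaL_def FactGroup_def RCOSETS_def by auto
  also have "\<dots> \<longleftrightarrow> (\<exists>g\<in>carrier GammaL. C = scalar_maps #>\<^bsub>GammaL\<^esub> g \<and> g ` E_space = E_space)"
    using pact_coset[of _ E_space] by (auto simp: E_space_def)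
  finally show ?thesis by (auto simp: GammaL_def)
qed

lemma X_action_coset:
  assumes "semilinear g" "bij g"
  shows "X_action m (scalar_maps #>\<^bsub>GammaL\<^esub> g) = (\<lambda>P\<in>X m. g ` P)"
  unfolding X_action_def using assms
  by (intro restrict_ext pact_coset) (auto simp: GammaL_def X_def has_type_def)

theorem theorem1p3:
  fixes m :: nat
  assumes "1 < m" and "m < CARD('n::finite) - 1"
  shows "(X_action m :: ('a::{field,finite} ^ ('n + 'l::finite) \<Rightarrow> 'a ^ ('n + 'l)) set
            \<Rightarrow> ('a ^ ('n + 'l)) set \<Rightarrow> ('a ^ ('n + 'l)) set)
         \<in> iso PGammaL_E (AutX m)"
proof -
  let ?f = "X_action m :: ('a ^ ('n + 'l) \<Rightarrow> 'a ^ ('n + 'l)) set \<Rightarrow> ('a ^ ('n + 'l)) set \<Rightarrow> ('a ^ ('n + 'l)) set"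
  let ?E = "E_space :: ('a ^ ('n + 'l)) set"
  interpret N: normal scalar_maps "GammaL :: ('a ^ ('n + 'l) \<Rightarrow> 'a ^ ('n + 'l)) monoid"
    by (rule normal_scalar_maps)
  have card: "CARD('n + 'l) = CARD('n) + CARD('l)" by simp
  have aut: "?f C \<in> carrier (AutX m)" if "C \<in> carrier PGammaL_E" for C
    using that by (auto simp: PGammaL_E_carrier X_action_coset image_scheme_aut AutX_def)
  have "?f \<in> hom PGammaL_E (AutX m)"
  proof (rule homI)
    fix C D :: "('a ^ ('n + 'l) \<Rightarrow> 'a ^ ('n + 'l)) set"
    assume C: "C \<in> carrier PGammaL_E" and D: "D \<in> carrier PGammaL_E"
    obtain g where g: "semilinear g" "bij g" "g ` ?E = ?E" "C = scalar_maps #>\<^bsub>GammaL\<^esub> g"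
      using C unfolding PGammaL_E_carrier by blast
    obtain h where h: "semilinear h" "bij h" "h ` ?E = ?E" "D = scalar_maps #>\<^bsub>GammaL\<^esub> h"
      using D unfolding PGammaL_E_carrier by blast
    have gG: "g \<in> carrier GammaL" "h \<in> carrier GammaL" using g h by (auto simp: GammaL_def)
    have "g \<circ> h \<in> carrier GammaL" using N.m_closed[OF gG] by (simp add: GammaL_def)
    then have gh: "semilinear (g \<circ> h)" "bij (g \<circ> h)" by (auto simp: GammaL_def)
    have "C \<otimes>\<^bsub>PGammaL_E\<^esub> D = scalar_maps #>\<^bsub>GammaL\<^esub> (g \<circ> h)"
      using N.rcos_sum[OF gG] g(4) h(4) by (simp add: PGammaL_E_def PGammaL_def FactGroup_def GammaL_def)
    then have "?f (C \<otimes>\<^bsub>PGammaL_E\<^esub> D) = (\<lambda>P\<in>X m. (g \<circ> h) ` P)" using X_action_coset[OF gh] by simp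
    also have "\<dots> = compose (X m) (?f C) (?f D)"
      unfolding g(4) h(4) X_action_coset[OF g(1,2)] X_action_coset[OF h(1,2)] compose_def
      by (rule restrict_ext) (use att.Xm_image[OF h(1-3), of _ m] in \<open>simp add: X_eq image_comp\<close>)
    also have "\<dots> = ?f C \<otimes>\<^bsub>AutX m\<^esub> ?f D"
      using aut[OF C] aut[OF D] by (simp add: AutX_def BijGroup_def scheme_auts_def)
    finally show "?f (C \<otimes>\<^bsub>PGammaL_E\<^esub> D) = ?f C \<otimes>\<^bsub>AutX m\<^esub> ?f D" .
  qed (rule aut)
  moreover have "inj_on ?f (carrier PGammaL_E)"
  proof (rule inj_onI)
    fix C D :: "('a ^ ('n + 'l) \<Rightarrow> 'a ^ ('n + 'l)) set"
    assume C: "C \<in> carrier PGammaL_E" and D: "D \<in> carrier PGammaL_E" and eq: "?f C = ?f D"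
    obtain g where g: "semilinear g" "bij g" "g ` ?E = ?E" "C = scalar_maps #>\<^bsub>GammaL\<^esub> g"
      using C unfolding PGammaL_E_carrier by blast
    obtain h where h: "semilinear h" "bij h" "h ` ?E = ?E" "D = scalar_maps #>\<^bsub>GammaL\<^esub> h"
      using D unfolding PGammaL_E_carrier by blast
    have gG: "g \<in> carrier GammaL" "h \<in> carrier GammaL" using g h by (auto simp: GammaL_def)
    \<comment> \<open>The quotient of the two representatives fixes every member of
      \<open>X m\<close> and hence is a scalar \<open>c\<close>. Moved past the semilinear
      \<open>h\<close>, the scalar becomes its image under the field automorphism of
      \<open>h\<close>, so \<open>g\<close> and \<open>h\<close> lie in the same coset.\<close>
    define k where "k = inv_into UNIV h \<circ> g"
    have hi: "inv_into UNIV h \<in> carrier GammaL"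
      using semilinear_inv[OF h(2,1)] h(2) by (simp add: GammaL_def bij_imp_bij_inv)
    have "k \<in> carrier GammaL" using N.m_closed[OF hi gG(1)] by (simp add: k_def GammaL_def)
    then have k: "semilinear k" "bij k" by (auto simp: GammaL_def)
    have kim: "k ` S = S" if "g ` S = h ` S" for S
    proof -
      have "k ` S = inv_into UNIV h ` (g ` S)" unfolding k_def by (rule image_comp[symmetric])
      then show ?thesis unfolding that image_inv_f_f[OF bij_is_inj[OF h(2)]] .
    qed
    have gh: "g ` P = h ` P" if "P \<in> att.Xm m" for P
    proof -
      have "?f C P = ?f D P" using eq by simp
      then show ?thesis using that unfolding g(4) h(4) X_action_coset[OF g(1,2)] X_action_coset[OF h(1,2)]
        by (simp add: X_eq)
    qed
    have kX: "\<forall>P\<in>att.Xm m. k ` P = P" by (intro ballI kim gh)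
    have kE: "k ` ?E = ?E" by (rule kim) (simp only: g(3) h(3))
    have k1: "\<forall>p\<in>att.Xm 1. k ` p = p"
      by (rule att.fixes_points[OF k kE _ _ kX]) (use assms in \<open>simp_all add: dim_E_space\<close>)
    have "vec.dim ?E + 2 \<le> CARD('n + 'l)" using assms by (simp add: dim_E_space)
    from att.scalar_if_fixes_points[OF k this k1]
    obtain c where c: "c \<noteq> 0" "\<forall>v. k v = c *s v" by (elim exE conjE)
    obtain \<tau> where t: "field_aut \<tau>" "\<And>c v. h (c *s v) = \<tau> c *s h v"
      using h(1) by (auto simp: semilinear_def)
    have "g v = \<tau> c *s h v" for v
    proof -
      have "g v = h (k v)" using h(2) by (simp add: k_def bij_is_surj surj_f_inv_f)
      then show ?thesis using c t by simp
    qed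
    then have "g = (*s) (\<tau> c) \<otimes>\<^bsub>GammaL\<^esub> h" by (simp add: GammaL_def fun_eq_iff)
    moreover have "(*s) (\<tau> c) \<in> scalar_maps" by (rule scalar_mapsI[OF field_aut_nonzero[OF t(1) c(1)]])
    ultimately have "g \<in> scalar_maps #>\<^bsub>GammaL\<^esub> h" unfolding r_coset_def by blast
    then have "scalar_maps #>\<^bsub>GammaL\<^esub> h = scalar_maps #>\<^bsub>GammaL\<^esub> g"
      by (rule N.repr_independence[OF _ gG(2) N.subgroup_axioms])
    then show "C = D" using g(4) h(4) by simp
  qed
  moreover have "\<sigma> \<in> ?f ` carrier PGammaL_E" if \<sigma>: "\<sigma> \<in> carrier (AutX m)" for \<sigma>
  proof -
    have \<sigma>': "\<sigma> \<in> scheme_auts (X m) (scheme_rels m)" using \<sigma> by (simp add: AutX_def)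
    have pres: "att.preserving m \<sigma>"
      using att.idx_map_preserving[OF scheme_auts_idx_map[OF \<sigma>']] assms by simp
    have "2 \<le> m" "m + vec.dim ?E < CARD('n + 'l)" using assms by (simp_all add: dim_E_space)
    from att.preserving_semilinear[OF this pres]
    obtain G where G: "semilinear G" "bij G" "G ` ?E = ?E" "\<forall>P\<in>att.Xm m. \<sigma> P = G ` P"
      by (elim exE conjE)
    have "scalar_maps #>\<^bsub>GammaL\<^esub> G \<in> carrier PGammaL_E" using G PGammaL_E_carrier by blast
    moreover have "\<sigma> = ?f (scalar_maps #>\<^bsub>GammaL\<^esub> G)"
    proof (rule extensionalityI)
      show "\<sigma> \<in> extensional (X m)" using \<sigma>' by (simp add: scheme_auts_def Bij_def)
      show "?f (scalar_maps #>\<^bsub>GammaL\<^esub> G) \<in> extensional (X m)" by (simp add: X_action_def)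
      show "\<sigma> P = ?f (scalar_maps #>\<^bsub>GammaL\<^esub> G) P" if "P \<in> X m" for P
        using that G(4) unfolding X_action_coset[OF G(1,2)] by (simp add: X_eq)
    qed
    ultimately show ?thesis by blast
  qed
  ultimately show ?thesis unfolding iso_def bij_betw_def using aut by blast
qed

end
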